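(* Let $n\ge 1$, let $D\subset\mathbf R^n$ be a bounded domain, let $\max\{1,\tfrac n2\}<r\le\infty$, and let $q=r^*$ be the Hölder conjugate exponent of $r$. Suppose that for some real-valued $V\in L^r(D)$ the Schrödinger equation $-\Delta u=Vu$ in $D$ has a nontrivial (complex-valued) distributional solution $u\in W^{1,2}_0(D)$. Then $$K_q(D)^2\,\|V_+\|_{r}\ \ge\ 1 .$$ Moreover, equality is attained: denoting by $u_*$ an extremal for the Sobolev inequality defining $K_q(D)$ (that is, $u_*\in W_0^{1,2}(D)$, $u_*\neq 0$, $K_q(D)=\|u_*\|_{2q}/\|\nabla u_*\|_2$), and setting $$V(x)=\frac{\|\nabla u_*\|_2^2}{\|u_*\|_{2q}^{2q}}\,|u_*(x)|^{2q-2},$$ the function $u=u_*$ satisfies $-\Delta u_*=Vu_*$ in the sense of distributions and $K_q(D)^2\|V_+\|_r=1$.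
   Context: $W^{1,2}_0(D)$ is the closure of $C_0^\infty(D)$ with respect to the norm $\|\nabla u\|_2$. $\|\cdot\|_p$ is the norm of $L^p(D)$. $V_+=\max\{V,0\}$. The conjugate exponent satisfies $\frac1q+\frac1r=1$, with $\infty^*=1$. The Sobolev constant is $K_q(D)=\sup\{\|u\|_{2q}/\|\nabla u\|_2 : u\in W^{1,2}_0(D),\ u\ne0\}$. A function $u\in W_0^{1,2}(D)$ is a distributional solution of $-\Delta u=Vu$ if $\int_D\nabla u\cdot\nabla\psi\,dx=\int_D Vu\psi\,dx$ for all $\psi\in C_0^\infty(D)$; it is nontrivial if it is not a.e. zero. *)

theory Defs
  imports "HOL-Probability.Essential_Supremum"
begin

section \<open>Lebesgue norms\<close>

(* The value of the norm is extended (infinity is allowed), so that no finiteness has to be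
   presupposed, e.g. in the supremum defining the Sobolev constant. Meaningful for p \<ge> 1. *)
definition Lp_norm :: "ennreal \<Rightarrow> 'a measure \<Rightarrow> ('a \<Rightarrow> 'b::real_normed_vector) \<Rightarrow> ennreal" where
  "Lp_norm p M f =
     (if p = \<infinity> then esssup M (\<lambda>x. ennreal (norm (f x)))
      else (let I = (\<integral>\<^sup>+ x. ennreal (norm (f x) powr enn2real p) \<partial>M)
            in if I = \<infinity> then \<infinity> else ennreal (enn2real I powr (1 / enn2real p))))"

definition Lp_space :: "ennreal \<Rightarrow> 'a measure \<Rightarrow> ('a \<Rightarrow> 'b::real_normed_vector) set" where
  "Lp_space p M = {f \<in> borel_measurable M. Lp_norm p M f < \<infinity>}"

section \<open>Test functions\<close>

definition partial_deriv :: "'n::finite \<Rightarrow> (real^'n \<Rightarrow> complex) \<Rightarrow> real^'n \<Rightarrow> complex" where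
  "partial_deriv i f x = frechet_derivative f (at x) (axis i 1)"

primrec Ck_function :: "nat \<Rightarrow> (real^'n::finite \<Rightarrow> complex) \<Rightarrow> bool" where
  "Ck_function 0 f \<longleftrightarrow> continuous_on UNIV f"
| "Ck_function (Suc k) f \<longleftrightarrow>
     (\<forall>x. f differentiable (at x)) \<and> (\<forall>i. Ck_function k (partial_deriv i f))"

(* Functions in C_0^\<infinity>(D), extended by zero to the whole space. *)
definition test_functions :: "(real^'n::finite) set \<Rightarrow> (real^'n \<Rightarrow> complex) set" where
  "test_functions D =
     {\<psi>. (\<forall>k. Ck_function k \<psi>) \<and> compact (closure {x. \<psi> x \<noteq> 0}) \<and> closure {x. \<psi> x \<noteq> 0} \<subseteq> D}"

section \<open>Weak gradients and the Sobolev space\<close>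

(* Elements of function spaces over D are represented by functions on the whole space; only
   their values on D, up to null sets, are relevant. *)

definition locally_integrable :: "(real^'n::finite) set \<Rightarrow> (real^'n \<Rightarrow> 'b::euclidean_space) \<Rightarrow> bool" where
  "locally_integrable D f \<longleftrightarrow> (\<forall>K. compact K \<and> K \<subseteq> D \<longrightarrow> f absolutely_integrable_on K)"

definition is_weak_gradient ::
    "(real^'n::finite) set \<Rightarrow> (real^'n \<Rightarrow> complex) \<Rightarrow> (real^'n \<Rightarrow> complex^'n) \<Rightarrow> bool" where
  "is_weak_gradient D u G \<longleftrightarrow>
     locally_integrable D u \<and> locally_integrable D G \<and>
     (\<forall>\<psi>\<in>test_functions D. \<forall>i.
        (LINT x|lebesgue_on D. u x * partial_deriv i \<psi> x) = - (LINT x|lebesgue_on D. G x $ i * \<psi> x))"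

(* Determined up to null subsets of D whenever a weak gradient exists. *)
definition weak_gradient ::
    "(real^'n::finite) set \<Rightarrow> (real^'n \<Rightarrow> complex) \<Rightarrow> real^'n \<Rightarrow> complex^'n" where
  "weak_gradient D u = (SOME G. is_weak_gradient D u G)"

definition gradient :: "(real^'n::finite \<Rightarrow> complex) \<Rightarrow> real^'n \<Rightarrow> complex^'n" where
  "gradient \<phi> x = (\<chi> i. partial_deriv i \<phi> x)"

(* The closure of the test functions in the norm "L^2 norm of the gradient", realised as a space
   of functions on D. As this norm does not distinguish u from u + c, the limit function is
   identified by convergence in L^1_loc(D), which for bounded D is implied, along sequences of
   test functions, by convergence of the gradients (Poincare). *)
definition W012 :: "(real^'n::finite) set \<Rightarrow> (real^'n \<Rightarrow> complex) set" where
  "W012 D = {u. (\<exists>G. is_weak_gradient D u G) \<and>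
     (\<exists>\<phi>. (\<forall>k::nat. \<phi> k \<in> test_functions D) \<and>
          (\<lambda>k. Lp_norm 2 (lebesgue_on D) (\<lambda>x. gradient (\<phi> k) x - weak_gradient D u x))
             \<longlonglongrightarrow> 0 \<and>
          (\<forall>K. compact K \<and> K \<subseteq> D \<longrightarrow>
             (\<lambda>k. Lp_norm 1 (lebesgue_on K) (\<lambda>x. \<phi> k x - u x)) \<longlonglongrightarrow> 0))}"

definition nontrivial :: "(real^'n::finite) set \<Rightarrow> (real^'n \<Rightarrow> complex) \<Rightarrow> bool" where
  "nontrivial D u \<longleftrightarrow> \<not> (AE x in lebesgue_on D. u x = 0)"

definition sobolev_quotient :: "real \<Rightarrow> (real^'n::finite) set \<Rightarrow> (real^'n \<Rightarrow> complex) \<Rightarrow> ennreal" where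
  "sobolev_quotient q D u =
     Lp_norm (ennreal (2 * q)) (lebesgue_on D) u / Lp_norm 2 (lebesgue_on D) (weak_gradient D u)"

definition sobolev_const :: "real \<Rightarrow> (real^'n::finite) set \<Rightarrow> ennreal" where
  "sobolev_const q D = Sup {sobolev_quotient q D u | u. u \<in> W012 D \<and> nontrivial D u}"

definition sobolev_extremal :: "real \<Rightarrow> (real^'n::finite) set \<Rightarrow> (real^'n \<Rightarrow> complex) \<Rightarrow> bool" where
  "sobolev_extremal q D u \<longleftrightarrow>
     u \<in> W012 D \<and> nontrivial D u \<and> sobolev_const q D = sobolev_quotient q D u"

section \<open>The Schroedinger equation\<close>

(* Integrability of V u \<psi> is required explicitly because a Bochner integral of a non-integrable
   function is 0 by convention; the left-hand integrand is always integrable, since the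
   weak gradient is locally integrable. *)
definition schroedinger_solution ::
    "(real^'n::finite) set \<Rightarrow> (real^'n \<Rightarrow> real) \<Rightarrow> (real^'n \<Rightarrow> complex) \<Rightarrow> bool" where
  "schroedinger_solution D V u \<longleftrightarrow> u \<in> W012 D \<and>
     (\<forall>\<psi>\<in>test_functions D.
        integrable (lebesgue_on D) (\<lambda>x. complex_of_real (V x) * u x * \<psi> x) \<and>
        (LINT x|lebesgue_on D. (\<Sum>i\<in>UNIV. weak_gradient D u x $ i * partial_deriv i \<psi> x))
          = (LINT x|lebesgue_on D. complex_of_real (V x) * u x * \<psi> x))"

(* The case s = 0 is separate because 0 powr 0 = 0, whereas for q = 1 the factor
   |u|^(2q-2) below has to be the constant 1. *)
definition nonneg_power :: "real \<Rightarrow> real \<Rightarrow> real" where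
  "nonneg_power a s = (if s = 0 then 1 else a powr s)"

definition extremal_potential ::
    "real \<Rightarrow> (real^'n::finite) set \<Rightarrow> (real^'n \<Rightarrow> complex) \<Rightarrow> real^'n \<Rightarrow> real" where
  "extremal_potential q D u x =
     (enn2real (Lp_norm 2 (lebesgue_on D) (weak_gradient D u)))\<^sup>2
       / enn2real (Lp_norm (ennreal (2 * q)) (lebesgue_on D) u) powr (2 * q)
       * nonneg_power (norm (u x)) (2 * q - 2)"

end

theory Submission
  imports Defs "HOL-Complex_Analysis.Great_Picard" "HOL-Library.Diagonal_Subsequence"
begin

text \<open>Testing the equation with \<open>u\<close> itself gives
  \<open>\<parallel>\<nabla>u\<parallel>\<^sub>2\<^sup>2 = \<integral> V |u|\<^sup>2 \<le> \<parallel>V\<^sub>+\<parallel>\<^sub>r \<parallel>u\<parallel>\<^bsub>2q\<^esub>\<^sup>2 \<le> K\<^sup>2 \<parallel>V\<^sub>+\<parallel>\<^sub>r \<parallel>\<nabla>u\<parallel>\<^sub>2\<^sup>2\<close>, which is the lower bound;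
  for an extremal \<open>u\<close> the Euler--Lagrange equation is the Schroedinger equation with the stated potential.
  Existence of an extremal rests on the subcritical Rellich--Kondrachov theorem. Its source is the bound
  \<open>\<parallel>u(\<cdot> + h) - u\<parallel>\<^sub>2 \<le> |h| \<parallel>\<nabla>u\<parallel>\<^sub>2\<close>: writing \<open>A\<^sub>t\<close> for the average over balls of radius \<open>t\<close>, it controls
  \<open>A\<^bsub>t/2\<^esub> u - A\<^sub>t u\<close> both in \<open>L\<^sup>2\<close> and in \<open>L\<^sup>\<infinity>\<close>, hence in \<open>L\<^sup>p\<close> by a positive power of \<open>t\<close>, and the sum over
  dyadic \<open>t\<close> bounds \<open>u - A\<^sub>t u\<close> in \<open>L\<^sup>p\<close>, while \<open>A\<^sub>t u\<close> ranges over an equicontinuous family.\<close>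

section \<open>Lebesgue norms\<close>

text \<open>\<open>u\<close> is not a test function, so testing the equation with it takes test
  functions \<open>\<phi> k\<close> whose gradients converge in L^2 and whose values converge in
  L^p, p = 2q. The definition of \<open>W012\<close> supplies only convergence in L^1_loc for the
  values; the Sobolev inequality upgrades it, and \<open>approximates\<close> records the outcome.
  Statements about the Sobolev constant are then checked on test functions and passed to the limit.
  The condition on r enters as positivity of \<open>sobolev_gain\<close>: for finite r > 1, n < 2r
  says exactly that 2q is subcritical. The endpoint r = \<infinity>, q = 1 runs through the same
  argument with p = 2. Test functions are extended by zero, so translations, Fubini and ball
  averages live on the whole space, and only the final norms return to \<open>D\<close>. Complex
  values are handled through the real inner product Re (z * cnj w): the energy identity and the
  first variation are real equations, and the complex weak equation is recovered from them by
  testing with \<open>cnj \<psi>\<close> and \<open>cnj (- \<i> * \<psi>)\<close>.\<close>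

lemma Lp_norm_le_iff:
  fixes f :: "'a \<Rightarrow> 'b::real_normed_vector"
  assumes "p > 0" "a \<ge> 0"
  shows "Lp_norm (ennreal p) M f \<le> ennreal a \<longleftrightarrow>
    (\<integral>\<^sup>+ x. ennreal (norm (f x) powr p) \<partial>M) \<le> ennreal (a powr p)"
proof (cases "(\<integral>\<^sup>+ x. ennreal (norm (f x) powr p) \<partial>M) = \<infinity>")
  case True
  then show ?thesis using assms by (simp add: Lp_norm_def top_unique)
next
  case False
  then obtain I where I: "(\<integral>\<^sup>+ x. ennreal (norm (f x) powr p) \<partial>M) = ennreal I" "I \<ge> 0"
    by (metis ennreal_cases infinity_ennreal_def)
  have "I powr (1/p) \<le> a \<longleftrightarrow> I \<le> a powr p"
  proof
    assume "I powr (1/p) \<le> a"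
    then have "(I powr (1/p)) powr p \<le> a powr p" using assms by (intro powr_mono2) auto
    then show "I \<le> a powr p" using assms I by (simp add: powr_powr)
  next
    assume "I \<le> a powr p"
    then have "I powr (1/p) \<le> (a powr p) powr (1/p)" using assms I by (intro powr_mono2) auto
    then show "I powr (1/p) \<le> a" using assms I by (simp add: powr_powr)
  qed
  then show ?thesis using assms I by (simp add: Lp_norm_def)
qed

lemma Lp_norm_eqD:
  fixes f :: "'a \<Rightarrow> 'b::real_normed_vector"
  assumes "Lp_norm (ennreal p) M f = ennreal a" "p > 0" "a \<ge> 0"
  shows "(\<integral>\<^sup>+ x. ennreal (norm (f x) powr p) \<partial>M) = ennreal (a powr p)"
proof (cases "(\<integral>\<^sup>+ x. ennreal (norm (f x) powr p) \<partial>M) = \<infinity>")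
  case True
  then show ?thesis using assms by (simp add: Lp_norm_def)
next
  case False
  then obtain I where I: "(\<integral>\<^sup>+ x. ennreal (norm (f x) powr p) \<partial>M) = ennreal I" "I \<ge> 0"
    by (metis ennreal_cases infinity_ennreal_def)
  then have "I powr (1/p) = a" using assms by (simp add: Lp_norm_def)
  then show ?thesis using I assms by (auto simp: powr_powr)
qed

lemma Lp_norm_eqI:
  fixes f :: "'a \<Rightarrow> 'b::real_normed_vector"
  assumes "(\<integral>\<^sup>+ x. ennreal (norm (f x) powr p) \<partial>M) = ennreal I" "p > 0" "I \<ge> 0"
  shows "Lp_norm (ennreal p) M f = ennreal (I powr (1/p))"
  using assms by (simp add: Lp_norm_def)

lemma ennreal_realE:
  fixes x :: ennreal
  assumes "x \<noteq> \<infinity>"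
  obtains a where "x = ennreal a" "a \<ge> 0"
  using assms by (cases x) auto

text \<open>An infinite upper bound is trivial, so testing finite bounds suffices. This lets
  \<open>Lp_norm_le_iff\<close> prove inequalities between two norms without a case split on
  infinite values.\<close>

lemma ennreal_le_by_real:
  fixes x y :: ennreal
  assumes "\<And>a. a \<ge> 0 \<Longrightarrow> y \<le> ennreal a \<Longrightarrow> x \<le> ennreal a"
  shows "x \<le> y"
  using assms by (cases y) (auto simp: top_unique)

lemma tendsto_ennreal_zeroI:
  fixes f :: "'a \<Rightarrow> ennreal"
  assumes "\<And>e::real. e > 0 \<Longrightarrow> \<forall>\<^sub>F k in F. f k \<le> ennreal e"
  shows "(f \<longlongrightarrow> 0) F"
proof (rule order_tendstoI)
  fix a :: ennreal assume "0 < a"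
  then obtain e :: real where "0 < ennreal e" "ennreal e < a"
  proof (cases a)
    case (real r)
    then show ?thesis using \<open>0 < a\<close> by (intro that[of "r / 2"]) (auto simp: ennreal_less_iff)
  next
    case top
    then show ?thesis by (intro that[of 1]) auto
  qed
  then have "e > 0" by (simp add: ennreal_less_iff)
  from assms[OF this] show "\<forall>\<^sub>F k in F. f k < a"
    by eventually_elim (use \<open>ennreal e < a\<close> in auto)
qed (use not_less_zero in auto)

lemma tendsto_ennreal_zeroD:
  fixes f :: "'a \<Rightarrow> ennreal"
  assumes "(f \<longlongrightarrow> 0) F" "e > 0"
  shows "\<forall>\<^sub>F k in F. f k \<le> ennreal e"
  using order_tendstoD(2)[OF assms(1), of "ennreal e"] assms(2)
  by (auto elim: eventually_mono)

lemma Lp_norm_mono_AE: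
  fixes f :: "'a \<Rightarrow> 'b::real_normed_vector" and g :: "'a \<Rightarrow> 'c::real_normed_vector"
  assumes "AE x in M. norm (f x) \<le> norm (g x)" "p > 0"
  shows "Lp_norm (ennreal p) M f \<le> Lp_norm (ennreal p) M g"
proof (rule ennreal_le_by_real)
  fix a :: real assume a: "a \<ge> 0" "Lp_norm (ennreal p) M g \<le> ennreal a"
  have "(\<integral>\<^sup>+ x. ennreal (norm (f x) powr p) \<partial>M) \<le> (\<integral>\<^sup>+ x. ennreal (norm (g x) powr p) \<partial>M)"
    using assms by (intro nn_integral_mono_AE) (auto intro!: powr_mono2)
  with a show "Lp_norm (ennreal p) M f \<le> ennreal a"
    using assms by (simp add: Lp_norm_le_iff)
qed

lemma Lp_norm_cong_AE:
  fixes f :: "'a \<Rightarrow> 'b::real_normed_vector" and g :: "'a \<Rightarrow> 'c::real_normed_vector"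
  assumes "AE x in M. norm (f x) = norm (g x)" "p > 0"
  shows "Lp_norm (ennreal p) M f = Lp_norm (ennreal p) M g"
  using assms by (intro antisym Lp_norm_mono_AE) auto

lemma Lp_norm_zero_iff:
  fixes f :: "'a \<Rightarrow> 'b::{second_countable_topology,real_normed_vector}"
  assumes "f \<in> borel_measurable M" "p > 0"
  shows "Lp_norm (ennreal p) M f = 0 \<longleftrightarrow> (AE x in M. f x = 0)"
proof -
  have "Lp_norm (ennreal p) M f = 0 \<longleftrightarrow> (\<integral>\<^sup>+ x. ennreal (norm (f x) powr p) \<partial>M) = 0"
    using Lp_norm_le_iff[of p 0 M f] assms by simp
  also have "\<dots> \<longleftrightarrow> (AE x in M. f x = 0)"
    using assms by (subst nn_integral_0_iff_AE) (auto simp: ennreal_eq_0_iff)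
  finally show ?thesis .
qed

lemma Lp_norm_scaleR_le:
  fixes f :: "'a \<Rightarrow> 'b::{second_countable_topology,real_normed_vector}"
  assumes "f \<in> borel_measurable M" "p > 0" "a \<ge> 0" "Lp_norm (ennreal p) M f \<le> ennreal a"
  shows "Lp_norm (ennreal p) M (\<lambda>x. c *\<^sub>R f x) \<le> ennreal (\<bar>c\<bar> * a)"
proof -
  have "(\<integral>\<^sup>+ x. ennreal (norm (c *\<^sub>R f x) powr p) \<partial>M)
      = (\<integral>\<^sup>+ x. ennreal (\<bar>c\<bar> powr p) * ennreal (norm (f x) powr p) \<partial>M)"
    by (simp add: powr_mult ennreal_mult)
  also have "\<dots> = ennreal (\<bar>c\<bar> powr p) * (\<integral>\<^sup>+ x. ennreal (norm (f x) powr p) \<partial>M)"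
    using assms by (intro nn_integral_cmult) auto
  also have "\<dots> \<le> ennreal (\<bar>c\<bar> powr p) * ennreal (a powr p)"
    using assms by (intro mult_left_mono) (auto simp: Lp_norm_le_iff)
  finally show ?thesis using assms
    by (subst Lp_norm_le_iff) (auto simp: powr_mult ennreal_mult)
qed

lemma Lp_norm_scaleR:
  fixes f :: "'a \<Rightarrow> 'b::{second_countable_topology,real_normed_vector}"
  assumes [measurable]: "f \<in> borel_measurable M" and "p > 0" "c \<noteq> 0"
  shows "Lp_norm (ennreal p) M (\<lambda>x. c *\<^sub>R f x) = ennreal \<bar>c\<bar> * Lp_norm (ennreal p) M f"
proof -
  have 1: "Lp_norm (ennreal p) M (\<lambda>x. d *\<^sub>R g x) \<le> ennreal \<bar>d\<bar> * Lp_norm (ennreal p) M g"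
    if [measurable]: "g \<in> borel_measurable M" and "d \<noteq> 0" for g :: "'a \<Rightarrow> 'b" and d
  proof (cases "Lp_norm (ennreal p) M g")
    case (real a)
    then show ?thesis using Lp_norm_scaleR_le[of g M p a d] \<open>p > 0\<close> by (simp add: ennreal_mult)
  next
    case top then show ?thesis using \<open>d \<noteq> 0\<close> by (simp add: ennreal_mult_top)
  qed
  \<comment> \<open>The reverse inequality is the same bound, applied to the scaled function with
    factor \<open>1 / c\<close>.\<close>
  have "ennreal \<bar>c\<bar> * Lp_norm (ennreal p) M f
      = ennreal \<bar>c\<bar> * Lp_norm (ennreal p) M (\<lambda>x. (1/c) *\<^sub>R (c *\<^sub>R f x))"
    using \<open>c \<noteq> 0\<close> by simp
  also have "\<dots> \<le> ennreal \<bar>c\<bar> * (ennreal \<bar>1/c\<bar> * Lp_norm (ennreal p) M (\<lambda>x. c *\<^sub>R f x))"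
    using \<open>c \<noteq> 0\<close> by (intro mult_left_mono 1) auto
  also have "\<dots> = Lp_norm (ennreal p) M (\<lambda>x. c *\<^sub>R f x)"
    using \<open>c \<noteq> 0\<close> by (simp add: mult.assoc[symmetric] ennreal_mult[symmetric])
  finally show ?thesis using 1[of f c] \<open>c \<noteq> 0\<close> by (intro antisym) auto
qed

section \<open>Minkowski's inequality\<close>

lemma powr_convex_combination:
  fixes x y :: real
  assumes "p \<ge> 1" "x \<ge> 0" "y \<ge> 0" "u \<ge> 0" "v \<ge> 0" "u + v = 1"
  shows "(u * x + v * y) powr p \<le> u * x powr p + v * y powr p"
proof (cases "x = 0 \<or> y = 0 \<or> u = 0 \<or> v = 0")
  case True
  have "(w * z) powr p \<le> w * z powr p" if "0 \<le> w" "w \<le> 1" "0 \<le> z" for w z :: real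
  proof -
    have "w powr p \<le> w powr 1" using that \<open>p \<ge> 1\<close> using powr_mono'[of 1 p w] by (cases "w = 0") auto
    then show ?thesis using that by (auto simp: powr_mult intro!: mult_right_mono)
  qed
  then show ?thesis using True assms by auto
next
  case False
  then show ?thesis
    using powr_convex[OF \<open>p \<ge> 1\<close>] assms by (auto simp: convex_on_def)
qed

text \<open>\<open>f + g\<close> is \<open>a + b\<close> times the convex combination of
  \<open>f / a\<close> and \<open>g / b\<close> with weights \<open>a / (a + b)\<close> and
  \<open>b / (a + b)\<close>, so convexity of the power can be integrated. Positive upper bounds in
  place of the norms themselves keep the divisions legitimate when a norm is zero.\<close>

lemma Lp_norm_triangle_real:
  fixes f g :: "'a \<Rightarrow> 'b::{second_countable_topology,real_normed_vector}"
  assumes [measurable]: "f \<in> borel_measurable M" "g \<in> borel_measurable M" and p: "p \<ge> 1"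
    and ab: "a > 0" "b > 0"
    and f: "Lp_norm (ennreal p) M f \<le> ennreal a" and g: "Lp_norm (ennreal p) M g \<le> ennreal b"
  shows "Lp_norm (ennreal p) M (\<lambda>x. f x + g x) \<le> ennreal (a + b)"
proof -
  define u where "u = a / (a + b)"
  define v where "v = b / (a + b)"
  have uv: "u \<ge> 0" "v \<ge> 0" "u + v = 1" "u > 0" "v > 0"
    using ab by (auto simp: u_def v_def add_divide_distrib[symmetric])
  have pt: "norm (f x + g x) powr p \<le>
      ((a+b) powr p * u / a powr p) * norm (f x) powr p + ((a+b) powr p * v / b powr p) * norm (g x) powr p" for x
  proof -
    have "norm (f x + g x) powr p \<le> (norm (f x) + norm (g x)) powr p"
      using p by (intro powr_mono2) (auto intro: norm_triangle_ineq)
    also have "norm (f x) + norm (g x) = (a + b) * (u * (norm (f x) / a) + v * (norm (g x) / b))"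
      using ab by (simp add: u_def v_def distrib_left)
    also have "\<dots> powr p = (a+b) powr p * (u * (norm (f x) / a) + v * (norm (g x) / b)) powr p"
      using ab uv by (intro powr_mult)
    also have "\<dots> \<le> (a+b) powr p * (u * (norm (f x) / a) powr p + v * (norm (g x) / b) powr p)"
      using ab uv p by (intro mult_left_mono powr_convex_combination) auto
    finally show ?thesis using ab by (simp add: powr_divide algebra_simps)
  qed
  have "(\<integral>\<^sup>+ x. ennreal (norm (f x + g x) powr p) \<partial>M) \<le>
    (\<integral>\<^sup>+ x. ennreal ((a+b) powr p * u / a powr p) * ennreal (norm (f x) powr p)
        + ennreal ((a+b) powr p * v / b powr p) * ennreal (norm (g x) powr p) \<partial>M)"
    using pt uv by (intro nn_integral_mono)
      (simp add: ennreal_mult[symmetric] ennreal_plus[symmetric] del: ennreal_plus)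
  also have "\<dots> = ennreal ((a+b) powr p * u / a powr p) * (\<integral>\<^sup>+ x. ennreal (norm (f x) powr p) \<partial>M)
        + ennreal ((a+b) powr p * v / b powr p) * (\<integral>\<^sup>+ x. ennreal (norm (g x) powr p) \<partial>M)"
    by (simp add: nn_integral_add nn_integral_cmult)
  also have "\<dots> \<le> ennreal ((a+b) powr p * u / a powr p) * ennreal (a powr p)
        + ennreal ((a+b) powr p * v / b powr p) * ennreal (b powr p)"
    using f g p ab by (intro add_mono mult_left_mono) (auto simp: Lp_norm_le_iff)
  also have "\<dots> = ennreal ((a+b) powr p * u + (a+b) powr p * v)"
    using ab uv by (simp add: ennreal_mult[symmetric] ennreal_plus[symmetric] del: ennreal_plus)
  also have "(a+b) powr p * u + (a+b) powr p * v = (a+b) powr p"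
    using uv by (simp add: distrib_left[symmetric])
  finally show ?thesis using ab p by (subst Lp_norm_le_iff) auto
qed

lemma Lp_norm_triangle:
  fixes f g :: "'a \<Rightarrow> 'b::{second_countable_topology,real_normed_vector}"
  assumes m: "f \<in> borel_measurable M" "g \<in> borel_measurable M" and p: "p \<ge> 1"
  shows "Lp_norm (ennreal p) M (\<lambda>x. f x + g x) \<le> Lp_norm (ennreal p) M f + Lp_norm (ennreal p) M g"
proof (cases "Lp_norm (ennreal p) M f = \<infinity> \<or> Lp_norm (ennreal p) M g = \<infinity>")
  case True
  then show ?thesis by auto
next
  case False
  then obtain a b where ab: "Lp_norm (ennreal p) M f = ennreal a" "a \<ge> 0"
      "Lp_norm (ennreal p) M g = ennreal b" "b \<ge> 0"
    by (metis ennreal_cases infinity_ennreal_def)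
  show ?thesis
  proof (rule ennreal_le_epsilon)
    fix e :: real assume "e > 0"
    \<comment> \<open>Enlarging each norm by \<open>e / 2\<close> provides the strictly positive
      bounds required above.\<close>
    have "Lp_norm (ennreal p) M (\<lambda>x. f x + g x) \<le> ennreal ((a + e/2) + (b + e/2))"
      using ab \<open>e > 0\<close> by (intro Lp_norm_triangle_real m p) auto
    also have "\<dots> = Lp_norm (ennreal p) M f + Lp_norm (ennreal p) M g + ennreal e"
      using ab \<open>e > 0\<close> by (simp add: ennreal_plus[symmetric] del: ennreal_plus)
    finally show "Lp_norm (ennreal p) M (\<lambda>x. f x + g x)
       \<le> Lp_norm (ennreal p) M f + Lp_norm (ennreal p) M g + ennreal e" .
  qed
qed

lemma Lp_norm_minus_commute:
  fixes f g :: "'a \<Rightarrow> 'b::real_normed_vector"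
  shows "Lp_norm p M (\<lambda>x. f x - g x) = Lp_norm p M (\<lambda>x. g x - f x)"
  by (simp add: Lp_norm_def norm_minus_commute)

lemma Lp_norm_triangle_diff:
  fixes f g h :: "'a \<Rightarrow> 'b::{second_countable_topology,real_normed_vector}"
  assumes [measurable]: "f \<in> borel_measurable M" "g \<in> borel_measurable M" "h \<in> borel_measurable M"
    and p: "p \<ge> 1"
  shows "Lp_norm (ennreal p) M (\<lambda>x. f x - h x) \<le>
     Lp_norm (ennreal p) M (\<lambda>x. f x - g x) + Lp_norm (ennreal p) M (\<lambda>x. g x - h x)"
  using Lp_norm_triangle[of "\<lambda>x. f x - g x" M "\<lambda>x. g x - h x" p] p by simp

lemma Lp_norm_le_add_diff:
  fixes f g :: "'a \<Rightarrow> 'b::{second_countable_topology,real_normed_vector}"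
  assumes [measurable]: "f \<in> borel_measurable M" "g \<in> borel_measurable M" and p: "p \<ge> 1"
  shows "Lp_norm (ennreal p) M f \<le> Lp_norm (ennreal p) M g + Lp_norm (ennreal p) M (\<lambda>x. f x - g x)"
  using Lp_norm_triangle[of g M "\<lambda>x. f x - g x" p] p by simp

section \<open>Norms of limits\<close>

lemma Lp_norm_tendsto:
  fixes f :: "nat \<Rightarrow> 'a \<Rightarrow> 'b::{second_countable_topology,real_normed_vector}"
  assumes [measurable]: "\<And>k. f k \<in> borel_measurable M" "g \<in> borel_measurable M" and p: "p \<ge> 1"
    and lim: "(\<lambda>k. Lp_norm (ennreal p) M (\<lambda>x. f k x - g x)) \<longlonglongrightarrow> 0"
    and fin: "Lp_norm (ennreal p) M g < \<infinity>"
  shows "(\<lambda>k. Lp_norm (ennreal p) M (f k)) \<longlonglongrightarrow> Lp_norm (ennreal p) M g"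
proof (rule tendsto_sandwich)
  let ?e = "\<lambda>k. Lp_norm (ennreal p) M (\<lambda>x. f k x - g x)"
  have "Lp_norm (ennreal p) M g \<le> Lp_norm (ennreal p) M (f k) + ?e k" for k
    using Lp_norm_le_add_diff[of g M "f k" p] p by (simp add: Lp_norm_minus_commute)
  then show "\<forall>\<^sub>F k in sequentially. Lp_norm (ennreal p) M g - ?e k \<le> Lp_norm (ennreal p) M (f k)"
    using fin by (intro always_eventually allI) (simp add: ennreal_minus_le_iff add.commute, metis less_irrefl)
  show "\<forall>\<^sub>F k in sequentially. Lp_norm (ennreal p) M (f k) \<le> Lp_norm (ennreal p) M g + ?e k"
    using Lp_norm_le_add_diff[of "f _" M g p] p by simp
  show "(\<lambda>k. Lp_norm (ennreal p) M g - ?e k) \<longlonglongrightarrow> Lp_norm (ennreal p) M g"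
    using tendsto_diff_ennreal[OF tendsto_const lim, of "Lp_norm (ennreal p) M g"] fin by auto
  show "(\<lambda>k. Lp_norm (ennreal p) M g + ?e k) \<longlonglongrightarrow> Lp_norm (ennreal p) M g"
    using tendsto_add[OF tendsto_const lim, of "Lp_norm (ennreal p) M g"] by simp
qed

text \<open>Fatou's lemma for the p-th powers. It carries a uniform norm bound to an almost
  everywhere limit, both in the completeness proof and when averages over shrinking balls are
  replaced by the function itself.\<close>

lemma Lp_norm_Fatou:
  fixes f :: "nat \<Rightarrow> 'a \<Rightarrow> 'b::{second_countable_topology,real_normed_vector}"
  assumes [measurable]: "\<And>k. f k \<in> borel_measurable M" and p: "p > 0"
    and lim: "AE x in M. (\<lambda>k. f k x) \<longlonglongrightarrow> g x"
    and le: "\<forall>\<^sub>F k in sequentially. Lp_norm (ennreal p) M (f k) \<le> c"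
  shows "Lp_norm (ennreal p) M g \<le> c"
proof (rule ennreal_le_by_real)
  fix a :: real assume a: "a \<ge> 0" "c \<le> ennreal a"
  have "(\<integral>\<^sup>+ x. ennreal (norm (g x) powr p) \<partial>M)
     = (\<integral>\<^sup>+ x. liminf (\<lambda>k. ennreal (norm (f k x) powr p)) \<partial>M)"
  proof (rule nn_integral_cong_AE)
    show "AE x in M. ennreal (norm (g x) powr p) = liminf (\<lambda>k. ennreal (norm (f k x) powr p))"
      using lim
    proof eventually_elim
      case (elim x)
      then have "(\<lambda>k. ennreal (norm (f k x) powr p)) \<longlonglongrightarrow> ennreal (norm (g x) powr p)"
        using p by (intro tendsto_ennrealI tendsto_powr' tendsto_norm) auto
      then show ?case by (metis lim_imp_Liminf sequentially_bot)
    qed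
  qed
  also have "\<dots> \<le> liminf (\<lambda>k. (\<integral>\<^sup>+ x. ennreal (norm (f k x) powr p) \<partial>M))"
    by (intro nn_integral_liminf) auto
  also have "\<dots> \<le> ennreal (a powr p)"
  proof -
    have "\<forall>\<^sub>F k in sequentially. (\<integral>\<^sup>+ x. ennreal (norm (f k x) powr p) \<partial>M) \<le> ennreal (a powr p)"
      using le
    proof eventually_elim
      case (elim k)
      then have "Lp_norm (ennreal p) M (f k) \<le> ennreal a" using a by auto
      then show ?case using a p by (simp add: Lp_norm_le_iff)
    qed
    then show ?thesis
      by (metis Limsup_bounded Liminf_le_Limsup order_trans sequentially_bot)
  qed
  finally show "Lp_norm (ennreal p) M g \<le> ennreal a" using a p by (simp add: Lp_norm_le_iff)
qed

section \<open>Hoelder's inequality\<close>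

lemma Lp_norm_Holder:
  fixes f :: "'a \<Rightarrow> 'b::{second_countable_topology,real_normed_vector}"
    and g :: "'a \<Rightarrow> 'c::{second_countable_topology,real_normed_vector}"
  assumes [measurable]: "f \<in> borel_measurable M" "g \<in> borel_measurable M"
    and p: "p > 1" "q > 1" "1 / p + 1 / q = 1"
  shows "(\<integral>\<^sup>+ x. ennreal (norm (f x) * norm (g x)) \<partial>M) \<le> Lp_norm (ennreal p) M f * Lp_norm (ennreal q) M g"
\<comment> \<open>Young's inequality is integrated for \<open>f / a\<close> and
  \<open>g / b\<close>, which requires both norms to be positive and finite. A zero norm makes the
  product vanish almost everywhere; with both norms nonzero, an infinite one makes the right-hand
  side infinite.\<close>
proof (cases "Lp_norm (ennreal p) M f = 0 \<or> Lp_norm (ennreal q) M g = 0")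
  case True
  then have "(AE x in M. f x = 0) \<or> (AE x in M. g x = 0)"
    using p by (auto simp: Lp_norm_zero_iff)
  then have "AE x in M. ennreal (norm (f x) * norm (g x)) = 0" by auto
  then have "(\<integral>\<^sup>+ x. ennreal (norm (f x) * norm (g x)) \<partial>M) = 0"
    by (subst nn_integral_0_iff_AE) auto
  then show ?thesis by simp
next
  case nz: False
  show ?thesis
  proof (cases "Lp_norm (ennreal p) M f = \<infinity> \<or> Lp_norm (ennreal q) M g = \<infinity>")
    case True
    then show ?thesis using nz by (auto simp: ennreal_mult_top ennreal_top_mult)
  next
    case False
    then obtain a b where ab: "Lp_norm (ennreal p) M f = ennreal a" "a > 0"
        "Lp_norm (ennreal q) M g = ennreal b" "b > 0"
      using nz by (metis ennreal_cases infinity_ennreal_def ennreal_0 order_le_less)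
    have pt: "norm (f x) * norm (g x) \<le>
      (a * b / p / a powr p) * norm (f x) powr p + (a * b / q / b powr q) * norm (g x) powr q" for x
    proof -
      have "norm (f x) * norm (g x) = (a * b) * ((norm (f x) / a) * (norm (g x) / b))"
        using ab by simp
      also have "\<dots> \<le> (a * b) * ((norm (f x) / a) powr p / p + (norm (g x) / b) powr q / q)"
        using ab p by (intro mult_left_mono Youngs_inequality) auto
      finally show ?thesis using ab by (simp add: powr_divide algebra_simps)
    qed
    have "(\<integral>\<^sup>+ x. ennreal (norm (f x) * norm (g x)) \<partial>M) \<le>
      (\<integral>\<^sup>+ x. ennreal (a * b / p / a powr p) * ennreal (norm (f x) powr p)
          + ennreal (a * b / q / b powr q) * ennreal (norm (g x) powr q) \<partial>M)"
      using pt ab p by (intro nn_integral_mono)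
        (simp add: ennreal_mult[symmetric] ennreal_plus[symmetric] del: ennreal_plus)
    also have "\<dots> = ennreal (a * b / p / a powr p) * (\<integral>\<^sup>+ x. ennreal (norm (f x) powr p) \<partial>M)
          + ennreal (a * b / q / b powr q) * (\<integral>\<^sup>+ x. ennreal (norm (g x) powr q) \<partial>M)"
      by (simp add: nn_integral_add nn_integral_cmult)
    also have "\<dots> = ennreal (a * b / p / a powr p) * ennreal (a powr p)
          + ennreal (a * b / q / b powr q) * ennreal (b powr q)"
      using ab p by (simp add: Lp_norm_eqD)
    also have "\<dots> = ennreal (a * b / p + a * b / q)"
      using ab p by (simp add: ennreal_mult[symmetric] ennreal_plus[symmetric] del: ennreal_plus)
    also have "a * b / p + a * b / q = a * b * (1 / p + 1 / q)"
      by (simp add: algebra_simps)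
    also have "\<dots> = a * b" using p by simp
    finally show ?thesis using ab by (simp add: ennreal_mult)
  qed
qed

lemma Lp_norm_powr:
  fixes f :: "'a \<Rightarrow> 'b::real_normed_vector"
  assumes "Lp_norm (ennreal (s * p)) M f \<le> ennreal a" "p > 0" "s > 0" "a \<ge> 0"
  shows "Lp_norm (ennreal p) M (\<lambda>x. norm (f x) powr s) \<le> ennreal (a powr s)"
  using assms by (simp add: Lp_norm_le_iff powr_powr)

text \<open>Cauchy-Schwarz for the q-th powers of the two norms. Followed by Hoelder's inequality
  with exponents r and q, it bounds a product of three factors in L^r, L^(2q) and L^(2q).\<close>

lemma Lp_norm_mult_le:
  fixes f :: "'a \<Rightarrow> 'b::{second_countable_topology,real_normed_vector}"
    and g :: "'a \<Rightarrow> 'c::{second_countable_topology,real_normed_vector}"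
  assumes [measurable]: "f \<in> borel_measurable M" "g \<in> borel_measurable M"
    and q: "q \<ge> 1" and ab: "a \<ge> 0" "b \<ge> 0"
    and f: "Lp_norm (ennreal (2 * q)) M f \<le> ennreal a" and g: "Lp_norm (ennreal (2 * q)) M g \<le> ennreal b"
  shows "Lp_norm (ennreal q) M (\<lambda>x. norm (f x) * norm (g x)) \<le> ennreal (a * b)"
proof -
  have "(\<integral>\<^sup>+ x. ennreal (norm (norm (f x) * norm (g x)) powr q) \<partial>M)
      = (\<integral>\<^sup>+ x. ennreal (norm (norm (f x) powr q) * norm (norm (g x) powr q)) \<partial>M)"
    by (simp add: powr_mult)
  also have "\<dots> \<le> Lp_norm (ennreal 2) M (\<lambda>x. norm (f x) powr q) * Lp_norm (ennreal 2) M (\<lambda>x. norm (g x) powr q)"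
    by (intro Lp_norm_Holder) auto
  also have "\<dots> \<le> ennreal (a powr q) * ennreal (b powr q)"
    using f g q ab by (intro mult_mono Lp_norm_powr) (auto simp: mult.commute)
  finally show ?thesis
    using q ab by (subst Lp_norm_le_iff) (auto simp: powr_mult ennreal_mult)
qed

text \<open>Hoelder's inequality against the constant 1, with p = 1 apart because its conjugate
  exponent is infinite. As \<open>C\<close> does not depend on \<open>f\<close>, convergence in L^p
  implies convergence in L^1 over a finite measure.\<close>

lemma Lp_norm_1_le:
  assumes fin: "finite_measure M" and p: "p \<ge> 1"
  shows "\<exists>C::real. C > 0 \<and> (\<forall>f :: 'a \<Rightarrow> 'b::{second_countable_topology,real_normed_vector}. f \<in> borel_measurable M \<longrightarrow>
     (\<integral>\<^sup>+ x. ennreal (norm (f x)) \<partial>M) \<le> ennreal C * Lp_norm (ennreal p) M f)"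
proof (cases "p = 1")
  case True
  have "(\<integral>\<^sup>+ x. ennreal (norm (f x)) \<partial>M) \<le> Lp_norm (ennreal 1) M f" for f :: "'a \<Rightarrow> 'b"
  proof (rule ennreal_le_by_real)
    fix a :: real assume "a \<ge> 0" "Lp_norm (ennreal 1) M f \<le> ennreal a"
    then show "(\<integral>\<^sup>+ x. ennreal (norm (f x)) \<partial>M) \<le> ennreal a"
      by (subst (asm) Lp_norm_le_iff) auto
  qed
  then show ?thesis using True by (intro exI[of _ 1]) auto
next
  case False
  define q where "q = p / (p - 1)"
  have q: "p > 1" "q > 1" "1 / p + 1 / q = 1" using False p by (auto simp: q_def field_simps)
  interpret finite_measure M by fact
  have fin: "Lp_norm (ennreal q) M (\<lambda>x. 1::real) < \<infinity>"
    using q by (auto simp: less_top[symmetric] Lp_norm_def Let_def emeasure_eq_measure)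
  then obtain c where c: "Lp_norm (ennreal q) M (\<lambda>x. 1::real) = ennreal c" "c \<ge> 0"
    by (metis ennreal_cases infinity_ennreal_def less_irrefl)
  show ?thesis
  proof (intro exI[of _ "c + 1"] conjI allI impI)
    show "c + 1 > 0" using c by simp
    fix f :: "'a \<Rightarrow> 'b" assume [measurable]: "f \<in> borel_measurable M"
    have "(\<integral>\<^sup>+ x. ennreal (norm (f x)) \<partial>M) = (\<integral>\<^sup>+ x. ennreal (norm (f x) * norm (1::real)) \<partial>M)" by simp
    also have "\<dots> \<le> Lp_norm (ennreal p) M f * Lp_norm (ennreal q) M (\<lambda>x. 1::real)"
      using q by (intro Lp_norm_Holder) auto
    also have "\<dots> \<le> Lp_norm (ennreal p) M f * ennreal (c + 1)"
      using c by (intro mult_left_mono) auto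
    finally show "(\<integral>\<^sup>+ x. ennreal (norm (f x)) \<partial>M) \<le> ennreal (c + 1) * Lp_norm (ennreal p) M f"
      by (simp add: mult.commute)
  qed
qed

text \<open>The Riesz-Fischer theorem: a rapidly Cauchy subsequence converges almost everywhere, and
  Fatou's lemma turns its limit into the norm limit of the whole sequence.\<close>

lemma Lp_norm_complete:
  fixes f :: "nat \<Rightarrow> 'a \<Rightarrow> 'b::{second_countable_topology,banach}"
  assumes [measurable]: "\<And>k. f k \<in> borel_measurable M" and p: "p \<ge> 1"
    and Cauchy: "\<And>e. e > 0 \<Longrightarrow> \<exists>N. \<forall>m\<ge>N. \<forall>n\<ge>N. Lp_norm (ennreal p) M (\<lambda>x. f m x - f n x) \<le> ennreal e"
  obtains g where "g \<in> borel_measurable M" "(\<lambda>k. Lp_norm (ennreal p) M (\<lambda>x. f k x - g x)) \<longlonglongrightarrow> 0"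
proof -
  \<comment> \<open>The rate 1/4^k leaves room for a weight 2^k: the integrals of
    \<open>(2^k * d k x) powr p\<close> remain summable, and finiteness of their sum at almost every
    point bounds \<open>d k x\<close> there by a multiple of 1/2^k.\<close>
  have "\<forall>k::nat. \<exists>N. \<forall>m\<ge>N. \<forall>n\<ge>N. Lp_norm (ennreal p) M (\<lambda>x. f m x - f n x) \<le> ennreal ((1/4)^k)"
    using Cauchy by simp
  then obtain N where N: "\<And>k m n. m \<ge> N k \<Longrightarrow> n \<ge> N k \<Longrightarrow>
      Lp_norm (ennreal p) M (\<lambda>x. f m x - f n x) \<le> ennreal ((1/4)^k)"
    by metis
  \<comment> \<open>Summing up to \<open>k\<close>, instead of taking \<open>N k\<close> alone,
    makes \<open>r (Suc k) \<ge> N k\<close> hold as well; the summand \<open>k\<close> makes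
    \<open>r\<close> tend to infinity.\<close>
  define r where "r k = k + (\<Sum>i\<le>k. N i)" for k
  have r: "r k \<ge> N k" "r (Suc k) \<ge> N k" "r k \<ge> k" for k
    by (auto simp: r_def intro: order_trans[OF member_le_sum[of k "{..k}" N]])
  define d where "d k x = norm (f (r (Suc k)) x - f (r k) x)" for k x
  have [measurable]: "d k \<in> borel_measurable M" for k unfolding d_def by measurable
  have "(\<integral>\<^sup>+ x. (\<Sum>k. ennreal ((2^k * d k x) powr p)) \<partial>M) = (\<Sum>k. \<integral>\<^sup>+ x. ennreal ((2^k * d k x) powr p) \<partial>M)"
    by (intro nn_integral_suminf) auto
  also have "\<dots> \<le> (\<Sum>k. ennreal ((1/2)^k))"
  proof (intro suminf_le)
    fix k
    have "(\<integral>\<^sup>+ x. ennreal ((2^k * d k x) powr p) \<partial>M)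
       = (\<integral>\<^sup>+ x. ennreal ((2^k) powr p) * ennreal (d k x powr p) \<partial>M)"
      by (simp add: powr_mult ennreal_mult d_def)
    also have "\<dots> = ennreal ((2^k) powr p) * (\<integral>\<^sup>+ x. ennreal (d k x powr p) \<partial>M)"
      by (intro nn_integral_cmult) auto
    also have "\<dots> \<le> ennreal ((2^k) powr p) * ennreal (((1/4)^k) powr p)"
      using N[OF r(2,1), of k] p by (intro mult_left_mono) (auto simp: Lp_norm_le_iff d_def)
    also have "\<dots> = ennreal ((2^k * (1/4)^k) powr p)"
      by (subst powr_mult) (auto simp: ennreal_mult)
    also have "(2^k * (1/4)^k :: real) = (1/2)^k" by (simp add: power_mult_distrib[symmetric])
    also have "((1/2::real)^k) powr p \<le> ((1/2)^k) powr 1"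
      using p by (intro powr_mono') (auto intro: power_le_one)
    finally show "(\<integral>\<^sup>+ x. ennreal ((2^k * d k x) powr p) \<partial>M) \<le> ennreal ((1/2)^k)"
      by (simp add: ennreal_leI)
  qed auto
  also have "\<dots> = ennreal (\<Sum>k. (1/2)^k)"
    by (intro suminf_ennreal2 summable_geometric) auto
  also have "\<dots> < \<infinity>" by simp
  finally have "(\<integral>\<^sup>+ x. (\<Sum>k. ennreal ((2^k * d k x) powr p)) \<partial>M) \<noteq> \<infinity>" by simp
  then have "AE x in M. (\<Sum>k. ennreal ((2^k * d k x) powr p)) \<noteq> \<infinity>"
    by (intro nn_integral_noteq_infinite) auto
  then have conv: "AE x in M. convergent (\<lambda>k. f (r k) x)"
  proof eventually_elim
    case (elim x)
    then obtain S where S: "(\<Sum>k. ennreal ((2^k * d k x) powr p)) = ennreal S" "S \<ge> 0"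
      by (rule ennreal_realE)
    have le: "norm (f (r (Suc k)) x - f (r k) x) \<le> S powr (1/p) * (1/2)^k" for k
    proof -
      have term_le: "t k \<le> (\<Sum>k. t k)" for t :: "nat \<Rightarrow> ennreal"
        using sum_le_suminf[of t "{k}"] by simp
      have "ennreal ((2^k * d k x) powr p) \<le> ennreal S"
        using term_le[of "\<lambda>k. ennreal ((2^k * d k x) powr p)"] unfolding S(1) .
      then have "(2^k * d k x) powr p \<le> S" using S by simp
      then have "((2^k * d k x) powr p) powr (1/p) \<le> S powr (1/p)" using p by (intro powr_mono2) auto
      then have "2^k * d k x \<le> S powr (1/p)" using p by (simp add: powr_powr d_def)
      then show ?thesis by (simp add: d_def field_simps)
    qed
    have "summable (\<lambda>k. f (r (Suc k)) x - f (r k) x)"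
      by (rule summable_comparison_test'[OF _ le]) (intro summable_mult summable_geometric, simp)
    then have "convergent (\<lambda>n. \<Sum>k<n. f (r (Suc k)) x - f (r k) x)"
      by (simp add: summable_iff_convergent)
    then have "convergent (\<lambda>n. (f (r n) x - f (r 0) x) + f (r 0) x)"
      unfolding sum_lessThan_telescope[of "\<lambda>k. f (r k) x"] by (intro convergent_add convergent_const)
    then show ?case by simp
  qed
  define g where "g x = lim (\<lambda>k. f (r k) x)" for x
  have [measurable]: "g \<in> borel_measurable M" unfolding g_def by measurable
  have lim: "AE x in M. (\<lambda>k. f (r k) x) \<longlonglongrightarrow> g x"
    using conv by eventually_elim (simp add: g_def convergent_LIMSEQ_iff)
  have "(\<lambda>k. Lp_norm (ennreal p) M (\<lambda>x. f k x - g x)) \<longlonglongrightarrow> 0"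
  proof (rule tendsto_ennreal_zeroI)
    fix e :: real assume "e > 0"
    then obtain K where K: "\<forall>m\<ge>K. \<forall>n\<ge>K. Lp_norm (ennreal p) M (\<lambda>x. f m x - f n x) \<le> ennreal e"
      using Cauchy by blast
    show "\<forall>\<^sub>F k in sequentially. Lp_norm (ennreal p) M (\<lambda>x. f k x - g x) \<le> ennreal e"
      unfolding eventually_sequentially
    proof (intro exI[of _ K] allI impI)
      fix n assume "n \<ge> K"
      show "Lp_norm (ennreal p) M (\<lambda>x. f n x - g x) \<le> ennreal e"
      proof (rule Lp_norm_Fatou)
        show "AE x in M. (\<lambda>k. f n x - f (r k) x) \<longlonglongrightarrow> f n x - g x"
          using lim by eventually_elim (intro tendsto_intros)
        show "\<forall>\<^sub>F k in sequentially. Lp_norm (ennreal p) M (\<lambda>x. f n x - f (r k) x) \<le> ennreal e"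
          unfolding eventually_sequentially using K \<open>n \<ge> K\<close> r(3) by (meson order_trans)
      qed (use p in auto)
    qed
  qed
  then show ?thesis by (rule that[OF \<open>g \<in> borel_measurable M\<close>])
qed

section \<open>Test functions\<close>

lemma partial_deriv_eqI:
  "(f has_derivative f') (at x) \<Longrightarrow> partial_deriv i f x = f' (axis i 1)"
  unfolding partial_deriv_def by (metis frechet_derivative_at)

lemma has_derivative_partial_deriv:
  assumes "f differentiable (at x)"
  shows "(f has_derivative (\<lambda>h. \<Sum>i\<in>UNIV. (h $ i) *\<^sub>R partial_deriv i f x)) (at x)"
proof -
  from assms have d: "(f has_derivative frechet_derivative f (at x)) (at x)"
    by (simp add: frechet_derivative_works)
  interpret bounded_linear "frechet_derivative f (at x)" using d by (rule has_derivative_bounded_linear)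
  have "frechet_derivative f (at x) h = (\<Sum>i\<in>UNIV. (h $ i) *\<^sub>R partial_deriv i f x)" for h
  proof -
    have "h = (\<Sum>i\<in>UNIV. (h $ i) *\<^sub>R axis i 1)"
      by (simp add: vec_eq_iff axis_def if_distrib cong: if_cong)
    then have "frechet_derivative f (at x) h = frechet_derivative f (at x) (\<Sum>i\<in>UNIV. (h $ i) *\<^sub>R axis i 1)"
      by simp
    then show ?thesis by (simp add: sum scaleR partial_deriv_def)
  qed
  with d show ?thesis by (metis (no_types, lifting) ext)
qed

lemma frechet_derivative_worksI:
  "f differentiable (at x) \<Longrightarrow> (f has_derivative frechet_derivative f (at x)) (at x)"
  using frechet_derivative_works by blast

lemma partial_deriv_bounded_linear:
  assumes "bounded_linear L" "f differentiable (at x)"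
  shows "partial_deriv i (\<lambda>x. L (f x)) x = L (partial_deriv i f x)"
proof -
  have "((\<lambda>x. L (f x)) has_derivative (\<lambda>h. L (frechet_derivative f (at x) h))) (at x)"
    using bounded_linear.has_derivative[OF assms(1) frechet_derivative_worksI[OF assms(2)]] .
  from partial_deriv_eqI[OF this] show ?thesis by (simp add: partial_deriv_def)
qed

lemma partial_deriv_add:
  assumes "f differentiable (at x)" "g differentiable (at x)"
  shows "partial_deriv i (\<lambda>x. f x + g x) x = partial_deriv i f x + partial_deriv i g x"
proof -
  have "((\<lambda>x. f x + g x) has_derivative (\<lambda>h. frechet_derivative f (at x) h + frechet_derivative g (at x) h)) (at x)"
    using has_derivative_add[OF assms[THEN frechet_derivative_worksI]] .
  from partial_deriv_eqI[OF this] show ?thesis by (simp add: partial_deriv_def)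
qed

lemma partial_deriv_mult:
  assumes "f differentiable (at x)" "g differentiable (at x)"
  shows "partial_deriv i (\<lambda>x. f x * g x) x = f x * partial_deriv i g x + partial_deriv i f x * g x"
proof -
  have "((\<lambda>x. f x * g x) has_derivative (\<lambda>h. f x * frechet_derivative g (at x) h + frechet_derivative f (at x) h * g x)) (at x)"
    using has_derivative_mult[OF assms[THEN frechet_derivative_worksI]] .
  from partial_deriv_eqI[OF this] show ?thesis by (simp add: partial_deriv_def)
qed

text \<open>Needed for products: a partial derivative of \<open>f * g\<close> multiplies one factor
  by a derivative of the other, so two orders of smoothness meet.\<close>

lemma Ck_function_Suc_imp: "Ck_function (Suc k) f \<Longrightarrow> Ck_function k f"
proof (induction k arbitrary: f)
  case 0
  then show ?case by (simp add: continuous_on_eq_continuous_within differentiable_imp_continuous_within)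
next
  case (Suc k)
  then show ?case by (metis Ck_function.simps(2))
qed

text \<open>Linearity is over the reals, so that conjugation is covered together with multiplication
  by a complex constant; both are applied to test functions later.\<close>

lemma Ck_function_bounded_linear:
  assumes "bounded_linear L"
  shows "Ck_function k f \<Longrightarrow> Ck_function k (\<lambda>x. L (f x))"
proof (induction k arbitrary: f)
  case 0
  then show ?case using assms by (auto intro: bounded_linear.continuous_on)
next
  case (Suc k)
  then have d: "f differentiable (at x)" for x by simp
  have "(\<lambda>x. L (f x)) differentiable (at x)" for x
    using bounded_linear.has_derivative[OF assms] d unfolding differentiable_def by blast
  moreover have "partial_deriv i (\<lambda>x. L (f x)) = (\<lambda>x. L (partial_deriv i f x))" for i
    using partial_deriv_bounded_linear[OF assms d] by blast
  ultimately show ?case using Suc by simp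
qed

lemma Ck_function_add:
  "Ck_function k f \<Longrightarrow> Ck_function k g \<Longrightarrow> Ck_function k (\<lambda>x. f x + g x)"
proof (induction k arbitrary: f g)
  case 0
  then show ?case by (auto intro: continuous_on_add)
next
  case (Suc k)
  then have d: "f differentiable (at x)" "g differentiable (at x)" for x by simp_all
  have "partial_deriv i (\<lambda>x. f x + g x) = (\<lambda>x. partial_deriv i f x + partial_deriv i g x)" for i
    using partial_deriv_add[OF d] by blast
  then show ?case using Suc by (simp add: differentiable_add)
qed

lemma Ck_function_mult:
  "Ck_function k f \<Longrightarrow> Ck_function k g \<Longrightarrow> Ck_function k (\<lambda>x. f x * g x)"
proof (induction k arbitrary: f g)
  case 0
  then show ?case by (auto intro: continuous_on_mult)
next
  case (Suc k)
  then have d: "f differentiable (at x)" "g differentiable (at x)" for x by simp_all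
  have "partial_deriv i (\<lambda>x. f x * g x) = (\<lambda>x. f x * partial_deriv i g x + partial_deriv i f x * g x)" for i
    using partial_deriv_mult[OF d] by blast
  moreover have "Ck_function k f" "Ck_function k g" using Suc.prems Ck_function_Suc_imp by blast+
  ultimately show ?case using Suc by (simp add: differentiable_mult Ck_function_add)
qed

lemma partial_deriv_const: "partial_deriv i (\<lambda>x. c) = (\<lambda>x. 0)"
  using partial_deriv_eqI[OF has_derivative_const] by blast

lemma Ck_function_const: "Ck_function k (\<lambda>x. c)"
  by (induction k arbitrary: c) (auto simp: partial_deriv_const)

lemma Ck_function_prod:
  assumes "\<And>i. i \<in> I \<Longrightarrow> Ck_function k (f i)"
  shows "Ck_function k (\<lambda>x. \<Prod>i\<in>I. f i x)"
  using assms by (induction I rule: infinite_finite_induct)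
    (auto simp: Ck_function_const intro: Ck_function_mult)

text \<open>The functions \<open>P(1/t) exp(-1/t)\<close>, extended by zero, are closed under differentiation.\<close>

definition flat_exp :: "real poly \<Rightarrow> real \<Rightarrow> real" where
  "flat_exp P t = (if t > 0 then poly P (1 / t) * exp (- (1 / t)) else 0)"

lemma poly_exp_tendsto_0: "((\<lambda>s::real. poly P s * exp (- s)) \<longlongrightarrow> 0) at_top"
proof -
  have "((\<lambda>s::real. \<Sum>i\<le>degree P. coeff P i * (s ^ i / exp s)) \<longlongrightarrow> (\<Sum>i\<le>degree P. coeff P i * 0)) at_top"
    by (intro tendsto_intros tendsto_power_div_exp_0)
  then show ?thesis by (simp add: poly_altdef sum_distrib_right exp_minus divide_inverse mult.assoc)
qed

text \<open>With s = 1/t, differentiating P(s) exp(-s) in t gives s^2 (P(s) - P'(s)) exp(-s), and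
  \<open>[:0,0,1:]\<close> is the polynomial s^2. At t = 0 the right difference quotient is s P(s)
  exp(-s) with s tending to infinity, and the left one is zero.\<close>

lemma flat_exp_deriv:
  "(flat_exp P has_real_derivative flat_exp ([:0,0,1:] * (P - pderiv P)) t) (at t)"
proof (cases "t = 0")
  case False
  show ?thesis
  proof (cases "t > 0")
    case True
    have "((\<lambda>t. poly P (1 / t) * exp (- (1 / t))) has_real_derivative
        flat_exp ([:0,0,1:] * (P - pderiv P)) t) (at t)"
      using True by (auto simp: flat_exp_def field_simps power2_eq_square intro!: derivative_eq_intros)
    then show ?thesis
      by (rule has_field_derivative_transform_within_open[where S = "{0<..}"])
        (use True in \<open>auto simp: flat_exp_def\<close>)
  next
    case neg: False
    have "((\<lambda>t. 0) has_real_derivative 0) (at t)" by simp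
    then have "(flat_exp P has_real_derivative 0) (at t)"
      by (rule has_field_derivative_transform_within_open[where S = "{..<0}"])
        (use False neg in \<open>auto simp: flat_exp_def\<close>)
    then show ?thesis using neg by (simp add: flat_exp_def)
  qed
next
  case True
  have "((\<lambda>s. poly ([:0,1:] * P) s * exp (- s)) \<longlongrightarrow> 0) at_top" by (rule poly_exp_tendsto_0)
  then have r: "((\<lambda>h::real. poly ([:0,1:] * P) (inverse h) * exp (- inverse h)) \<longlongrightarrow> 0) (at_right 0)"
    by (rule filterlim_compose) (rule filterlim_inverse_at_top_right)
  have "((\<lambda>h. flat_exp P h / h) \<longlongrightarrow> 0) (at_right 0)"
    by (rule tendsto_cong[THEN iffD1, OF _ r]) (auto simp: eventually_at_filter flat_exp_def field_simps)
  moreover have "((\<lambda>h. flat_exp P h / h) \<longlongrightarrow> 0) (at_left 0)"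
    by (rule tendsto_cong[THEN iffD1, OF _ tendsto_const]) (auto simp: eventually_at_filter flat_exp_def)
  ultimately have "((\<lambda>h. flat_exp P h / h) \<longlongrightarrow> 0) (at 0)"
    by (simp add: filterlim_split_at)
  then show ?thesis using True
    by (simp add: has_field_derivative_iff flat_exp_def)
qed

text \<open>\<open>P\<close> has to vary in the induction, since each derivative changes it. Affine
  functions of a single coordinate suffice because the bumps below are products over the
  coordinates.\<close>

lemma Ck_function_flat_exp:
  "Ck_function k (\<lambda>x::real^'n::finite. complex_of_real (flat_exp P (c * x $ i + d)))"
proof (induction k arbitrary: P)
  case 0
  have "continuous_on UNIV (flat_exp P)"
    by (meson DERIV_isCont continuous_at_imp_continuous_on flat_exp_deriv)
  then have "continuous_on UNIV (\<lambda>x::real^'n. flat_exp P (c * x $ i + d))"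
    by (rule continuous_on_compose2) (auto intro!: continuous_intros)
  then show ?case by (auto intro: continuous_on_of_real)
next
  case (Suc k)
  let ?Q = "[:0,0,1:] * (P - pderiv P)"
  have d: "((\<lambda>x::real^'n. complex_of_real (flat_exp P (c * x $ i + d))) has_derivative
     (\<lambda>h. complex_of_real (flat_exp ?Q (c * x $ i + d) * (c * h $ i)))) (at x)" for x
  proof (rule has_derivative_of_real)
    have "(flat_exp P has_derivative (*) (flat_exp ?Q (c * x $ i + d))) (at (c * x $ i + d))"
      using flat_exp_deriv by (simp add: has_field_derivative_def)
    moreover have "((\<lambda>x::real^'n. c * x $ i + d) has_derivative (\<lambda>h. c * h $ i)) (at x)"
      using has_derivative_add[OF has_derivative_mult_right[OF bounded_linear_imp_has_derivative[OF
            bounded_linear_vec_nth[of i]]] has_derivative_const[of d], of c] by simp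
    ultimately show "((\<lambda>x::real^'n. flat_exp P (c * x $ i + d)) has_derivative
       (\<lambda>h. flat_exp ?Q (c * x $ i + d) * (c * h $ i))) (at x)"
      using has_derivative_compose by fast
  qed
  have "partial_deriv j (\<lambda>x::real^'n. complex_of_real (flat_exp P (c * x $ i + d))) =
     (\<lambda>x. complex_of_real (c * axis j 1 $ i) * complex_of_real (flat_exp ?Q (c * x $ i + d)))" for j
    using partial_deriv_eqI[OF d] by (auto simp: mult.commute)
  moreover have "(\<lambda>x::real^'n. complex_of_real (flat_exp P (c * x $ i + d))) differentiable (at x)" for x
    using d unfolding differentiable_def by blast
  ultimately show ?case
    using Ck_function_bounded_linear[OF bounded_linear_mult_right Suc[of ?Q]] by simp
qed

text \<open>Each factor is exp(-1/s) in a multiple of the signed distance to a face, so the bump is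
  positive exactly inside the box. Growing \<open>m\<close> steepens the transition at the faces
  without moving the support; \<open>Suc m\<close> keeps the bump with \<open>m = 0\<close> nonzero,
  which serves later as a concrete nontrivial test function.\<close>

definition box_bump :: "real^'n::finite \<Rightarrow> real^'n \<Rightarrow> nat \<Rightarrow> real^'n \<Rightarrow> complex" where
  "box_bump a b m x = (\<Prod>i\<in>UNIV.
     of_real (flat_exp 1 (real (Suc m) * (x $ i - a $ i))) *
     of_real (flat_exp 1 (real (Suc m) * (b $ i - x $ i))))"

lemma Ck_function_box_bump: "Ck_function k (box_bump a b m)"
proof -
  have "box_bump a b m = (\<lambda>x. \<Prod>i\<in>UNIV.
     of_real (flat_exp 1 (real (Suc m) * x $ i + (- real (Suc m) * a $ i))) *
     of_real (flat_exp 1 (- real (Suc m) * x $ i + real (Suc m) * b $ i)))"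
    unfolding box_bump_def by (simp add: algebra_simps)
  then show ?thesis
    by (simp only:) (intro Ck_function_prod Ck_function_mult Ck_function_flat_exp)
qed

lemma flat_exp_1_bounds: "0 \<le> flat_exp 1 t" "flat_exp 1 t \<le> 1" "flat_exp 1 t = 0 \<longleftrightarrow> t \<le> 0"
  by (auto simp: flat_exp_def)

lemma box_bump_eq_0: "x \<notin> box a b \<Longrightarrow> box_bump a b m x = 0"
proof -
  assume "x \<notin> box a b"
  then obtain i where "x $ i \<le> a $ i \<or> b $ i \<le> x $ i" by (auto simp: mem_box_cart not_less)
  then have "flat_exp 1 (real (Suc m) * (x $ i - a $ i)) = 0 \<or> flat_exp 1 (real (Suc m) * (b $ i - x $ i)) = 0"
    unfolding flat_exp_1_bounds(3) by (simp add: mult_le_0_iff)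
  then show ?thesis unfolding box_bump_def by (intro prod_zero) auto
qed

lemma box_bump_neq_0: "x \<in> box a b \<Longrightarrow> box_bump a b m x \<noteq> 0"
proof -
  assume x: "x \<in> box a b"
  have "flat_exp 1 (real (Suc m) * (x $ i - a $ i)) \<noteq> 0 \<and> flat_exp 1 (real (Suc m) * (b $ i - x $ i)) \<noteq> 0" for i
    using x unfolding flat_exp_1_bounds(3) by (simp add: mult_le_0_iff mem_box_cart not_le)
  then show ?thesis by (simp add: box_bump_def)
qed

lemma norm_box_bump_le: "norm (box_bump a b m x) \<le> 1"
  unfolding box_bump_def prod_norm[symmetric] norm_mult norm_of_real
  by (intro prod_le_1) (auto simp: flat_exp_1_bounds intro!: mult_le_one)

lemma box_bump_tendsto: "(\<lambda>m. box_bump a b m x) \<longlonglongrightarrow> indicator (box a b) x"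
proof (cases "x \<in> box a b")
  case True
  have l: "(\<lambda>m. flat_exp 1 (real (Suc m) * s)) \<longlonglongrightarrow> 1" if "s > 0" for s
  proof -
    have "(\<lambda>m. exp (- (inverse (real (Suc m)) / s))) \<longlonglongrightarrow> exp (- (0 / s))"
      by (intro tendsto_intros LIMSEQ_inverse_real_of_nat) (use that in auto)
    moreover have "flat_exp 1 (real (Suc m) * s) = exp (- (inverse (real (Suc m)) / s))" for m
      using that by (simp add: flat_exp_def divide_inverse mult.commute)
    ultimately show ?thesis by simp
  qed
  have "(\<lambda>m. box_bump a b m x) \<longlonglongrightarrow> (\<Prod>i\<in>(UNIV::'a set). of_real 1 * of_real 1)"
    unfolding box_bump_def
  proof (intro tendsto_prod tendsto_mult tendsto_of_real)
    fix i
    have "x $ i - a $ i > 0" "b $ i - x $ i > 0" using True by (auto simp: mem_box_cart)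
    from this[THEN l]
    show "(\<lambda>m. flat_exp 1 (real (Suc m) * (x $ i - a $ i))) \<longlonglongrightarrow> 1"
      "(\<lambda>m. flat_exp 1 (real (Suc m) * (b $ i - x $ i))) \<longlonglongrightarrow> 1" .
  qed
  then show ?thesis using True by simp
next
  case False
  then show ?thesis by (simp add: box_bump_eq_0)
qed

lemma test_functions_box_bump:
  assumes "cbox a b \<subseteq> D"
  shows "box_bump a b m \<in> test_functions D"
proof -
  have c: "closure {x. box_bump a b m x \<noteq> 0} \<subseteq> cbox a b"
  proof (rule closure_minimal)
    show "{x. box_bump a b m x \<noteq> 0} \<subseteq> cbox a b"
      using box_bump_eq_0[of _ a b m] box_subset_cbox[of a b] by blast
  qed (rule closed_cbox)
  moreover have "compact (closure {x. box_bump a b m x \<noteq> 0})"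
    using c by (meson bounded_cbox bounded_subset closed_closure compact_eq_bounded_closed)
  ultimately show ?thesis using assms Ck_function_box_bump by (auto simp: test_functions_def)
qed

section \<open>Supports and linear combinations of test functions\<close>

lemma test_functions_differentiable:
  assumes "\<phi> \<in> test_functions D" shows "\<phi> differentiable (at x)"
  using assms Ck_function.simps(2)[of 0 \<phi>] by (auto simp: test_functions_def)

lemma test_functions_continuous:
  assumes "\<phi> \<in> test_functions D" shows "continuous_on A \<phi>"
  using assms Ck_function.simps(1)[of \<phi>] continuous_on_subset by (auto simp: test_functions_def)

lemma test_functions_continuous_partial_deriv:
  assumes "\<phi> \<in> test_functions D" shows "continuous_on A (partial_deriv i \<phi>)"
proof -
  have "Ck_function (Suc 0) \<phi>" using assms unfolding test_functions_def by blast
  then have "continuous_on UNIV (partial_deriv i \<phi>)" by simp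
  then show ?thesis by (rule continuous_on_subset) simp
qed

text \<open>On the open complement of the closed support the function is constantly zero, hence
  differentiable there with derivative zero; so a single compact set works for the function and all
  its partial derivatives.\<close>

lemma test_functions_support:
  assumes "\<phi> \<in> test_functions D"
  obtains K where "compact K" "K \<subseteq> D" "\<And>x. x \<notin> K \<Longrightarrow> \<phi> x = 0" "\<And>x i. x \<notin> K \<Longrightarrow> partial_deriv i \<phi> x = 0"
proof
  let ?K = "closure {x. \<phi> x \<noteq> 0}"
  show "compact ?K" "?K \<subseteq> D" using assms by (auto simp: test_functions_def)
  show 0: "\<phi> x = 0" if "x \<notin> ?K" for x using that closure_subset[of "{x. \<phi> x \<noteq> 0}"] by blast
  show "partial_deriv i \<phi> x = 0" if "x \<notin> ?K" for x i
  proof -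
    have "(\<phi> has_derivative (\<lambda>h. 0)) (at x)"
    proof (rule has_derivative_transform_within_open)
      show "((\<lambda>_. 0) has_derivative (\<lambda>h. 0)) (at x)" by (rule has_derivative_const)
      show "open (- ?K)" by (simp add: open_Compl)
      show "x \<in> - ?K" using that by simp
      show "0 = \<phi> y" if "y \<in> - ?K" for y using 0[of y] that by simp
    qed
    from partial_deriv_eqI[OF this] show ?thesis .
  qed
qed

lemma compact_closed_subset:
  fixes K A :: "'a::t2_space set"
  assumes "compact K" "closed A" "A \<subseteq> K"
  shows "compact A"
proof -
  have "K \<inter> A = A" using assms by blast
  then show ?thesis using compact_Int_closed[OF assms(1,2)] by simp
qed

lemma test_functions_add:
  assumes "\<phi> \<in> test_functions D" "\<psi> \<in> test_functions D"
  shows "(\<lambda>x. \<phi> x + \<psi> x) \<in> test_functions D"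
proof -
  have "closure {x. \<phi> x + \<psi> x \<noteq> 0} \<subseteq> closure ({x. \<phi> x \<noteq> 0} \<union> {x. \<psi> x \<noteq> 0})"
    by (intro closure_mono) auto
  then have c: "closure {x. \<phi> x + \<psi> x \<noteq> 0} \<subseteq> closure {x. \<phi> x \<noteq> 0} \<union> closure {x. \<psi> x \<noteq> 0}"
    by (simp add: closure_Un)
  have k: "compact (closure {x. \<phi> x \<noteq> 0} \<union> closure {x. \<psi> x \<noteq> 0})"
    using assms by (auto simp: test_functions_def intro: compact_Un)
  have "compact (closure {x. \<phi> x + \<psi> x \<noteq> 0})"
    by (rule compact_closed_subset[OF k closed_closure c])
  then show ?thesis using assms c by (auto simp: test_functions_def intro: Ck_function_add)
qed

lemma test_functions_bounded_linear:
  assumes "\<phi> \<in> test_functions D" "bounded_linear L"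
  shows "(\<lambda>x. L (\<phi> x)) \<in> test_functions D"
proof -
  have c: "closure {x. L (\<phi> x) \<noteq> 0} \<subseteq> closure {x. \<phi> x \<noteq> 0}"
    by (intro closure_mono) (use assms in \<open>auto simp: linear_simps\<close>)
  moreover have "compact (closure {x. L (\<phi> x) \<noteq> 0})"
    using compact_closed_subset[OF _ closed_closure c] assms by (auto simp: test_functions_def)
  ultimately show ?thesis using assms by (auto simp: test_functions_def intro: Ck_function_bounded_linear)
qed

lemma gradient_add:
  assumes "\<phi> \<in> test_functions D" "\<psi> \<in> test_functions D"
  shows "gradient (\<lambda>x. \<phi> x + \<psi> x) x = gradient \<phi> x + gradient \<psi> x"
  using assms by (simp add: gradient_def vec_eq_iff partial_deriv_add test_functions_differentiable)

lemma gradient_bounded_linear: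
  assumes "\<phi> \<in> test_functions D" "bounded_linear L"
  shows "gradient (\<lambda>x. L (\<phi> x)) x = (\<chi> i. L (gradient \<phi> x $ i))"
  using assms by (simp add: gradient_def vec_eq_iff partial_deriv_bounded_linear test_functions_differentiable)

lemma gradient_scaleR:
  assumes "\<phi> \<in> test_functions D"
  shows "gradient (\<lambda>x. c *\<^sub>R \<phi> x) x = c *\<^sub>R gradient \<phi> x"
  using gradient_bounded_linear[OF assms bounded_linear_scaleR_right[of c]] by (simp add: vec_eq_iff)

lemma test_functions_scaleR:
  "\<phi> \<in> test_functions D \<Longrightarrow> (\<lambda>x. c *\<^sub>R \<phi> x) \<in> test_functions D"
  by (rule test_functions_bounded_linear[OF _ bounded_linear_scaleR_right])

lemma test_functions_diff:
  assumes "\<phi> \<in> test_functions D" "\<psi> \<in> test_functions D"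
  shows "(\<lambda>x. \<phi> x - \<psi> x) \<in> test_functions D"
  using test_functions_add[OF assms(1) test_functions_scaleR[OF assms(2), of "-1"]] by simp

lemma gradient_diff:
  assumes "\<phi> \<in> test_functions D" "\<psi> \<in> test_functions D"
  shows "gradient (\<lambda>x. \<phi> x - \<psi> x) x = gradient \<phi> x - gradient \<psi> x"
  using gradient_add[OF assms(1) test_functions_scaleR[OF assms(2), of "-1"]] gradient_scaleR[OF assms(2), of "-1"]
  by simp

lemma continuous_gradient:
  assumes "\<phi> \<in> test_functions D" shows "continuous_on A (gradient \<phi>)"
  unfolding gradient_def
  by (intro continuous_on_vec_lambda test_functions_continuous_partial_deriv[OF assms])

section \<open>Uniqueness of weak gradients\<close>

lemma borel_measurable_lebesgue_on:
  assumes "f \<in> borel_measurable borel"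
  shows "f \<in> borel_measurable (lebesgue_on D)"
  using assms by (intro measurable_restrict_space1 measurable_completion) simp

text \<open>Moves integrals of functions supported in \<open>D\<close> to the whole space with
  \<open>lborel\<close>, where translation invariance and Fubini's theorem apply.\<close>

lemma nn_integral_lebesgue_on_eq_lborel:
  fixes D :: "'a::euclidean_space set"
  assumes "f \<in> borel_measurable borel" "D \<in> sets lebesgue" "\<And>x. x \<notin> D \<Longrightarrow> f x = 0"
  shows "(\<integral>\<^sup>+ x. f x \<partial>lebesgue_on D) = (\<integral>\<^sup>+ x. f x \<partial>lborel)"
proof -
  have "(\<integral>\<^sup>+ x. f x \<partial>lebesgue_on D) = (\<integral>\<^sup>+ x. f x * indicator D x \<partial>lebesgue)"
    using assms(2) by (intro nn_integral_restrict_space) simp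
  also have "(\<lambda>x. f x * indicator D x) = f" using assms(3) by (auto simp: indicator_def)
  finally show ?thesis by (simp add: nn_integral_completion)
qed

lemma integral_lebesgue_on_eq_lborel:
  fixes f :: "'a::euclidean_space \<Rightarrow> 'b::{banach, second_countable_topology}"
  assumes "f \<in> borel_measurable borel" "D \<in> sets lebesgue" "\<And>x. x \<notin> D \<Longrightarrow> f x = 0"
  shows "(LINT x|lebesgue_on D. f x) = (LINT x|lborel. f x)"
proof -
  have "(LINT x|lebesgue_on D. f x) = (LINT x|lebesgue. indicator D x *\<^sub>R f x)"
    using assms(2) by (intro integral_restrict_space) simp
  also have "(\<lambda>x. indicator D x *\<^sub>R f x) = f" using assms(3) by (auto simp: indicator_def)
  finally show ?thesis using assms(1) by (simp add: integral_completion)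
qed

lemma Lp_norm_lebesgue_on_eq_lborel:
  fixes f :: "'a::euclidean_space \<Rightarrow> 'b::{real_normed_vector, second_countable_topology}"
  assumes [measurable]: "f \<in> borel_measurable borel" and "D \<in> sets lebesgue" "\<And>x. x \<notin> D \<Longrightarrow> f x = 0" "p > 0"
  shows "Lp_norm (ennreal p) (lebesgue_on D) f = Lp_norm (ennreal p) lborel f"
proof -
  have "(\<integral>\<^sup>+ x. ennreal (norm (f x) powr p) \<partial>lebesgue_on D) = (\<integral>\<^sup>+ x. ennreal (norm (f x) powr p) \<partial>lborel)"
    using assms by (intro nn_integral_lebesgue_on_eq_lborel) auto
  then show ?thesis using assms(4) by (simp add: Lp_norm_def)
qed

text \<open>An open set is a countable union of closed boxes. On each of them the function is
  integrable, hence measurable, and measurability glues over a countable cover.\<close>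

lemma locally_integrable_borel_measurable:
  fixes f :: "real^'n::finite \<Rightarrow> 'b::euclidean_space"
  assumes D: "open D" and f: "locally_integrable D f"
  shows "f \<in> borel_measurable (lebesgue_on D)"
proof -
  obtain C where C: "countable C" "C \<subseteq> Pow D" "\<And>X. X \<in> C \<Longrightarrow> \<exists>a b. X = cbox a b" "\<Union>C = D"
    using open_countable_Union_open_cbox[OF D] by metis
  show ?thesis
  proof (rule measurable_piecewise_restrict[OF C(1)])
    show "X \<inter> space (lebesgue_on D) \<in> sets (lebesgue_on D)" if XC: "X \<in> C" for X
    proof -
      obtain a b where X: "X = cbox a b" using C(3)[OF XC] by auto
      then have "X \<in> sets lebesgue" by simp
      moreover have "X \<subseteq> D" using XC C by auto
      ultimately show ?thesis by (auto simp: sets_restrict_space Int_absorb2)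
    qed
    show "space (lebesgue_on D) \<subseteq> \<Union>C" using C by simp
    show "f \<in> borel_measurable (restrict_space (lebesgue_on D) X)" if XC: "X \<in> C" for X
    proof -
      obtain a b where X: "X = cbox a b" using C(3)[OF XC] by auto
      have "X \<subseteq> D" using XC C by auto
      have "D \<in> sets lebesgue" "X \<in> sets lebesgue" using D X by auto
      then have "restrict_space (lebesgue_on D) X = lebesgue_on X"
        using \<open>X \<subseteq> D\<close> by (subst restrict_restrict_space) (auto simp: Int_absorb1)
      moreover have "f absolutely_integrable_on X"
        using f \<open>X \<subseteq> D\<close> X by (auto simp: locally_integrable_def)
      ultimately show ?thesis
        using absolutely_integrable_imp_integrable[OF _ \<open>X \<in> sets lebesgue\<close>] borel_measurable_integrable by metis
    qed
  qed
qed

lemma integrable_locally_integrable_mult: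
  fixes f \<psi> :: "real^'n::finite \<Rightarrow> complex"
  assumes D: "open D" and f: "locally_integrable D f" and K: "compact K" "K \<subseteq> D"
    and \<psi>: "\<psi> \<in> borel_measurable borel" "\<And>x. x \<notin> K \<Longrightarrow> \<psi> x = 0" "\<And>x. norm (\<psi> x) \<le> B"
  shows "integrable (lebesgue_on D) (\<lambda>x. f x * \<psi> x)"
proof (rule Bochner_Integration.integrable_bound)
  have KD: "K \<in> sets lebesgue" "D \<in> sets lebesgue" using K D by (auto simp: compact_imp_closed)
  have Kf: "integrable lebesgue (\<lambda>x. indicator K x *\<^sub>R f x)"
    using f K by (simp add: locally_integrable_def set_integrable_def)
  have "integrable lebesgue (\<lambda>x. indicator D x *\<^sub>R (indicator K x *\<^sub>R f x))"
  proof -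
    have "(\<lambda>x. indicator D x *\<^sub>R (indicator K x *\<^sub>R f x)) = (\<lambda>x. indicat_real K x *\<^sub>R f x)"
      using K by (auto simp: indicator_def fun_eq_iff)
    then show ?thesis using Kf by simp
  qed
  then have "integrable (lebesgue_on D) (\<lambda>x. indicator K x *\<^sub>R f x)"
    using KD by (simp add: integrable_restrict_space)
  then show "integrable (lebesgue_on D) (\<lambda>x. B *\<^sub>R (indicator K x *\<^sub>R f x))"
    by (rule integrable_scaleR_right)
  show "(\<lambda>x. f x * \<psi> x) \<in> borel_measurable (lebesgue_on D)"
    using locally_integrable_borel_measurable[OF D f] borel_measurable_lebesgue_on[OF \<psi>(1)] by measurable
  have "norm (f x * \<psi> x) \<le> norm (B *\<^sub>R (indicat_real K x *\<^sub>R f x))" for x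
  proof (cases "x \<in> K")
    case True
    have "norm (f x * \<psi> x) \<le> norm (f x) * B"
      unfolding norm_mult by (intro mult_left_mono \<psi>) auto
    also have "\<dots> \<le> norm (B *\<^sub>R (indicat_real K x *\<^sub>R f x))" using True
      by (simp add: mult.commute mult_right_mono)
    finally show ?thesis .
  qed (use \<psi> in auto)
  then show "AE x in lebesgue_on D. norm (f x * \<psi> x) \<le> norm (B *\<^sub>R (indicat_real K x *\<^sub>R f x))" by simp
qed

text \<open>The bumps converge boundedly to indicators of boxes, so \<open>f\<close> has integral zero over every
  closed box in \<open>D\<close>, and Lebesgue differentiation applies.\<close>

lemma locally_integrable_AE_zero:
  fixes f :: "real^'n::finite \<Rightarrow> complex"
  assumes D: "open D" and f: "locally_integrable D f"
    and 0: "\<And>\<psi>. \<psi> \<in> test_functions D \<Longrightarrow> (LINT x|lebesgue_on D. f x * \<psi> x) = 0"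
  shows "AE x in lebesgue_on D. f x = 0"
proof -
  have fm[measurable]: "f \<in> borel_measurable (lebesgue_on D)"
    by (rule locally_integrable_borel_measurable[OF D f])
  have Dl: "D \<in> sets lebesgue" using D by auto
  have box0: "integral (cbox a b) f = 0" if ab: "cbox a b \<subseteq> D" for a b
  proof -
    \<comment> \<open>The dominating function lives on the closed box, because local integrability
      speaks of compact sets; the bumps converge to the indicator of the open box, which differs
      from it by a null set.\<close>
    have Il: "integrable (lebesgue_on D) (\<lambda>x. f x * indicator (cbox a b) x)"
      by (rule integrable_locally_integrable_mult[OF D f compact_cbox ab, of _ 1])
        (auto simp: indicator_def)
    have bl: "(\<lambda>m. LINT x|lebesgue_on D. f x * box_bump a b m x) \<longlonglongrightarrow>
        (LINT x|lebesgue_on D. f x * indicator (box a b) x)"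
    proof (rule integral_dominated_convergence[OF _ _ Bochner_Integration.integrable_norm[OF Il]])
      have "box_bump a b m \<in> borel_measurable borel" for m
        by (intro borel_measurable_continuous_onI test_functions_continuous[OF test_functions_box_bump[of a b UNIV]]) auto
      from this[THEN borel_measurable_lebesgue_on]
      show "(\<lambda>x. f x * box_bump a b m x) \<in> borel_measurable (lebesgue_on D)" for m by measurable
      have "(indicator (box a b) :: _ \<Rightarrow> complex) \<in> borel_measurable borel" by simp
      from this[THEN borel_measurable_lebesgue_on]
      show "(\<lambda>x. f x * indicator (box a b) x) \<in> borel_measurable (lebesgue_on D)" by measurable
      show "AE x in lebesgue_on D. (\<lambda>m. f x * box_bump a b m x) \<longlonglongrightarrow> f x * indicator (box a b) x"
        by (intro AE_I2 tendsto_intros box_bump_tendsto)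
      have "norm (f x * box_bump a b m x) \<le> norm (f x * indicator (cbox a b) x)" for x m
      proof (cases "x \<in> box a b")
        case True
        then have "x \<in> cbox a b" using box_subset_cbox by blast
        then show ?thesis using norm_box_bump_le[of a b m x]
          by (simp add: norm_mult mult_left_le)
      qed (simp add: box_bump_eq_0)
      then show "AE x in lebesgue_on D. norm (f x * box_bump a b m x) \<le> norm (f x * indicator (cbox a b) x)" for m
        by simp
    qed
    have "(LINT x|lebesgue_on D. f x * box_bump a b m x) = 0" for m
      by (intro 0 test_functions_box_bump ab)
    with bl have "(LINT x|lebesgue_on D. f x * indicator (box a b) x) = 0"
      by (simp add: LIMSEQ_const_iff)
    then have "0 = (LINT x|lebesgue. indicator D x *\<^sub>R (f x * indicator (box a b) x))"
      using Dl by (simp add: integral_restrict_space)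
    also have "(\<lambda>x. indicator D x *\<^sub>R (f x * indicator (box a b) x)) = (\<lambda>x. indicator (box a b) x *\<^sub>R f x)"
      using ab box_subset_cbox[of a b] by (auto simp: indicator_def fun_eq_iff)
    also have "(LINT x|lebesgue. indicator (box a b) x *\<^sub>R f x) = integral (box a b) f"
    proof -
      have "f absolutely_integrable_on cbox a b" using f ab by (auto simp: locally_integrable_def)
      then have "f absolutely_integrable_on box a b" by (simp add: absolutely_integrable_on_open_interval)
      from set_lebesgue_integral_eq_integral(2)[OF this] show ?thesis by (simp add: set_lebesgue_integral_def)
    qed
    finally show ?thesis by (simp add: integral_open_interval)
  qed
  have AE0: "AE x in lebesgue. x \<in> cbox c d \<longrightarrow> f x = 0" if cd: "cbox c d \<subseteq> D" for c d
  proof -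
    \<comment> \<open>Extension by zero, since the differentiation theorem asks for integrability
      over all boxes. Its averages are over the one-sided cubes from \<open>x\<close> to
      \<open>x + h *\<^sub>R One\<close>.\<close>
    define g where "g x = (if x \<in> cbox c d then f x else 0)" for x
    have fi: "f absolutely_integrable_on cbox c d" using f cd by (auto simp: locally_integrable_def)
    then have "g absolutely_integrable_on UNIV" unfolding g_def by (simp add: absolutely_integrable_restrict_UNIV)
    then have "g integrable_on UNIV" by (simp add: set_lebesgue_integral_eq_integral(1))
    then have "g integrable_on cbox a b" for a b
      by (rule integrable_on_subcbox) simp
    then obtain N where N: "negligible N" "\<And>x e. \<lbrakk>x \<notin> N; 0 < e\<rbrakk> \<Longrightarrow>
        \<exists>d>0. \<forall>h. 0 < h \<and> h < d \<longrightarrow> norm (integral (cbox x (x + h *\<^sub>R One)) g /\<^sub>R h ^ DIM(real^'n) - g x) < e"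
      using integrable_ccontinuous_explicit[of g] by metis
    have fz: "f x = 0" if x: "x \<in> box c d" "x \<notin> N" for x
    proof (rule ccontr)
      assume "f x \<noteq> 0"
      then obtain \<delta> where \<delta>: "\<delta> > 0"
        "\<And>h. 0 < h \<Longrightarrow> h < \<delta> \<Longrightarrow> norm (integral (cbox x (x + h *\<^sub>R One)) g /\<^sub>R h ^ DIM(real^'n) - g x) < norm (f x)"
        using N(2)[OF x(2), of "norm (f x)"] by auto
      obtain \<epsilon> where \<epsilon>: "\<epsilon> > 0" "ball x \<epsilon> \<subseteq> box c d" using x(1) open_box open_contains_ball by metis
      \<comment> \<open>Small enough for the differentiation estimate and for the cube, whose
        diagonal has length \<open>h * norm One\<close>, to stay in the ball of radius
        \<open>\<epsilon>\<close> around \<open>x\<close>.\<close>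
      define h where "h = min (\<delta> / 2) (\<epsilon> / 2 / norm (One :: real^'n))"
      have nO: "norm (One :: real^'n) > 0" by (simp add: norm_eq_zero)
      then have h: "0 < h" "h < \<delta>" using \<delta> \<epsilon> by (auto simp: h_def)
      have "h * norm (One :: real^'n) \<le> \<epsilon> / 2" using nO by (simp add: h_def min_def field_simps)
      have "cbox x (x + h *\<^sub>R One) \<subseteq> cbox c d"
      proof -
        have "x \<in> ball x \<epsilon>" "x + h *\<^sub>R One \<in> ball x \<epsilon>"
          using \<epsilon> h \<open>h * norm One \<le> \<epsilon> / 2\<close> by (auto simp: dist_norm)
        then have "x \<in> cbox c d" "x + h *\<^sub>R One \<in> cbox c d" using \<epsilon> box_subset_cbox by blast+
        then show ?thesis by (intro subset_box_imp) (auto simp: mem_box)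
      qed
      then have "integral (cbox x (x + h *\<^sub>R One)) g = integral (cbox x (x + h *\<^sub>R One)) f"
        unfolding g_def by (intro integral_cong) auto
      also have "\<dots> = 0" using \<open>cbox x (x + h *\<^sub>R One) \<subseteq> cbox c d\<close> cd by (intro box0) auto
      \<comment> \<open>The cube average is zero, so the differentiation estimate becomes a bound on
        \<open>g x\<close> alone; but \<open>g x = f x\<close>.\<close>
      finally have "norm (g x) < norm (f x)" using \<delta>(2)[OF h] by simp
      then show False using x box_subset_cbox[of c d] by (auto simp: g_def)
    qed
    have "N \<union> (cbox c d - box c d) \<in> null_sets lebesgue"
      using N(1) null_sets_cbox_Diff_box[of c d] by (auto simp: negligible_iff_null_sets null_sets_completionI)
    then show ?thesis
      by (rule AE_I') (use fz in auto)
  qed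
  obtain C where C: "countable C" "C \<subseteq> Pow D" "\<And>X. X \<in> C \<Longrightarrow> \<exists>a b. X = cbox a b" "\<Union>C = D"
    using open_countable_Union_open_cbox[OF D] by metis
  have "AE x in lebesgue. \<forall>X\<in>C. x \<in> X \<longrightarrow> f x = 0"
  proof (rule AE_ball_countable'[OF _ C(1)])
    fix X assume "X \<in> C"
    then obtain a b where "X = cbox a b" "X \<subseteq> D" using C(2,3) by blast
    then show "AE x in lebesgue. x \<in> X \<longrightarrow> f x = 0" using AE0 by auto
  qed
  then have "AE x in lebesgue. x \<in> D \<longrightarrow> f x = 0" using C(4) by (auto elim: eventually_mono)
  then show ?thesis using Dl by (simp add: AE_restrict_space_iff)
qed

lemma locally_integrable_nth:
  fixes G :: "real^'n::finite \<Rightarrow> complex^'m::finite"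
  assumes "locally_integrable D G"
  shows "locally_integrable D (\<lambda>x. G x $ i)"
  using assms absolutely_integrable_linear[OF _ bounded_linear_vec_nth[of i]]
  by (auto simp: locally_integrable_def o_def)

lemma locally_integrable_diff:
  assumes "locally_integrable D f" "locally_integrable D g"
  shows "locally_integrable D (\<lambda>x. f x - g x)"
  using assms by (auto simp: locally_integrable_def set_integral_diff)

lemma test_functions_bounded:
  assumes "\<phi> \<in> test_functions D" shows "\<exists>B. \<forall>x. norm (\<phi> x) \<le> B"
proof -
  obtain K where K: "compact K" "\<And>x. x \<notin> K \<Longrightarrow> \<phi> x = 0" using test_functions_support[OF assms] by metis
  have "bounded (\<phi> ` K)"
    by (intro compact_imp_bounded compact_continuous_image K test_functions_continuous[OF assms])
  then obtain B where B: "\<And>x. x \<in> K \<Longrightarrow> norm (\<phi> x) \<le> B" by (auto simp: bounded_iff)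
  show ?thesis
  proof (intro exI[of _ "max B 0"] allI)
    fix x show "norm (\<phi> x) \<le> max B 0" using B[of x] K(2)[of x] by (cases "x \<in> K") auto
  qed
qed

lemma test_functions_partial_deriv:
  assumes "\<phi> \<in> test_functions D" shows "partial_deriv i \<phi> \<in> test_functions D"
proof -
  obtain K where K: "compact K" "K \<subseteq> D" "\<And>x. x \<notin> K \<Longrightarrow> partial_deriv i \<phi> x = 0"
    using test_functions_support[OF assms] by metis
  have c: "closure {x. partial_deriv i \<phi> x \<noteq> 0} \<subseteq> K"
    by (rule closure_minimal) (use K compact_imp_closed in auto)
  have "Ck_function k (partial_deriv i \<phi>)" for k
    using assms Ck_function.simps(2)[of k \<phi>] unfolding test_functions_def by blast
  then show ?thesis using compact_closed_subset[OF K(1) closed_closure c] c K(2)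
    by (auto simp: test_functions_def)
qed

lemma test_functions_borel_measurable:
  assumes "\<phi> \<in> test_functions D" shows "\<phi> \<in> borel_measurable borel"
  by (intro borel_measurable_continuous_onI test_functions_continuous[OF assms])

lemma gradient_borel_measurable:
  assumes "\<phi> \<in> test_functions D" shows "gradient \<phi> \<in> borel_measurable borel"
  by (intro borel_measurable_continuous_onI continuous_gradient[OF assms])

lemma integrable_locally_integrable_test:
  assumes "open D" "locally_integrable D f" "\<psi> \<in> test_functions D"
  shows "integrable (lebesgue_on D) (\<lambda>x. f x * \<psi> x)"
proof -
  obtain K where K: "compact K" "K \<subseteq> D" "\<And>x. x \<notin> K \<Longrightarrow> \<psi> x = 0" using test_functions_support[OF assms(3)] by metis
  obtain B where "\<And>x. norm (\<psi> x) \<le> B" using test_functions_bounded[OF assms(3)] by blast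
  then show ?thesis
    by (intro integrable_locally_integrable_mult[OF assms(1,2) K(1,2) test_functions_borel_measurable[OF assms(3)] K(3)])
qed

text \<open>The components of the difference are orthogonal to all test functions. This makes the
  choice in \<open>weak_gradient\<close> harmless: any known weak gradient may replace it under
  norms and integrals.\<close>

lemma weak_gradient_unique:
  assumes D: "open D" and G: "is_weak_gradient D u G" and H: "is_weak_gradient D u H"
  shows "AE x in lebesgue_on D. G x = H x"
proof -
  have "AE x in lebesgue_on D. G x $ i - H x $ i = 0" for i
  proof (rule locally_integrable_AE_zero[OF D])
    have li: "locally_integrable D (\<lambda>x. G x $ i)" "locally_integrable D (\<lambda>x. H x $ i)"
      using G H by (auto simp: is_weak_gradient_def locally_integrable_nth)
    then show "locally_integrable D (\<lambda>x. G x $ i - H x $ i)" by (rule locally_integrable_diff)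
    fix \<psi> assume \<psi>: "\<psi> \<in> test_functions D"
    have "(LINT x|lebesgue_on D. u x * partial_deriv i \<psi> x) = - (LINT x|lebesgue_on D. F x $ i * \<psi> x)"
      if "is_weak_gradient D u F" for F
      using that \<psi> by (simp add: is_weak_gradient_def)
    from this[OF G] this[OF H] show "(LINT x|lebesgue_on D. (G x $ i - H x $ i) * \<psi> x) = 0"
      using integrable_locally_integrable_test[OF D li(1) \<psi>] integrable_locally_integrable_test[OF D li(2) \<psi>]
      by (simp add: left_diff_distrib)
  qed
  then have "AE x in lebesgue_on D. \<forall>i\<in>UNIV. G x $ i - H x $ i = 0"
    by (intro AE_finite_allI) auto
  then show ?thesis by (auto simp: vec_eq_iff elim: eventually_mono)
qed

lemma integrable_lborel_test:
  assumes "\<phi> \<in> test_functions D" shows "integrable lborel \<phi>"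
proof -
  obtain K where K: "compact K" "\<And>x. x \<notin> K \<Longrightarrow> \<phi> x = 0" using test_functions_support[OF assms] by metis
  have "integrable lborel (\<lambda>x. indicator K x *\<^sub>R \<phi> x)"
    by (intro borel_integrable_compact K test_functions_continuous[OF assms])
  also have "(\<lambda>x. indicator K x *\<^sub>R \<phi> x) = \<phi>" using K by (auto simp: indicator_def)
  finally show ?thesis .
qed

lemma integral_lborel_translate:
  fixes f :: "'a::euclidean_space \<Rightarrow> 'b::{banach,second_countable_topology}"
  assumes [measurable]: "f \<in> borel_measurable borel"
  shows "(LINT x|lborel. f (x + a)) = (LINT x|lborel. f x)"
    and "integrable lborel (\<lambda>x. f (x + a)) \<longleftrightarrow> integrable lborel f"
proof -
  have "(LINT x|lborel. f x) = (LINT x|distr lborel borel ((+) a). f x)" by (simp add: lborel_distr_plus)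
  also have "\<dots> = (LINT x|lborel. f (x + a))" by (subst integral_distr) (auto simp: add.commute)
  finally show "(LINT x|lborel. f (x + a)) = (LINT x|lborel. f x)" by simp
  have "integrable lborel f \<longleftrightarrow> integrable (distr lborel borel ((+) a)) f" by (simp add: lborel_distr_plus)
  also have "\<dots> \<longleftrightarrow> integrable lborel (\<lambda>x. f (x + a))" by (subst integrable_distr_eq) (auto simp: add.commute)
  finally show "integrable lborel (\<lambda>x. f (x + a)) \<longleftrightarrow> integrable lborel f" by simp
qed

lemma nn_integral_lborel_translate:
  fixes f :: "'a::euclidean_space \<Rightarrow> ennreal"
  assumes [measurable]: "f \<in> borel_measurable borel"
  shows "(\<integral>\<^sup>+ x. f (x + a) \<partial>lborel) = (\<integral>\<^sup>+ x. f x \<partial>lborel)"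
proof -
  have "(\<integral>\<^sup>+ x. f x \<partial>lborel) = (\<integral>\<^sup>+ x. f x \<partial>distr lborel borel ((+) a))" by (simp add: lborel_distr_plus)
  also have "\<dots> = (\<integral>\<^sup>+ x. f (x + a) \<partial>lborel)" by (subst nn_integral_distr) (auto simp: add.commute)
  finally show ?thesis by simp
qed

section \<open>Integration by parts and translations\<close>

lemma test_functions_eq_0:
  assumes "\<phi> \<in> test_functions D" "x \<notin> D"
  shows "\<phi> x = 0"
proof -
  obtain K where "K \<subseteq> D" "\<And>x. x \<notin> K \<Longrightarrow> \<phi> x = 0" using test_functions_support[OF assms(1)] by metis
  then show ?thesis using assms(2) by auto
qed

lemma gradient_eq_0:
  assumes "\<phi> \<in> test_functions D" "x \<notin> D"
  shows "gradient \<phi> x = 0"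
  using test_functions_eq_0[OF test_functions_partial_deriv[OF assms(1)] assms(2)]
  by (simp add: gradient_def vec_eq_iff)

lemma test_functions_mult:
  assumes "\<phi> \<in> test_functions D" "\<psi> \<in> test_functions D"
  shows "(\<lambda>x. \<phi> x * \<psi> x) \<in> test_functions D"
proof -
  have c: "closure {x. \<phi> x * \<psi> x \<noteq> 0} \<subseteq> closure {x. \<phi> x \<noteq> 0}"
    by (intro closure_mono) auto
  have k: "compact (closure {x. \<phi> x \<noteq> 0})" using assms by (auto simp: test_functions_def)
  have "compact (closure {x. \<phi> x * \<psi> x \<noteq> 0})"
    by (rule compact_closed_subset[OF k closed_closure c])
  then show ?thesis using assms c by (auto simp: test_functions_def intro: Ck_function_mult)
qed

section \<open>Derivatives along segments and integration by parts\<close>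

definition directional_deriv :: "real^'n::finite \<Rightarrow> (real^'n \<Rightarrow> complex) \<Rightarrow> real^'n \<Rightarrow> complex" where
  "directional_deriv h \<phi> x = (\<Sum>i\<in>UNIV. (h $ i) *\<^sub>R partial_deriv i \<phi> x)"

lemma norm_directional_deriv_le: "norm (directional_deriv h \<phi> x) \<le> norm h * norm (gradient \<phi> x)"
proof -
  have "norm (directional_deriv h \<phi> x) \<le> (\<Sum>i\<in>UNIV. norm ((h $ i) *\<^sub>R partial_deriv i \<phi> x))"
    unfolding directional_deriv_def by (rule norm_sum)
  also have "\<dots> = (\<Sum>i\<in>UNIV. \<bar>h $ i\<bar> * \<bar>norm (partial_deriv i \<phi> x)\<bar>)" by simp
  also have "\<dots> \<le> L2_set (\<lambda>i. h $ i) UNIV * L2_set (\<lambda>i. norm (partial_deriv i \<phi> x)) UNIV"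
    by (rule L2_set_mult_ineq)
  also have "\<dots> = norm h * norm (gradient \<phi> x)" by (simp add: norm_vec_def gradient_def L2_set_def)
  finally show ?thesis .
qed

lemma has_vector_derivative_line:
  assumes "\<phi> \<in> test_functions D"
  shows "((\<lambda>t. \<phi> (x + t *\<^sub>R h)) has_vector_derivative directional_deriv h \<phi> (x + t *\<^sub>R h)) (at t within S)"
proof -
  have "((\<lambda>t. x + t *\<^sub>R h) has_derivative (\<lambda>s. s *\<^sub>R h)) (at t within S)"
    using has_derivative_add[OF has_derivative_const has_derivative_scaleR_left[OF has_derivative_ident]] by simp
  from has_derivative_compose[OF this has_derivative_partial_deriv[OF test_functions_differentiable[OF assms]]]
  show ?thesis
    by (simp add: has_vector_derivative_def directional_deriv_def scaleR_sum_right)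
qed

lemma continuous_on_directional_deriv_line:
  assumes "\<phi> \<in> test_functions D"
  shows "continuous_on S (\<lambda>t. directional_deriv h \<phi> (x + t *\<^sub>R h))"
  unfolding directional_deriv_def
  by (intro continuous_on_sum continuous_on_scaleR continuous_on_const
      continuous_on_compose2[OF test_functions_continuous_partial_deriv[OF assms, of UNIV]] continuous_intros) auto

text \<open>The mean value inequality on the segment. It dominates the difference quotients
  uniformly when their integrals are taken to the limit.\<close>

lemma norm_diff_line_le:
  assumes "\<phi> \<in> test_functions D" "\<And>y. norm (gradient \<phi> y) \<le> B"
  shows "norm (\<phi> (x + h) - \<phi> x) \<le> B * norm h"
proof -
  have "norm ((\<lambda>t. \<phi> (x + t *\<^sub>R h)) 1 - (\<lambda>t. \<phi> (x + t *\<^sub>R h)) 0) \<le> (norm h * B) * norm (1 - 0 :: real)"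
  proof (rule differentiable_bound[where S = "{0..1}" and f' = "\<lambda>t s. s *\<^sub>R directional_deriv h \<phi> (x + t *\<^sub>R h)"])
    show "((\<lambda>t. \<phi> (x + t *\<^sub>R h)) has_derivative (\<lambda>s. s *\<^sub>R directional_deriv h \<phi> (x + t *\<^sub>R h))) (at t within {0..1})" for t
      using has_vector_derivative_line[OF assms(1)] by (simp add: has_vector_derivative_def)
    show "onorm (\<lambda>s. s *\<^sub>R directional_deriv h \<phi> (x + t *\<^sub>R h)) \<le> norm h * B" for t :: real
    proof (rule onorm_le)
      fix s :: real
      have "norm (directional_deriv h \<phi> (x + t *\<^sub>R h)) \<le> norm h * B"
        by (rule order_trans[OF norm_directional_deriv_le]) (intro mult_left_mono assms, simp)
      then show "norm (s *\<^sub>R directional_deriv h \<phi> (x + t *\<^sub>R h)) \<le> norm h * B * norm s"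
        by (simp add: mult.commute mult_left_mono)
    qed
  qed auto
  then show ?thesis by (simp add: mult.commute)
qed

lemma gradient_bounded:
  assumes "\<phi> \<in> test_functions D" shows "\<exists>B. \<forall>x. norm (gradient \<phi> x) \<le> B"
proof -
  have "\<exists>B. \<forall>x. norm (partial_deriv i \<phi> x) \<le> B" for i
    by (rule test_functions_bounded[OF test_functions_partial_deriv[OF assms]])
  then obtain B where B: "\<And>i x. norm (partial_deriv i \<phi> x) \<le> B i" by metis
  have "norm (gradient \<phi> x) \<le> (\<Sum>i\<in>UNIV. B i)" for x
    unfolding norm_vec_def
    by (rule order_trans[OF L2_set_le_sum]) (auto intro!: sum_mono B simp: gradient_def)
  then show ?thesis by blast
qed

lemma has_vector_derivative_imp_quotient:
  fixes f :: "real \<Rightarrow> 'a::real_normed_vector"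
  assumes "(f has_vector_derivative d) (at 0)"
  shows "((\<lambda>t. (1 / t) *\<^sub>R (f t - f 0)) \<longlongrightarrow> d) (at 0)"
proof (rule LIM_zero_cancel, rule tendsto_norm_zero_cancel)
  have "((\<lambda>t. norm (f t - f 0 - t *\<^sub>R d) / norm t) \<longlongrightarrow> 0) (at 0)"
    using assms by (simp add: has_vector_derivative_def has_derivative_at)
  then show "((\<lambda>t. norm ((1 / t) *\<^sub>R (f t - f 0) - d)) \<longlongrightarrow> 0) (at 0)"
  proof (rule tendsto_cong[THEN iffD1, rotated])
    have "norm (f t - f 0 - t *\<^sub>R d) / norm t = norm ((1 / t) *\<^sub>R (f t - f 0) - d)" if "t \<noteq> 0" for t :: real
    proof -
      have "(1 / t) *\<^sub>R (f t - f 0) - d = (1 / t) *\<^sub>R (f t - f 0 - t *\<^sub>R d)"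
        using that by (simp add: scaleR_diff_right)
      then have "norm ((1 / t) *\<^sub>R (f t - f 0) - d) = norm ((1 / t) *\<^sub>R (f t - f 0 - t *\<^sub>R d))" by simp
      then show ?thesis by (simp only: norm_scaleR) simp
    qed
    then show "\<forall>\<^sub>F t in at 0. norm (f t - f 0 - t *\<^sub>R d) / norm t = norm ((1 / t) *\<^sub>R (f t - f 0) - d)"
      by (simp add: eventually_at_filter)
  qed
qed

text \<open>Every difference quotient has integral zero by translation invariance, and the quotients
  converge boundedly to the partial derivative on a fixed ball, so no iterated integration over
  coordinates occurs.\<close>

lemma integral_partial_deriv_0:
  assumes \<phi>: "\<phi> \<in> test_functions D"
  shows "(LINT x|lborel. partial_deriv i \<phi> x) = 0"
proof -
  obtain K where K: "compact K" "\<And>x. x \<notin> K \<Longrightarrow> \<phi> x = 0" using test_functions_support[OF \<phi>] by metis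
  obtain R where R: "\<And>x. x \<in> K \<Longrightarrow> norm x \<le> R" using K compact_imp_bounded bounded_iff by metis
  obtain B where B: "\<And>x. norm (gradient \<phi> x) \<le> B" using gradient_bounded[OF \<phi>] by blast
  have [measurable]: "\<phi> \<in> borel_measurable borel" "partial_deriv i \<phi> \<in> borel_measurable borel"
    using test_functions_borel_measurable test_functions_partial_deriv \<phi> by blast+
  have B0: "B \<ge> 0" using B[of 0] norm_ge_zero order_trans by blast
  \<comment> \<open>Steps of length at most 1 keep all difference quotients supported in the ball of
    radius \<open>R + 1\<close>.\<close>
  define e where "e m = inverse (real (Suc m))" for m
  have e: "0 < e m" "e m \<le> 1" for m by (auto simp: e_def field_simps)
  let ?g = "\<lambda>m x. (1 / e m) *\<^sub>R (\<phi> (x + e m *\<^sub>R axis i 1) - \<phi> x)"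
  have "(\<lambda>m. LINT x|lborel. ?g m x) \<longlonglongrightarrow> (LINT x|lborel. partial_deriv i \<phi> x)"
  proof (rule integral_dominated_convergence)
    have "emeasure lborel (cball (0::real^'a) (R + 1)) < \<infinity>" by (rule emeasure_lborel_cball_finite)
    then show "integrable lborel (\<lambda>x::real^'a. B * indicator (cball 0 (R + 1)) x)"
      by (intro integrable_mult_right integrable_real_indicator) auto
    show "AE x in lborel. (\<lambda>m. ?g m x) \<longlonglongrightarrow> partial_deriv i \<phi> x"
    proof (rule AE_I2)
      fix x
      have "((\<lambda>t. \<phi> (x + t *\<^sub>R axis i 1)) has_vector_derivative directional_deriv (axis i 1) \<phi> (x + 0 *\<^sub>R axis i 1)) (at 0)"
        by (rule has_vector_derivative_line[OF \<phi>])
      moreover have "directional_deriv (axis i 1) \<phi> x = partial_deriv i \<phi> x"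
        by (simp add: directional_deriv_def axis_def if_distrib[of "\<lambda>c. c *\<^sub>R _"] cong: if_cong)
      ultimately have "((\<lambda>t. \<phi> (x + t *\<^sub>R axis i 1)) has_vector_derivative partial_deriv i \<phi> x) (at 0)" by simp
      then have "((\<lambda>t. (1 / t) *\<^sub>R (\<phi> (x + t *\<^sub>R axis i 1) - \<phi> x)) \<longlongrightarrow> partial_deriv i \<phi> x) (at 0)"
        using has_vector_derivative_imp_quotient[of "\<lambda>t. \<phi> (x + t *\<^sub>R axis i 1)"] by simp
      then show "(\<lambda>m. ?g m x) \<longlonglongrightarrow> partial_deriv i \<phi> x"
      proof (rule filterlim_compose)
        have "e \<longlonglongrightarrow> 0" unfolding e_def by (rule LIMSEQ_inverse_real_of_nat)
        then show "filterlim e (at 0) sequentially"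
          using e(1) by (auto simp: filterlim_at intro!: always_eventually less_imp_neq[symmetric])
      qed
    qed
    have "norm (?g m x) \<le> B * indicator (cball 0 (R + 1)) x" for m x
    proof (cases "x \<in> cball 0 (R + 1)")
      case True
      have "norm (\<phi> (x + e m *\<^sub>R axis i 1) - \<phi> x) \<le> B * norm (e m *\<^sub>R (axis i 1 :: real^'a))"
        by (rule norm_diff_line_le[OF \<phi> B])
      then have "norm (\<phi> (x + e m *\<^sub>R axis i 1) - \<phi> x) / e m \<le> B" using e(1)[of m] by (simp add: pos_divide_le_eq)
      moreover have "norm (?g m x) = norm (\<phi> (x + e m *\<^sub>R axis i 1) - \<phi> x) / e m"
        unfolding norm_scaleR using e(1)[of m] by simp
      ultimately have "norm (?g m x) \<le> B" by (simp only:)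
      then show ?thesis using True by (simp only: indicator_simps mult_1_right)
    next
      case False
      then have "x \<notin> K" using R by fastforce
      moreover have "x + e m *\<^sub>R axis i 1 \<notin> K"
      proof
        assume "x + e m *\<^sub>R axis i 1 \<in> K"
        then have "norm (x + e m *\<^sub>R axis i 1) \<le> R" by (rule R)
        moreover have "norm x \<le> norm (x + e m *\<^sub>R axis i 1) + norm (e m *\<^sub>R (axis i 1 :: real^'a))"
          by (metis add_diff_cancel_right' norm_triangle_ineq4)
        ultimately show False using False e[of m] by simp
      qed
      ultimately show ?thesis using K B0 by simp
    qed
    then show "AE x in lborel. norm (?g m x) \<le> B * indicator (cball 0 (R + 1)) x" for m by simp
  qed measurable
  moreover have "(LINT x|lborel. ?g m x) = 0" for m
  proof -
    have "integrable lborel \<phi>" by (rule integrable_lborel_test[OF \<phi>])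
    then show ?thesis using integral_lborel_translate[of \<phi> "e m *\<^sub>R axis i 1"] by simp
  qed
  ultimately have "(\<lambda>m::nat. 0) \<longlonglongrightarrow> (LINT x|lborel. partial_deriv i \<phi> x)" by (simp only:)
  then show ?thesis by (simp add: LIMSEQ_const_iff)
qed

lemma continuous_absolutely_integrable_on_compact:
  fixes f :: "'a::euclidean_space \<Rightarrow> 'b::euclidean_space"
  assumes "continuous_on UNIV f" "compact K"
  shows "f absolutely_integrable_on K"
proof -
  have [measurable]: "f \<in> borel_measurable borel" by (intro borel_measurable_continuous_onI assms)
  have [measurable]: "K \<in> sets borel" using assms by (simp add: compact_imp_closed)
  have "integrable lborel (\<lambda>x. indicator K x *\<^sub>R f x)"
    using assms continuous_on_subset by (intro borel_integrable_compact) blast+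
  then have "integrable lebesgue (\<lambda>x. indicator K x *\<^sub>R f x)"
    by (subst integrable_completion) auto
  then show ?thesis by (simp add: set_integrable_def)
qed

text \<open>The partial derivative of \<open>\<phi> * \<psi>\<close>, again a test function, has
  integral zero; the product rule splits it into the two sides.\<close>

lemma is_weak_gradient_test:
  assumes D: "open D" and \<phi>: "\<phi> \<in> test_functions D"
  shows "is_weak_gradient D \<phi> (gradient \<phi>)"
  unfolding is_weak_gradient_def
proof (intro conjI ballI allI)
  show "locally_integrable D \<phi>" "locally_integrable D (gradient \<phi>)"
    unfolding locally_integrable_def
    using continuous_absolutely_integrable_on_compact test_functions_continuous[OF \<phi>] continuous_gradient[OF \<phi>] by blast+
  fix \<psi> i assume \<psi>: "\<psi> \<in> test_functions D"
  have Dl: "D \<in> sets lebesgue" using D by auto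
  note z = test_functions_eq_0[OF \<phi>] and z' = test_functions_eq_0[OF test_functions_partial_deriv[OF \<phi>]]
  have m: "\<phi> \<in> borel_measurable borel" "partial_deriv i \<phi> \<in> borel_measurable borel"
     "\<psi> \<in> borel_measurable borel" "partial_deriv i \<psi> \<in> borel_measurable borel"
    using test_functions_borel_measurable test_functions_partial_deriv \<phi> \<psi> by blast+
  note [measurable] = m
  have "(LINT x|lebesgue_on D. \<phi> x * partial_deriv i \<psi> x) = (LINT x|lborel. \<phi> x * partial_deriv i \<psi> x)"
    by (rule integral_lebesgue_on_eq_lborel[OF _ Dl]) (use z in auto)
  moreover have "(LINT x|lebesgue_on D. gradient \<phi> x $ i * \<psi> x) = (LINT x|lborel. partial_deriv i \<phi> x * \<psi> x)"
    unfolding gradient_def vec_lambda_beta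
    by (rule integral_lebesgue_on_eq_lborel[OF _ Dl]) (use z' in auto)
  moreover have "0 = (LINT x|lborel. partial_deriv i (\<lambda>x. \<phi> x * \<psi> x) x)"
    by (rule integral_partial_deriv_0[symmetric, OF test_functions_mult[OF \<phi> \<psi>]])
  moreover have "partial_deriv i (\<lambda>x. \<phi> x * \<psi> x) x = \<phi> x * partial_deriv i \<psi> x + partial_deriv i \<phi> x * \<psi> x" for x
    by (intro partial_deriv_mult test_functions_differentiable[OF \<phi>] test_functions_differentiable[OF \<psi>])
  moreover have "integrable lborel (\<lambda>x. \<phi> x * partial_deriv i \<psi> x)" "integrable lborel (\<lambda>x. partial_deriv i \<phi> x * \<psi> x)"
    by (intro integrable_lborel_test[where D = D] test_functions_mult \<phi> \<psi> test_functions_partial_deriv)+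
  ultimately show "(LINT x|lebesgue_on D. \<phi> x * partial_deriv i \<psi> x) = - (LINT x|lebesgue_on D. gradient \<phi> x $ i * \<psi> x)"
    by (simp add: eq_neg_iff_add_eq_0)
qed

section \<open>Translations controlled by the energy\<close>

abbreviation dirichlet_energy :: "(real^'n::finite \<Rightarrow> complex) \<Rightarrow> ennreal" where
  "dirichlet_energy \<phi> \<equiv> \<integral>\<^sup>+ x. ennreal ((norm (gradient \<phi> x))\<^sup>2) \<partial>lborel"

text \<open>The increment is the integral of the directional derivative over the segment from
  \<open>x\<close> to \<open>x + h\<close>. Cauchy-Schwarz over the unit interval brings the square
  inside; integrating in \<open>x\<close> first, by Fubini, makes each point of the segment
  contribute the same energy.\<close>

lemma translation_estimate:
  fixes \<phi> :: "real^'n::finite \<Rightarrow> complex"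
  assumes \<phi>: "\<phi> \<in> test_functions D"
  shows "(\<integral>\<^sup>+ x. ennreal ((norm (\<phi> (x + h) - \<phi> x))\<^sup>2) \<partial>lborel)
     \<le> ennreal ((norm h)\<^sup>2) * dirichlet_energy \<phi>"
proof -
  have [measurable]: "\<phi> \<in> borel_measurable borel" "gradient \<phi> \<in> borel_measurable borel"
    using test_functions_borel_measurable gradient_borel_measurable \<phi> by blast+
  let ?E = "dirichlet_energy \<phi>"
  have pt: "ennreal ((norm (\<phi> (x + h) - \<phi> x))\<^sup>2)
     \<le> (\<integral>\<^sup>+ t. indicator {0..1::real} t * ennreal ((norm h)\<^sup>2 * (norm (gradient \<phi> (x + t *\<^sub>R h)))\<^sup>2) \<partial>lborel)" for x
  proof -
    let ?d = "\<lambda>t. directional_deriv h \<phi> (x + t *\<^sub>R h)"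
    have "has_bochner_integral lborel (\<lambda>t. indicator {0..1} t *\<^sub>R ?d t) (\<phi> (x + 1 *\<^sub>R h) - \<phi> (x + 0 *\<^sub>R h))"
      by (rule has_bochner_integral_FTC_Icc) (auto intro: has_vector_derivative_line[OF \<phi>] continuous_on_directional_deriv_line[OF \<phi>])
    then have i: "integrable lborel (\<lambda>t. indicator {0..1} t *\<^sub>R ?d t)"
      "\<phi> (x + h) - \<phi> x = (LINT t|lborel. indicator {0..1} t *\<^sub>R ?d t)"
      by (auto simp: has_bochner_integral_iff)
    have "ennreal (norm (\<phi> (x + h) - \<phi> x)) \<le> (\<integral>\<^sup>+ t. norm (indicator {0..1} t *\<^sub>R ?d t) \<partial>lborel)"
      unfolding i(2) by (rule integral_norm_bound_ennreal[OF i(1)])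
    \<comment> \<open>The indicator is written twice so that it can serve as one factor of
      Cauchy-Schwarz, where its own integral is 1, and still localise the other.\<close>
    also have "\<dots> \<le> (\<integral>\<^sup>+ t. indicator {0..1} t * (indicator {0..1::real} t * ennreal (norm h * norm (gradient \<phi> (x + t *\<^sub>R h)))) \<partial>lborel)"
      by (intro nn_integral_mono) (auto simp: indicator_def intro!: ennreal_leI norm_directional_deriv_le)
    finally have "(ennreal (norm (\<phi> (x + h) - \<phi> x)))\<^sup>2 \<le> \<dots>\<^sup>2" by (intro power_mono) auto
    also have "\<dots> \<le> (\<integral>\<^sup>+ t. (indicator {0..1::real} t)\<^sup>2 \<partial>lborel) * (\<integral>\<^sup>+ t. (indicator {0..1::real} t * ennreal (norm h * norm (gradient \<phi> (x + t *\<^sub>R h))))\<^sup>2 \<partial>lborel)"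
      by (rule Cauchy_Schwarz_nn_integral[where f = "indicator {0..1}"
            and g = "\<lambda>t. indicator {0..1} t * ennreal (norm h * norm (gradient \<phi> (x + t *\<^sub>R h)))"]) auto
    also have "(\<integral>\<^sup>+ t. (indicator {0..1::real} t)\<^sup>2 \<partial>lborel) = (\<integral>\<^sup>+ t. indicator {0..1::real} t \<partial>lborel)"
      by (intro nn_integral_cong) (auto simp: indicator_def)
    also have "\<dots> = 1" by simp
    also have "(\<integral>\<^sup>+ t. (indicator {0..1::real} t * ennreal (norm h * norm (gradient \<phi> (x + t *\<^sub>R h))))\<^sup>2 \<partial>lborel)
      = (\<integral>\<^sup>+ t. indicator {0..1::real} t * ennreal ((norm h)\<^sup>2 * (norm (gradient \<phi> (x + t *\<^sub>R h)))\<^sup>2) \<partial>lborel)"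
      by (intro nn_integral_cong) (auto simp: indicator_def ennreal_power power_mult_distrib)
    finally show ?thesis by (simp add: ennreal_power)
  qed
  have "(\<integral>\<^sup>+ x. ennreal ((norm (\<phi> (x + h) - \<phi> x))\<^sup>2) \<partial>lborel)
    \<le> (\<integral>\<^sup>+ x. \<integral>\<^sup>+ t. indicator {0..1::real} t * ennreal ((norm h)\<^sup>2 * (norm (gradient \<phi> (x + t *\<^sub>R h)))\<^sup>2) \<partial>lborel \<partial>lborel)"
    by (intro nn_integral_mono pt)
  also have "\<dots> = (\<integral>\<^sup>+ t. \<integral>\<^sup>+ x. indicator {0..1::real} t * ennreal ((norm h)\<^sup>2 * (norm (gradient \<phi> (x + t *\<^sub>R h)))\<^sup>2) \<partial>lborel \<partial>lborel)"
    by (rule lborel_pair.Fubini') measurable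
  also have "\<dots> = (\<integral>\<^sup>+ t. indicator {0..1::real} t * (ennreal ((norm h)\<^sup>2) * ?E) \<partial>lborel)"
  proof (intro nn_integral_cong)
    fix t :: real
    have "(\<integral>\<^sup>+ x. indicator {0..1::real} t * ennreal ((norm h)\<^sup>2 * (norm (gradient \<phi> (x + t *\<^sub>R h)))\<^sup>2) \<partial>lborel)
      = indicator {0..1::real} t * (ennreal ((norm h)\<^sup>2) * (\<integral>\<^sup>+ x. ennreal ((norm (gradient \<phi> (x + t *\<^sub>R h)))\<^sup>2) \<partial>lborel))"
      by (simp add: nn_integral_cmult ennreal_mult)
    also have "(\<integral>\<^sup>+ x. ennreal ((norm (gradient \<phi> (x + t *\<^sub>R h)))\<^sup>2) \<partial>lborel) = ?E"
      by (rule nn_integral_lborel_translate) measurable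
    finally show "(\<integral>\<^sup>+ x. indicator {0..1::real} t * ennreal ((norm h)\<^sup>2 * (norm (gradient \<phi> (x + t *\<^sub>R h)))\<^sup>2) \<partial>lborel)
      = indicator {0..1::real} t * (ennreal ((norm h)\<^sup>2) * ?E)" .
  qed
  also have "\<dots> = (\<integral>\<^sup>+ t. indicator {0..1::real} t \<partial>lborel) * (ennreal ((norm h)\<^sup>2) * ?E)"
    by (intro nn_integral_multc) auto
  finally show ?thesis by simp
qed

text \<open>A translation by the diameter moves \<open>D\<close> off itself, so that \<open>\<phi>\<close> and its translate have disjoint supports.\<close>

lemma Poincare_inequality:
  fixes \<phi> :: "real^'n::finite \<Rightarrow> complex"
  assumes \<phi>: "\<phi> \<in> test_functions D" and D: "D \<subseteq> ball 0 R" "R > 0"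
  shows "(\<integral>\<^sup>+ x. ennreal ((norm (\<phi> x))\<^sup>2) \<partial>lborel)
     \<le> ennreal ((2 * R)\<^sup>2) * dirichlet_energy \<phi>"
proof -
  \<comment> \<open>\<open>undefined\<close> stands for an arbitrary coordinate direction; what
    matters is the length \<open>2 * R\<close>.\<close>
  define h :: "real^'n" where "h = (2 * R) *\<^sub>R axis undefined 1"
  have h: "norm h = 2 * R" using D by (simp add: h_def)
  have "(\<integral>\<^sup>+ x. ennreal ((norm (\<phi> x))\<^sup>2) \<partial>lborel) \<le> (\<integral>\<^sup>+ x. ennreal ((norm (\<phi> (x + h) - \<phi> x))\<^sup>2) \<partial>lborel)"
  proof (intro nn_integral_mono)
    fix x
    show "ennreal ((norm (\<phi> x))\<^sup>2) \<le> ennreal ((norm (\<phi> (x + h) - \<phi> x))\<^sup>2)"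
    proof (cases "\<phi> x = 0")
      case False
      have z: "\<phi> y = 0" if "y \<notin> ball 0 R" for y using test_functions_eq_0[OF \<phi>] that D by blast
      have "x \<in> ball 0 R" using False z by blast
      moreover have "norm h \<le> norm (x + h) + norm x" by (metis add_diff_cancel_left' norm_triangle_ineq4)
      ultimately have "x + h \<notin> ball 0 R" using h by simp
      then show ?thesis using z by simp
    qed simp
  qed
  also have "\<dots> \<le> ennreal ((norm h)\<^sup>2) * dirichlet_energy \<phi>"
    by (rule translation_estimate[OF \<phi>])
  finally show ?thesis using h by simp
qed

section \<open>Averages over balls\<close>

abbreviation ball_vol :: "'n::finite itself \<Rightarrow> real \<Rightarrow> real" where
  "ball_vol _ t \<equiv> measure lborel (ball (0::real^'n) t)"

text \<open>The uniform probability density on the ball. Its values are extended reals so that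
  Jensen's inequality and Fubini can be stated with nonnegative integrals, free of integrability
  conditions.\<close>

definition ball_weight :: "real \<Rightarrow> real^'n::finite \<Rightarrow> ennreal" where
  "ball_weight t h = ennreal (1 / ball_vol TYPE('n) t) * indicator (ball 0 t) h"

definition ball_avg :: "real \<Rightarrow> (real^'n::finite \<Rightarrow> complex) \<Rightarrow> real^'n \<Rightarrow> complex" where
  "ball_avg t \<phi> x = (LINT h|lborel. indicator (ball 0 t) h *\<^sub>R \<phi> (x + h)) /\<^sub>R ball_vol TYPE('n) t"

lemma ball_vol_eq: "t \<ge> 0 \<Longrightarrow> ball_vol TYPE('n::finite) t = t ^ CARD('n) * ball_vol TYPE('n) 1"
  using content_ball_conv_unit_ball[of t "0 :: real^'n"] by simp

lemma ball_vol_pos: "t > 0 \<Longrightarrow> ball_vol TYPE('n::finite) t > 0"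
  using content_ball_pos[of t "0 :: real^'n"] by simp

lemma emeasure_ball_vol: "emeasure lborel (ball (0::real^'n::finite) t) = ennreal (ball_vol TYPE('n) t)"
  using emeasure_lborel_ball_finite[of "0::real^'n" t] by (intro emeasure_eq_ennreal_measure) auto

lemma ball_borel [measurable]: "ball (c :: 'a::metric_space) r \<in> sets borel"
  by simp

lemma ball_weight_measurable [measurable]: "ball_weight t \<in> borel_measurable borel"
  unfolding ball_weight_def by measurable

lemma nn_integral_ball_weight:
  "t > 0 \<Longrightarrow> (\<integral>\<^sup>+ h. ball_weight t h \<partial>(lborel :: (real^'n::finite) measure)) = 1"
  using ball_vol_pos[of t, where 'n='n] unfolding ball_weight_def
  by (subst nn_integral_cmult) (auto simp: emeasure_ball_vol ennreal_mult[symmetric])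

lemma integrable_ball_continuous:
  fixes g :: "real^'n::finite \<Rightarrow> complex"
  assumes "continuous_on UNIV g"
  shows "integrable lborel (\<lambda>h. indicator (ball 0 t) h *\<^sub>R g h)"
proof -
  have "set_integrable lborel (cball 0 t) g"
    unfolding set_integrable_def
    by (rule borel_integrable_compact[OF compact_cball continuous_on_subset[OF assms subset_UNIV]])
  then have "set_integrable lborel (ball 0 t) g"
    by (rule set_integrable_subset) auto
  then show ?thesis by (simp add: set_integrable_def)
qed

text \<open>The weight has mass one, so \<open>c\<close> can be moved into the average;
  Cauchy-Schwarz against the indicator of the ball then costs one factor of the volume, which
  cancels one of the two inverse volumes.\<close>

lemma ball_Jensen:
  fixes g :: "real^'n::finite \<Rightarrow> complex"
  assumes t: "t > 0" and g: "continuous_on UNIV g"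
  shows "ennreal ((norm ((LINT h|lborel. indicator (ball 0 t) h *\<^sub>R g h) /\<^sub>R ball_vol TYPE('n) t - c))\<^sup>2)
    \<le> (\<integral>\<^sup>+ h. ball_weight t h * ennreal ((norm (g h - c))\<^sup>2) \<partial>lborel)"
proof -
  let ?v = "ball_vol TYPE('n) t" and ?B = "ball (0::real^'n) t"
  have v: "?v > 0" by (rule ball_vol_pos[OF t])
  have gm[measurable]: "g \<in> borel_measurable borel" by (intro borel_measurable_continuous_onI g)
  have i1: "integrable lborel (\<lambda>h. indicator ?B h *\<^sub>R g h)" by (rule integrable_ball_continuous[OF g])
  have i2: "integrable lborel (\<lambda>h. indicator ?B h *\<^sub>R c)" by (rule integrable_ball_continuous[OF continuous_on_const])
  have "integrable lborel (indicator ?B :: real^'n \<Rightarrow> real)"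
    using emeasure_lborel_ball_finite[of 0 t] by (intro integrable_real_indicator) auto
  then have "(LINT h|lborel. indicator ?B h *\<^sub>R c) = (LINT h|lborel. indicator ?B h) *\<^sub>R c"
    by (rule integral_scaleR_left)
  also have "(LINT h|lborel. indicator ?B h :: real) = ?v" by simp
  finally have "(LINT h|lborel. indicator ?B h *\<^sub>R c) = ?v *\<^sub>R c" .
  then have "(LINT h|lborel. indicator ?B h *\<^sub>R (g h - c)) = (LINT h|lborel. indicator ?B h *\<^sub>R g h) - ?v *\<^sub>R c"
    using i1 i2 by (simp add: scaleR_diff_right)
  then have eq: "(LINT h|lborel. indicator ?B h *\<^sub>R g h) /\<^sub>R ?v - c = (LINT h|lborel. indicator ?B h *\<^sub>R (g h - c)) /\<^sub>R ?v"
    using v by (simp add: scaleR_diff_right)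
  have i3: "integrable lborel (\<lambda>h. indicator ?B h *\<^sub>R (g h - c))"
    using i1 i2 by (simp add: scaleR_diff_right)
  let ?f = "\<lambda>h. indicator ?B h * ennreal (norm (g h - c))"
  have "ennreal (norm ((LINT h|lborel. indicator ?B h *\<^sub>R g h) /\<^sub>R ?v - c))
     = ennreal (1 / ?v) * ennreal (norm (LINT h|lborel. indicator ?B h *\<^sub>R (g h - c)))"
    unfolding eq using v by (simp add: ennreal_mult[symmetric] divide_inverse)
  also have "\<dots> \<le> ennreal (1 / ?v) * (\<integral>\<^sup>+ h. indicator ?B h * ?f h \<partial>lborel)"
  proof (intro mult_left_mono)
    have "ennreal (norm (LINT h|lborel. indicator ?B h *\<^sub>R (g h - c))) \<le> (\<integral>\<^sup>+ h. norm (indicator ?B h *\<^sub>R (g h - c)) \<partial>lborel)"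
      by (rule integral_norm_bound_ennreal[OF i3])
    also have "\<dots> = (\<integral>\<^sup>+ h. indicator ?B h * ?f h \<partial>lborel)"
      by (intro nn_integral_cong) (auto simp: indicator_def)
    finally show "ennreal (norm (LINT h|lborel. indicator ?B h *\<^sub>R (g h - c))) \<le> (\<integral>\<^sup>+ h. indicator ?B h * ?f h \<partial>lborel)" .
  qed simp
  finally have "(ennreal (norm ((LINT h|lborel. indicator ?B h *\<^sub>R g h) /\<^sub>R ?v - c)))\<^sup>2
    \<le> (ennreal (1 / ?v) * (\<integral>\<^sup>+ h. indicator ?B h * ?f h \<partial>lborel))\<^sup>2" by (intro power_mono) auto
  also have "\<dots> = (ennreal (1 / ?v))\<^sup>2 * (\<integral>\<^sup>+ h. indicator ?B h * ?f h \<partial>lborel)\<^sup>2" by (rule power_mult_distrib)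
  also have "\<dots> \<le> (ennreal (1 / ?v))\<^sup>2 * ((\<integral>\<^sup>+ h. (indicator ?B h)\<^sup>2 \<partial>lborel) * (\<integral>\<^sup>+ h. (?f h)\<^sup>2 \<partial>lborel))"
    by (intro mult_left_mono Cauchy_Schwarz_nn_integral[where f = "indicator ?B" and g = ?f]) auto
  also have "(\<integral>\<^sup>+ h. (indicator ?B h)\<^sup>2 \<partial>lborel) = (\<integral>\<^sup>+ h. indicator ?B h \<partial>lborel)"
    by (intro nn_integral_cong) (auto simp: indicator_def)
  also have "\<dots> = ennreal ?v" by (simp add: emeasure_ball_vol)
  also have "(\<integral>\<^sup>+ h. (?f h)\<^sup>2 \<partial>lborel) = (\<integral>\<^sup>+ h. indicator ?B h * ennreal ((norm (g h - c))\<^sup>2) \<partial>lborel)"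
    by (intro nn_integral_cong) (auto simp: indicator_def ennreal_power)
  also have "(ennreal (1 / ?v))\<^sup>2 * (ennreal ?v * (\<integral>\<^sup>+ h. indicator ?B h * ennreal ((norm (g h - c))\<^sup>2) \<partial>lborel))
    = ennreal (1 / ?v) * (\<integral>\<^sup>+ h. indicator ?B h * ennreal ((norm (g h - c))\<^sup>2) \<partial>lborel)"
  proof -
    have "(ennreal (1 / ?v))\<^sup>2 * ennreal ?v = ennreal (1 / ?v)"
      using v by (simp add: ennreal_power ennreal_mult[symmetric] power2_eq_square)
    then show ?thesis by (simp add: mult.assoc[symmetric])
  qed
  also have "\<dots> = (\<integral>\<^sup>+ h. ball_weight t h * ennreal ((norm (g h - c))\<^sup>2) \<partial>lborel)"
    unfolding ball_weight_def mult.assoc by (intro nn_integral_cmult[symmetric]) measurable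
  finally show ?thesis by (simp add: ennreal_power)
qed

lemma test_translate_continuous:
  assumes "\<phi> \<in> test_functions D"
  shows "continuous_on S (\<lambda>h. \<phi> (x + h))"
  by (intro continuous_on_compose2[OF test_functions_continuous[OF assms, of UNIV]] continuous_intros) auto

lemma ball_avg_Jensen:
  fixes \<phi> :: "real^'n::finite \<Rightarrow> complex"
  assumes "\<phi> \<in> test_functions D" "t > 0"
  shows "ennreal ((norm (ball_avg t \<phi> x - c))\<^sup>2) \<le> (\<integral>\<^sup>+ h. ball_weight t h * ennreal ((norm (\<phi> (x + h) - c))\<^sup>2) \<partial>lborel)"
  unfolding ball_avg_def by (rule ball_Jensen[OF assms(2) test_translate_continuous[OF assms(1)]])

text \<open>Jensen's inequality twice: for the average of radius \<open>s\<close> with the other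
  average as constant, then for the average of radius \<open>t\<close> with the constant
  \<open>\<phi> (x + h)\<close>.\<close>

lemma ball_avg_diff_le:
  fixes \<phi> :: "real^'n::finite \<Rightarrow> complex"
  assumes "\<phi> \<in> test_functions D" "s > 0" "t > 0"
  shows "ennreal ((norm (ball_avg s \<phi> x - ball_avg t \<phi> x))\<^sup>2) \<le>
    (\<integral>\<^sup>+ h. ball_weight s h * (\<integral>\<^sup>+ k. ball_weight t k * ennreal ((norm (\<phi> (x + k) - \<phi> (x + h)))\<^sup>2) \<partial>lborel) \<partial>lborel)"
proof -
  have "ennreal ((norm (ball_avg s \<phi> x - ball_avg t \<phi> x))\<^sup>2) \<le>
     (\<integral>\<^sup>+ h. ball_weight s h * ennreal ((norm (\<phi> (x + h) - ball_avg t \<phi> x))\<^sup>2) \<partial>lborel)"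
    by (rule ball_avg_Jensen[OF assms(1,2)])
  also have "\<dots> \<le> (\<integral>\<^sup>+ h. ball_weight s h * (\<integral>\<^sup>+ k. ball_weight t k * ennreal ((norm (\<phi> (x + k) - \<phi> (x + h)))\<^sup>2) \<partial>lborel) \<partial>lborel)"
  proof (intro nn_integral_mono mult_left_mono)
    show "ennreal ((norm (\<phi> (x + h) - ball_avg t \<phi> x))\<^sup>2) \<le>
       (\<integral>\<^sup>+ k. ball_weight t k * ennreal ((norm (\<phi> (x + k) - \<phi> (x + h)))\<^sup>2) \<partial>lborel)" for h
      using ball_avg_Jensen[OF assms(1,3), of x "\<phi> (x + h)"] by (simp only: norm_minus_commute)
  qed simp
  finally show ?thesis .
qed

text \<open>With \<open>h\<close> and \<open>k\<close> in the two balls, the two points compared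
  differ by a translation of length at most \<open>s + t\<close>. Integrating over \<open>x\<close>
  first allows the translation estimate for each such pair, and both weights have mass one.\<close>

lemma ball_avg_diff_L2:
  fixes \<phi> :: "real^'n::finite \<Rightarrow> complex"
  assumes \<phi>: "\<phi> \<in> test_functions D" and st: "s > 0" "t > 0"
  shows "(\<integral>\<^sup>+ x. ennreal ((norm (ball_avg s \<phi> x - ball_avg t \<phi> x))\<^sup>2) \<partial>lborel)
    \<le> ennreal ((s + t)\<^sup>2) * dirichlet_energy \<phi>"
proof -
  let ?E = "dirichlet_energy \<phi>"
  let ?F = "\<lambda>x h k. ennreal ((norm (\<phi> (x + k) - \<phi> (x + h)))\<^sup>2)"
  have [measurable]: "\<phi> \<in> borel_measurable borel" by (rule test_functions_borel_measurable[OF \<phi>])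
  have F: "(\<integral>\<^sup>+ x. ?F x h k \<partial>lborel) \<le> ennreal ((norm (k - h))\<^sup>2) * ?E" for h k
  proof -
    have "(\<integral>\<^sup>+ x. ?F x h k \<partial>lborel) = (\<integral>\<^sup>+ x. ennreal ((norm (\<phi> ((x + h) + (k - h)) - \<phi> (x + h)))\<^sup>2) \<partial>lborel)"
      by (simp add: algebra_simps)
    also have "\<dots> = (\<integral>\<^sup>+ x. ennreal ((norm (\<phi> (x + (k - h)) - \<phi> x))\<^sup>2) \<partial>lborel)"
      by (rule nn_integral_lborel_translate[where f = "\<lambda>x. ennreal ((norm (\<phi> (x + (k - h)) - \<phi> x))\<^sup>2)"]) measurable
    also have "\<dots> \<le> ennreal ((norm (k - h))\<^sup>2) * ?E" by (rule translation_estimate[OF \<phi>])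
    finally show ?thesis .
  qed
  have "(\<integral>\<^sup>+ x. ennreal ((norm (ball_avg s \<phi> x - ball_avg t \<phi> x))\<^sup>2) \<partial>lborel)
     \<le> (\<integral>\<^sup>+ x. \<integral>\<^sup>+ h. ball_weight s h * (\<integral>\<^sup>+ k. ball_weight t k * ?F x h k \<partial>lborel) \<partial>lborel \<partial>lborel)"
    by (intro nn_integral_mono ball_avg_diff_le[OF \<phi> st])
  also have "\<dots> = (\<integral>\<^sup>+ h. \<integral>\<^sup>+ x. ball_weight s h * (\<integral>\<^sup>+ k. ball_weight t k * ?F x h k \<partial>lborel) \<partial>lborel \<partial>lborel)"
    by (rule lborel_pair.Fubini') measurable
  also have "\<dots> = (\<integral>\<^sup>+ h. ball_weight s h * (\<integral>\<^sup>+ x. \<integral>\<^sup>+ k. ball_weight t k * ?F x h k \<partial>lborel \<partial>lborel) \<partial>lborel)"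
    by (intro nn_integral_cong nn_integral_cmult) measurable
  also have "\<dots> = (\<integral>\<^sup>+ h. ball_weight s h * (\<integral>\<^sup>+ k. \<integral>\<^sup>+ x. ball_weight t k * ?F x h k \<partial>lborel \<partial>lborel) \<partial>lborel)"
  proof -
    have "(\<integral>\<^sup>+ x. \<integral>\<^sup>+ k. ball_weight t k * ?F x h k \<partial>lborel \<partial>lborel) = (\<integral>\<^sup>+ k. \<integral>\<^sup>+ x. ball_weight t k * ?F x h k \<partial>lborel \<partial>lborel)" for h
      by (rule lborel_pair.Fubini') measurable
    then show ?thesis by (simp only:)
  qed
  also have "\<dots> = (\<integral>\<^sup>+ h. ball_weight s h * (\<integral>\<^sup>+ k. ball_weight t k * (\<integral>\<^sup>+ x. ?F x h k \<partial>lborel) \<partial>lborel) \<partial>lborel)"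
  proof -
    have "(\<integral>\<^sup>+ x. ball_weight t k * ?F x h k \<partial>lborel) = ball_weight t k * (\<integral>\<^sup>+ x. ?F x h k \<partial>lborel)" for h k
      by (intro nn_integral_cmult) measurable
    then show ?thesis by (simp only:)
  qed
  also have "\<dots> \<le> (\<integral>\<^sup>+ h. ball_weight s h * (\<integral>\<^sup>+ k. ball_weight t k * (ennreal ((s + t)\<^sup>2) * ?E)
      \<partial>(lborel :: (real^'n) measure)) \<partial>(lborel :: (real^'n) measure))"
  proof (intro nn_integral_mono)
    fix h :: "real^'n"
    show "ball_weight s h * (\<integral>\<^sup>+ k. ball_weight t k * (\<integral>\<^sup>+ x. ?F x h k \<partial>lborel) \<partial>lborel)
      \<le> ball_weight s h * (\<integral>\<^sup>+ k. ball_weight t k * (ennreal ((s + t)\<^sup>2) * ?E) \<partial>(lborel :: (real^'n) measure))"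
    proof (cases "h \<in> ball 0 s")
      case h: True
      have "(\<integral>\<^sup>+ k. ball_weight t k * (\<integral>\<^sup>+ x. ?F x h k \<partial>lborel) \<partial>lborel) \<le> (\<integral>\<^sup>+ k. ball_weight t k * (ennreal ((s + t)\<^sup>2) * ?E) \<partial>(lborel :: (real^'n) measure))"
      proof (intro nn_integral_mono)
        fix k :: "real^'n"
        show "ball_weight t k * (\<integral>\<^sup>+ x. ?F x h k \<partial>lborel) \<le> ball_weight t k * (ennreal ((s + t)\<^sup>2) * ?E)"
        proof (cases "k \<in> ball 0 t")
          case k: True
          have "norm (k - h) \<le> norm k + norm h" by (rule norm_triangle_ineq4)
          then have "norm (k - h) \<le> s + t" using h k by simp
          then have "ennreal ((norm (k - h))\<^sup>2) * ?E \<le> ennreal ((s + t)\<^sup>2) * ?E"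
            by (intro mult_right_mono ennreal_leI power_mono) auto
          from order_trans[OF F this] show ?thesis by (intro mult_left_mono) auto
        qed (simp add: ball_weight_def)
      qed
      then show ?thesis by (intro mult_left_mono) auto
    qed (simp add: ball_weight_def)
  qed
  also have "\<dots> = ennreal ((s + t)\<^sup>2) * ?E"
    using st by (simp add: nn_integral_multc nn_integral_ball_weight)
  finally show ?thesis .
qed

text \<open>The same double average at a fixed \<open>x\<close>, reorganised by
  \<open>k = m + h\<close>: for fixed \<open>m\<close> it is now the integral over \<open>h\<close>,
  extended from the ball to the whole space, to which the translation estimate applies. The weights
  are bounded by their inverse volumes and only \<open>m\<close> in the ball of radius
  \<open>s + t\<close> contributes. For \<open>s = t / 2\<close> the resulting factor has order t^(2
  - n).\<close>

lemma ball_avg_diff_sup: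
  fixes \<phi> :: "real^'n::finite \<Rightarrow> complex"
  assumes \<phi>: "\<phi> \<in> test_functions D" and st: "s > 0" "t > 0"
  shows "ennreal ((norm (ball_avg s \<phi> x - ball_avg t \<phi> x))\<^sup>2)
    \<le> ennreal (ball_vol TYPE('n) (s + t) / (ball_vol TYPE('n) s * ball_vol TYPE('n) t) * (s + t)\<^sup>2)
        * dirichlet_energy \<phi>"
proof -
  let ?E = "dirichlet_energy \<phi>"
  let ?F = "\<lambda>h m. ennreal ((norm (\<phi> (x + h + m) - \<phi> (x + h)))\<^sup>2)"
  let ?v = "ball_vol TYPE('n)"
  have v: "?v s > 0" "?v t > 0" using st ball_vol_pos by blast+
  let ?c = "ennreal (1 / ?v s) * ennreal (1 / ?v t)"
  let ?B = "indicator (ball 0 (s + t)) :: real^'n \<Rightarrow> ennreal"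
  have [measurable]: "\<phi> \<in> borel_measurable borel" by (rule test_functions_borel_measurable[OF \<phi>])
  have "ennreal ((norm (ball_avg s \<phi> x - ball_avg t \<phi> x))\<^sup>2) \<le>
    (\<integral>\<^sup>+ h. ball_weight s h * (\<integral>\<^sup>+ k. ball_weight t k * ennreal ((norm (\<phi> (x + k) - \<phi> (x + h)))\<^sup>2) \<partial>lborel) \<partial>lborel)"
    by (rule ball_avg_diff_le[OF \<phi> st])
  also have "\<dots> \<le> (\<integral>\<^sup>+ h. \<integral>\<^sup>+ m. ?c * (?B m * ?F h m) \<partial>lborel \<partial>lborel)"
  proof (intro nn_integral_mono)
    fix h :: "real^'n"
    show "ball_weight s h * (\<integral>\<^sup>+ k. ball_weight t k * ennreal ((norm (\<phi> (x + k) - \<phi> (x + h)))\<^sup>2) \<partial>lborel)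
      \<le> (\<integral>\<^sup>+ m. ?c * (?B m * ?F h m) \<partial>lborel)"
    proof (cases "h \<in> ball 0 s")
      case h: True
      have "(\<integral>\<^sup>+ k. ball_weight t k * ennreal ((norm (\<phi> (x + k) - \<phi> (x + h)))\<^sup>2) \<partial>lborel)
        = (\<integral>\<^sup>+ m. ball_weight t (m + h) * ennreal ((norm (\<phi> (x + (m + h)) - \<phi> (x + h)))\<^sup>2) \<partial>lborel)"
        by (rule nn_integral_lborel_translate[symmetric, where f = "\<lambda>k. ball_weight t k * ennreal ((norm (\<phi> (x + k) - \<phi> (x + h)))\<^sup>2)"]) measurable
      also have "\<dots> \<le> (\<integral>\<^sup>+ m. ennreal (1 / ?v t) * (?B m * ?F h m) \<partial>lborel)"
      proof (intro nn_integral_mono)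
        fix m :: "real^'n"
        have "ball_weight t (m + h) \<le> ennreal (1 / ?v t) * ?B m"
        proof (cases "m + h \<in> ball 0 t")
          case True
          have "norm m \<le> norm (m + h) + norm h" by (metis add_diff_cancel_right' norm_triangle_ineq4)
          then have "m \<in> ball 0 (s + t)" using True h by simp
          then show ?thesis by (simp add: ball_weight_def indicator_def)
        qed (simp add: ball_weight_def)
        then have "ball_weight t (m + h) * ?F h m \<le> ennreal (1 / ?v t) * ?B m * ?F h m" by (rule mult_right_mono) simp
        then show "ball_weight t (m + h) * ennreal ((norm (\<phi> (x + (m + h)) - \<phi> (x + h)))\<^sup>2) \<le> ennreal (1 / ?v t) * (?B m * ?F h m)"
          by (simp add: mult.assoc algebra_simps)
      qed
      finally have "ball_weight s h * (\<integral>\<^sup>+ k. ball_weight t k * ennreal ((norm (\<phi> (x + k) - \<phi> (x + h)))\<^sup>2) \<partial>lborel)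
         \<le> ennreal (1 / ?v s) * (\<integral>\<^sup>+ m. ennreal (1 / ?v t) * (?B m * ?F h m) \<partial>lborel)"
        using h by (intro mult_mono) (auto simp: ball_weight_def)
      also have "\<dots> = (\<integral>\<^sup>+ m. ennreal (1 / ?v s) * (ennreal (1 / ?v t) * (?B m * ?F h m)) \<partial>lborel)"
        by (intro nn_integral_cmult[symmetric]) measurable
      finally show ?thesis by (simp add: mult.assoc)
    qed (simp add: ball_weight_def)
  qed
  also have "\<dots> = (\<integral>\<^sup>+ m. \<integral>\<^sup>+ h. ?c * (?B m * ?F h m) \<partial>lborel \<partial>lborel)"
    by (rule lborel_pair.Fubini') measurable
  also have "\<dots> \<le> (\<integral>\<^sup>+ m. ?c * (?B m * (ennreal ((s + t)\<^sup>2) * ?E)) \<partial>lborel)"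
  proof (intro nn_integral_mono)
    fix m :: "real^'n"
    have "(\<integral>\<^sup>+ h. ?c * (?B m * ?F h m) \<partial>lborel) = ?c * (?B m * (\<integral>\<^sup>+ h. ?F h m \<partial>lborel))"
      by (simp add: nn_integral_cmult)
    also have "(\<integral>\<^sup>+ h. ?F h m \<partial>lborel) = (\<integral>\<^sup>+ h. ennreal ((norm (\<phi> ((h + x) + m) - \<phi> (h + x)))\<^sup>2) \<partial>lborel)"
      by (simp add: add.commute)
    also have "\<dots> = (\<integral>\<^sup>+ y. ennreal ((norm (\<phi> (y + m) - \<phi> y))\<^sup>2) \<partial>lborel)"
      by (rule nn_integral_lborel_translate[where f = "\<lambda>y. ennreal ((norm (\<phi> (y + m) - \<phi> y))\<^sup>2)"]) measurable
    finally have eq: "(\<integral>\<^sup>+ h. ?c * (?B m * ?F h m) \<partial>lborel) = ?c * (?B m * (\<integral>\<^sup>+ y. ennreal ((norm (\<phi> (y + m) - \<phi> y))\<^sup>2) \<partial>lborel))" .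
    show "(\<integral>\<^sup>+ h. ?c * (?B m * ?F h m) \<partial>lborel) \<le> ?c * (?B m * (ennreal ((s + t)\<^sup>2) * ?E))"
    proof (cases "m \<in> ball 0 (s + t)")
      case True
      have "(\<integral>\<^sup>+ y. ennreal ((norm (\<phi> (y + m) - \<phi> y))\<^sup>2) \<partial>lborel) \<le> ennreal ((norm m)\<^sup>2) * ?E"
        by (rule translation_estimate[OF \<phi>])
      also have "\<dots> \<le> ennreal ((s + t)\<^sup>2) * ?E"
        using True by (intro mult_right_mono ennreal_leI power_mono) auto
      finally show ?thesis unfolding eq by (intro mult_left_mono) auto
    qed (simp add: eq)
  qed
  also have "\<dots> = ?c * (ennreal (?v (s + t)) * (ennreal ((s + t)\<^sup>2) * ?E))"
    by (simp add: nn_integral_cmult nn_integral_multc emeasure_ball_vol)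
  also have "\<dots> = ennreal (?v (s + t) / (?v s * ?v t) * (s + t)\<^sup>2) * ?E"
  proof -
    have "?c * (ennreal (?v (s + t)) * ennreal ((s + t)\<^sup>2)) = ennreal (1 / ?v s * (1 / ?v t) * (?v (s + t) * (s + t)\<^sup>2))"
      using v by (simp add: ennreal_mult[symmetric])
    also have "1 / ?v s * (1 / ?v t) * (?v (s + t) * (s + t)\<^sup>2) = ?v (s + t) / (?v s * ?v t) * (s + t)\<^sup>2" by simp
    finally have c: "?c * (ennreal (?v (s + t)) * ennreal ((s + t)\<^sup>2)) = ennreal (?v (s + t) / (?v s * ?v t) * (s + t)\<^sup>2)" .
    show ?thesis unfolding c[symmetric] by (simp only: mult.assoc)
  qed
  finally show ?thesis .
qed

text \<open>Jensen's inequality with the weight bounded by the inverse volume, then the translation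
  estimate. At a fixed radius the Lipschitz constant depends on the energy alone, which gives
  equicontinuity.\<close>

lemma ball_avg_translate:
  fixes \<phi> :: "real^'n::finite \<Rightarrow> complex"
  assumes \<phi>: "\<phi> \<in> test_functions D" and t: "t > 0"
  shows "ennreal ((norm (ball_avg t \<phi> x - ball_avg t \<phi> y))\<^sup>2)
    \<le> ennreal ((norm (x - y))\<^sup>2 / ball_vol TYPE('n) t) * dirichlet_energy \<phi>"
proof -
  let ?v = "ball_vol TYPE('n) t"
  have v: "?v > 0" using t by (rule ball_vol_pos)
  have [measurable]: "\<phi> \<in> borel_measurable borel" by (rule test_functions_borel_measurable[OF \<phi>])
  have c: "continuous_on UNIV (\<lambda>h. \<phi> (x + h) - \<phi> (y + h))"
    by (intro continuous_on_diff test_translate_continuous[OF \<phi>])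
  have "ball_avg t \<phi> x - ball_avg t \<phi> y = (LINT h|lborel. indicator (ball 0 t) h *\<^sub>R (\<phi> (x + h) - \<phi> (y + h))) /\<^sub>R ?v"
    using integrable_ball_continuous[OF test_translate_continuous[OF \<phi>]]
    by (simp add: ball_avg_def scaleR_diff_right)
  then have "ennreal ((norm (ball_avg t \<phi> x - ball_avg t \<phi> y))\<^sup>2)
     \<le> (\<integral>\<^sup>+ h. ball_weight t h * ennreal ((norm (\<phi> (x + h) - \<phi> (y + h)))\<^sup>2) \<partial>lborel)"
    using ball_Jensen[OF t c, of 0] by simp
  also have "\<dots> \<le> (\<integral>\<^sup>+ h. ennreal (1 / ?v) * ennreal ((norm (\<phi> (x + h) - \<phi> (y + h)))\<^sup>2) \<partial>lborel)"
    by (intro nn_integral_mono mult_right_mono) (auto simp: ball_weight_def indicator_def)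
  also have "\<dots> = ennreal (1 / ?v) * (\<integral>\<^sup>+ h. ennreal ((norm (\<phi> ((h + y) + (x - y)) - \<phi> (h + y)))\<^sup>2) \<partial>lborel)"
    by (subst nn_integral_cmult) (auto simp: add.commute)
  also have "(\<integral>\<^sup>+ h. ennreal ((norm (\<phi> ((h + y) + (x - y)) - \<phi> (h + y)))\<^sup>2) \<partial>lborel)
     = (\<integral>\<^sup>+ z. ennreal ((norm (\<phi> (z + (x - y)) - \<phi> z))\<^sup>2) \<partial>lborel)"
    by (rule nn_integral_lborel_translate[where f = "\<lambda>z. ennreal ((norm (\<phi> (z + (x - y)) - \<phi> z))\<^sup>2)"]) measurable
  also have "ennreal (1 / ?v) * (\<integral>\<^sup>+ z. ennreal ((norm (\<phi> (z + (x - y)) - \<phi> z))\<^sup>2) \<partial>lborel)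
    \<le> ennreal (1 / ?v) * (ennreal ((norm (x - y))\<^sup>2) * dirichlet_energy \<phi>)"
    by (intro mult_left_mono translation_estimate[OF \<phi>]) auto
  also have "\<dots> = ennreal ((norm (x - y))\<^sup>2 / ?v) * dirichlet_energy \<phi>"
    using v by (simp add: mult.assoc[symmetric] ennreal_mult[symmetric])
  finally show ?thesis .
qed

text \<open>Again the weight is bounded by the inverse volume. Together with the Poincare inequality
  this is the uniform bound required by Ascoli's theorem.\<close>

lemma ball_avg_sup:
  fixes \<phi> :: "real^'n::finite \<Rightarrow> complex"
  assumes \<phi>: "\<phi> \<in> test_functions D" and t: "t > 0"
  shows "ennreal ((norm (ball_avg t \<phi> x))\<^sup>2) \<le> ennreal (1 / ball_vol TYPE('n) t) * (\<integral>\<^sup>+ x. ennreal ((norm (\<phi> x))\<^sup>2) \<partial>lborel)"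
proof -
  let ?v = "ball_vol TYPE('n) t"
  have [measurable]: "\<phi> \<in> borel_measurable borel" by (rule test_functions_borel_measurable[OF \<phi>])
  have "ennreal ((norm (ball_avg t \<phi> x))\<^sup>2) \<le> (\<integral>\<^sup>+ h. ball_weight t h * ennreal ((norm (\<phi> (x + h)))\<^sup>2) \<partial>lborel)"
    using ball_avg_Jensen[OF \<phi> t, of x 0] by simp
  also have "\<dots> \<le> (\<integral>\<^sup>+ h. ennreal (1 / ?v) * ennreal ((norm (\<phi> (h + x)))\<^sup>2) \<partial>lborel)"
    by (intro nn_integral_mono mult_mono) (auto simp: ball_weight_def indicator_def add.commute)
  also have "\<dots> = ennreal (1 / ?v) * (\<integral>\<^sup>+ h. ennreal ((norm (\<phi> (h + x)))\<^sup>2) \<partial>lborel)"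
    by (intro nn_integral_cmult) measurable
  also have "(\<integral>\<^sup>+ h. ennreal ((norm (\<phi> (h + x)))\<^sup>2) \<partial>lborel) = (\<integral>\<^sup>+ h. ennreal ((norm (\<phi> h))\<^sup>2) \<partial>lborel)"
    by (rule nn_integral_lborel_translate) measurable
  finally show ?thesis .
qed

lemma ball_avg_tendsto:
  fixes \<phi> :: "real^'n::finite \<Rightarrow> complex"
  assumes \<phi>: "\<phi> \<in> test_functions D" and t: "t \<longlonglongrightarrow> 0" "\<And>m::nat. t m > 0"
  shows "(\<lambda>m. ball_avg (t m) \<phi> x) \<longlonglongrightarrow> \<phi> x"
proof (rule LIMSEQ_I)
  fix r :: real assume r: "r > 0"
  have "isCont \<phi> x" using test_functions_continuous[OF \<phi>, of UNIV] by (simp add: continuous_on_eq_continuous_at)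
  then obtain d where d: "d > 0" "\<And>y. dist y x < d \<Longrightarrow> dist (\<phi> y) (\<phi> x) < r / 2"
    using r unfolding continuous_at_eps_delta by (meson half_gt_zero)
  obtain N where N: "\<And>m. m \<ge> N \<Longrightarrow> t m < d"
    using order_tendstoD(2)[OF t(1) d(1)] by (auto simp: eventually_sequentially)
  show "\<exists>N. \<forall>m\<ge>N. norm (ball_avg (t m) \<phi> x - \<phi> x) < r"
  proof (intro exI[of _ N] allI impI)
    fix m assume "m \<ge> N"
    have "ennreal ((norm (ball_avg (t m) \<phi> x - \<phi> x))\<^sup>2) \<le> (\<integral>\<^sup>+ h. ball_weight (t m) h * ennreal ((norm (\<phi> (x + h) - \<phi> x))\<^sup>2) \<partial>lborel)"
      by (rule ball_avg_Jensen[OF \<phi> t(2)])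
    also have "\<dots> \<le> (\<integral>\<^sup>+ h. ball_weight (t m) h * ennreal ((r / 2)\<^sup>2) \<partial>(lborel :: (real^'n) measure))"
    proof (intro nn_integral_mono)
      fix h :: "real^'n"
      show "ball_weight (t m) h * ennreal ((norm (\<phi> (x + h) - \<phi> x))\<^sup>2) \<le> ball_weight (t m) h * ennreal ((r / 2)\<^sup>2)"
      proof (cases "h \<in> ball 0 (t m)")
        case True
        then have "dist (x + h) x < d" using N[OF \<open>m \<ge> N\<close>] by (simp add: dist_norm)
        from d(2)[OF this] show ?thesis
          by (intro mult_left_mono ennreal_leI power_mono) (auto simp: dist_norm)
      qed (simp add: ball_weight_def)
    qed
    also have "\<dots> = ennreal ((r / 2)\<^sup>2)"
      by (simp add: nn_integral_multc nn_integral_ball_weight[OF t(2)])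
    finally have "(norm (ball_avg (t m) \<phi> x - \<phi> x))\<^sup>2 \<le> (r / 2)\<^sup>2" by simp
    then have "norm (ball_avg (t m) \<phi> x - \<phi> x) \<le> r / 2" using r by (simp add: power2_le_iff_abs_le)
    then show "norm (ball_avg (t m) \<phi> x - \<phi> x) < r" using r by simp
  qed
qed

section \<open>Sobolev inequality and compactness\<close>

lemma ball_avg_lipschitz:
  fixes \<phi> :: "real^'n::finite \<Rightarrow> complex"
  assumes \<phi>: "\<phi> \<in> test_functions D" and t: "t > 0" and e: "e \<ge> 0"
    and E: "dirichlet_energy \<phi> \<le> ennreal (e\<^sup>2)"
  shows "norm (ball_avg t \<phi> x - ball_avg t \<phi> y) \<le> e / sqrt (ball_vol TYPE('n) t) * norm (x - y)"
proof -
  let ?v = "ball_vol TYPE('n) t"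
  have v: "?v > 0" using t by (rule ball_vol_pos)
  have "ennreal ((norm (ball_avg t \<phi> x - ball_avg t \<phi> y))\<^sup>2) \<le> ennreal ((norm (x - y))\<^sup>2 / ?v) * ennreal (e\<^sup>2)"
    by (rule order_trans[OF ball_avg_translate[OF \<phi> t]]) (intro mult_left_mono E, simp)
  also have "\<dots> = ennreal ((e / sqrt ?v * norm (x - y))\<^sup>2)"
    using v by (simp add: ennreal_mult[symmetric] power_mult_distrib power_divide mult.commute)
  finally have "(norm (ball_avg t \<phi> x - ball_avg t \<phi> y))\<^sup>2 \<le> (e / sqrt ?v * norm (x - y))\<^sup>2"
    by (simp add: ennreal_le_iff)
  then show ?thesis using v e by (intro power2_le_imp_le[of "norm (ball_avg t \<phi> x - ball_avg t \<phi> y)"]) auto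
qed

lemma ball_avg_measurable:
  fixes \<phi> :: "real^'n::finite \<Rightarrow> complex"
  assumes \<phi>: "\<phi> \<in> test_functions D" and t: "t > 0" and e: "e \<ge> 0"
    and E: "dirichlet_energy \<phi> \<le> ennreal (e\<^sup>2)"
  shows "ball_avg t \<phi> \<in> borel_measurable borel"
proof (rule borel_measurable_continuous_onI, rule lipschitz_on_continuous_on[OF lipschitz_onI])
  show "dist (ball_avg t \<phi> x) (ball_avg t \<phi> y) \<le> e / sqrt (ball_vol TYPE('n) t) * dist x y" for x y
    unfolding dist_norm by (rule ball_avg_lipschitz[OF \<phi> t e E])
  show "0 \<le> e / sqrt (ball_vol TYPE('n) t)" using e by simp
qed

text \<open>The power of \<open>t\<close> in the bound on \<open>A\<^bsub>t/2\<^esub> \<phi> - A\<^sub>t \<phi>\<close> in \<open>L\<^sup>p\<close>; it is positive exactly in the subcritical range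
  \<open>p < 2n/(n - 2)\<close> (every \<open>p\<close> if \<open>n \<le> 2\<close>).\<close>

definition sobolev_gain :: "'n::finite itself \<Rightarrow> real \<Rightarrow> real" where
  "sobolev_gain _ p = (2 + (2 - real CARD('n)) * (p - 2) / 2) / p"

text \<open>Interpolation: the p-th power of the difference is its square times at most the
  \<open>(p - 2) / 2\<close>-th power of the supremum of the square. That supremum has order t^(2-n)
  e^2 and the integrated square has order t^2 e^2; collecting the powers of \<open>t\<close> and
  taking the p-th root leaves the exponent \<open>sobolev_gain\<close>.\<close>

lemma dyadic_Lp_estimate:
  assumes p: "p \<ge> 2"
  shows "\<exists>C>0. \<forall>(\<phi> :: real^'n::finite \<Rightarrow> complex) D t e. \<phi> \<in> test_functions D \<longrightarrow> t > 0 \<longrightarrow> e \<ge> 0 \<longrightarrow>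
      dirichlet_energy \<phi> \<le> ennreal (e\<^sup>2) \<longrightarrow>
      Lp_norm (ennreal p) lborel (\<lambda>x. ball_avg (t / 2) \<phi> x - ball_avg t \<phi> x)
        \<le> ennreal (C * t powr sobolev_gain TYPE('n) p * e)"
proof -
  let ?n = "CARD('n)" and ?w = "ball_vol TYPE('n) 1"
  have w: "?w > 0" by (rule ball_vol_pos) simp
  \<comment> \<open>The constant of the sup bound for radii \<open>t / 2\<close> and
    \<open>t\<close>: the volume ratio is 3^n / (w t^n), and (3t/2)^2 contributes 9/4.\<close>
  define C1 where "C1 = 3 ^ ?n * 9 / (4 * ?w)"
  have C1: "C1 > 0" using w by (simp add: C1_def)
  \<comment> \<open>The factor 9/4 comes from (3t/2)^2 in the L^2 bound.\<close>
  define C where "C = (C1 powr ((p - 2) / 2) * (9 / 4)) powr (1 / p)"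
  have "C > 0" using C1 by (simp add: C_def)
  moreover have "Lp_norm (ennreal p) lborel (\<lambda>x. ball_avg (t / 2) \<phi> x - ball_avg t \<phi> x)
        \<le> ennreal (C * t powr sobolev_gain TYPE('n) p * e)"
    if \<phi>: "\<phi> \<in> test_functions D" and t: "t > 0" and e: "e \<ge> 0"
      and E: "dirichlet_energy \<phi> \<le> ennreal (e\<^sup>2)"
    for \<phi> :: "real^'n \<Rightarrow> complex" and D t e
  proof (cases "e = 0")
    \<comment> \<open>With zero energy the sup bound makes the difference vanish identically.
      Splitting this off leaves a positive \<open>e\<close> for the powers below.\<close>
    case True
    have "Lp_norm (ennreal p) lborel (\<lambda>x. ball_avg (t / 2) \<phi> x - ball_avg t \<phi> x) \<le> ennreal 0"
    proof -
      have "ennreal ((norm (ball_avg (t / 2) \<phi> x - ball_avg t \<phi> x))\<^sup>2) \<le> 0" for x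
      proof -
        have "ennreal ((norm (ball_avg (t / 2) \<phi> x - ball_avg t \<phi> x))\<^sup>2) \<le> 
          ennreal (ball_vol TYPE('n) (t/2 + t) / (ball_vol TYPE('n) (t/2) * ball_vol TYPE('n) t) * (t/2 + t)\<^sup>2) * 0"
          by (rule order_trans[OF ball_avg_diff_sup[OF \<phi>]]) (use t E True in auto)
        then show ?thesis by simp
      qed
      then have "ball_avg (t / 2) \<phi> x - ball_avg t \<phi> x = 0" for x
        by (simp add: ennreal_eq_0_iff)
      then show ?thesis using p by (subst Lp_norm_le_iff) auto
    qed
    then show ?thesis using True by simp
  next
    case False
    with e have e: "e > 0" by simp
    let ?f = "\<lambda>x. ball_avg (t / 2) \<phi> x - ball_avg t \<phi> x"
    have t2: "t / 2 > 0" using t by simp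
    have [measurable]: "ball_avg (t / 2) \<phi> \<in> borel_measurable borel" "ball_avg t \<phi> \<in> borel_measurable borel"
      using ball_avg_measurable[OF \<phi> t2 less_imp_le[OF e] E] ball_avg_measurable[OF \<phi> t less_imp_le[OF e] E] .
    define a where "a = C1 * t powr (2 - real ?n) * e\<^sup>2"
    have vol: "ball_vol TYPE('n) (t/2 + t) / (ball_vol TYPE('n) (t/2) * ball_vol TYPE('n) t) * (t/2 + t)\<^sup>2 = C1 * t powr (2 - real ?n)"
    proof -
      have v: "ball_vol TYPE('n) (t/2 + t) = (3 / 2) ^ ?n * t ^ ?n * ?w"
        "ball_vol TYPE('n) (t/2) = (1 / 2) ^ ?n * t ^ ?n * ?w" "ball_vol TYPE('n) t = t ^ ?n * ?w"
        using ball_vol_eq[of "t/2 + t", where 'n='n] ball_vol_eq[of "t/2", where 'n='n] ball_vol_eq[of t, where 'n='n] t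
        by (simp_all add: power_mult_distrib[symmetric])
      have tp: "t powr (2 - real ?n) = t\<^sup>2 / t ^ ?n"
        using t by (simp add: powr_diff powr_realpow)
      have s: "(t / 2 + t)\<^sup>2 = 9 / 4 * t\<^sup>2" by (simp add: power2_eq_square)
      have r: "(3 / 2 :: real) ^ ?n = 3 ^ ?n * (1 / 2) ^ ?n" by (simp add: power_mult_distrib[symmetric])
      have tn: "t ^ ?n > 0" using t by simp
      define X where "X = t ^ ?n"
      define Y where "Y = (1 / 2 :: real) ^ ?n"
      have XY: "X > 0" "Y > 0" using t by (auto simp: X_def Y_def)
      show ?thesis unfolding v tp s r C1_def X_def[symmetric] Y_def[symmetric]
        using XY w by (simp add: field_simps)
    qed
    have sup: "(norm (?f x))\<^sup>2 \<le> a" for x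
    proof -
      have "ennreal ((norm (?f x))\<^sup>2) \<le> ennreal (C1 * t powr (2 - real ?n)) * ennreal (e\<^sup>2)"
        unfolding vol[symmetric] by (rule order_trans[OF ball_avg_diff_sup[OF \<phi> t2 t]]) (intro mult_left_mono E, simp)
      also have "\<dots> = ennreal a" using C1 by (simp add: a_def ennreal_mult[symmetric])
      finally show ?thesis using C1 by (simp add: a_def)
    qed
    have "(\<integral>\<^sup>+ x. ennreal (norm (?f x) powr p) \<partial>lborel) \<le> (\<integral>\<^sup>+ x. ennreal (a powr ((p - 2) / 2)) * ennreal ((norm (?f x))\<^sup>2) \<partial>lborel)"
    proof (intro nn_integral_mono)
      fix x
      have "norm (?f x) powr p = ((norm (?f x))\<^sup>2) powr ((p - 2) / 2) * (norm (?f x))\<^sup>2"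
      proof (cases "?f x = 0")
        case False
        then have "norm (?f x) > 0" by simp
        have sq: "((norm (?f x))\<^sup>2) powr ((p - 2) / 2) = norm (?f x) powr (p - 2)"
        proof -
          have "((norm (?f x))\<^sup>2) powr ((p - 2) / 2) = (norm (?f x) powr 2) powr ((p - 2) / 2)" by simp
          also have "\<dots> = norm (?f x) powr (2 * ((p - 2) / 2))" by (rule powr_powr)
          also have "2 * ((p - 2) / 2) = p - 2" by simp
          finally show ?thesis .
        qed
        have "((norm (?f x))\<^sup>2) powr ((p - 2) / 2) * (norm (?f x))\<^sup>2 = norm (?f x) powr (p - 2) * norm (?f x) powr 2"
          unfolding sq by simp
        also have "\<dots> = norm (?f x) powr p" by (simp only: powr_add[symmetric]) simp
        finally show ?thesis by simp
      qed simp
      also have "\<dots> \<le> a powr ((p - 2) / 2) * (norm (?f x))\<^sup>2"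
        using sup p by (intro mult_right_mono powr_mono2) auto
      finally show "ennreal (norm (?f x) powr p) \<le> ennreal (a powr ((p - 2) / 2)) * ennreal ((norm (?f x))\<^sup>2)"
        by (simp add: ennreal_mult[symmetric])
    qed
    also have "\<dots> = ennreal (a powr ((p - 2) / 2)) * (\<integral>\<^sup>+ x. ennreal ((norm (?f x))\<^sup>2) \<partial>lborel)"
      by (intro nn_integral_cmult) measurable
    also have "\<dots> \<le> ennreal (a powr ((p - 2) / 2)) * (ennreal ((t / 2 + t)\<^sup>2) * ennreal (e\<^sup>2))"
      by (intro mult_left_mono order_trans[OF ball_avg_diff_L2[OF \<phi> t2 t]] E) auto
    also have "\<dots> = ennreal (a powr ((p - 2) / 2) * ((t / 2 + t)\<^sup>2 * e\<^sup>2))" by (simp add: ennreal_mult)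
    also have "a powr ((p - 2) / 2) * ((t / 2 + t)\<^sup>2 * e\<^sup>2) = (C * t powr sobolev_gain TYPE('n) p * e) powr p"
    proof -
      have "a powr ((p - 2) / 2) = C1 powr ((p - 2) / 2) * t powr ((2 - real ?n) * (p - 2) / 2) * e powr (p - 2)"
      proof -
        have "(e\<^sup>2) powr ((p - 2) / 2) = (e powr 2) powr ((p - 2) / 2)" using e by simp
        also have "\<dots> = e powr (2 * ((p - 2) / 2))" by (rule powr_powr)
        also have "2 * ((p - 2) / 2) = p - 2" by simp
        finally have "(e\<^sup>2) powr ((p - 2) / 2) = e powr (p - 2)" .
        then show ?thesis using C1 t e by (simp add: a_def powr_mult powr_powr)
      qed
      moreover have "(t / 2 + t)\<^sup>2 = 9 / 4 * t powr 2" using t by (simp add: power2_eq_square)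
      moreover have "e\<^sup>2 = e powr 2" using e by simp
      ultimately have "a powr ((p - 2) / 2) * ((t / 2 + t)\<^sup>2 * e\<^sup>2) =
        (C1 powr ((p - 2) / 2) * (9 / 4)) * (t powr ((2 - real ?n) * (p - 2) / 2) * t powr 2) * (e powr (p - 2) * e powr 2)"
        by (simp only: mult_ac)
      also have "\<dots> = C powr p * (t powr (sobolev_gain TYPE('n) p * p)) * e powr p"
      proof -
        have "t powr ((2 - real ?n) * (p - 2) / 2) * t powr 2 = t powr (sobolev_gain TYPE('n) p * p)"
          using p by (simp only: powr_add[symmetric]) (simp add: sobolev_gain_def add.commute)
        moreover have "e powr (p - 2) * e powr 2 = e powr p" by (simp only: powr_add[symmetric]) simp
        moreover have "C1 powr ((p - 2) / 2) * (9 / 4) = C powr p" using p C1 by (simp add: C_def powr_powr)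
        ultimately show ?thesis by (simp only:)
      qed
      also have "\<dots> = (C * t powr sobolev_gain TYPE('n) p * e) powr p"
        using \<open>C > 0\<close> t e by (simp add: powr_mult powr_powr)
      finally show ?thesis .
    qed
    finally show ?thesis using p \<open>C > 0\<close> e by (subst Lp_norm_le_iff) auto
  qed
  ultimately show ?thesis by blast
qed

text \<open>Halving the radius multiplies the previous bound by \<open>\<rho>\<close>, which is
  below 1 because the gain is positive, so the telescoping sum is dominated by a geometric series.
  Fatou's lemma replaces the averages of vanishing radius by \<open>\<phi>\<close>. The case
  \<open>m = 0\<close> will give the Sobolev inequality; the decay \<open>\<rho> ^ m\<close>,
  uniform in \<open>\<phi>\<close>, will give compactness.\<close>

lemma dyadic_approximation:
  assumes p: "p \<ge> 2" and \<theta>: "sobolev_gain TYPE('n::finite) p > 0"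
  shows "\<exists>C>0. \<exists>\<rho>>0. \<rho> < 1 \<and> (\<forall>(\<phi> :: real^'n::finite \<Rightarrow> complex) D m e. \<phi> \<in> test_functions D \<longrightarrow> e \<ge> 0 \<longrightarrow>
      dirichlet_energy \<phi> \<le> ennreal (e\<^sup>2) \<longrightarrow>
      Lp_norm (ennreal p) lborel (\<lambda>x. \<phi> x - ball_avg ((1/2)^m) \<phi> x) \<le> ennreal (C * \<rho> ^ m * e))"
proof -
  obtain C where C: "C > 0" "\<forall>(\<phi> :: real^'n \<Rightarrow> complex) D t e. \<phi> \<in> test_functions D \<longrightarrow> t > 0 \<longrightarrow> e \<ge> 0 \<longrightarrow>
      dirichlet_energy \<phi> \<le> ennreal (e\<^sup>2) \<longrightarrow>
      Lp_norm (ennreal p) lborel (\<lambda>x. ball_avg (t / 2) \<phi> x - ball_avg t \<phi> x)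
        \<le> ennreal (C * t powr sobolev_gain TYPE('n) p * e)"
    using dyadic_Lp_estimate[OF p, where 'n='n] by blast
  define \<rho> where "\<rho> = (1/2) powr sobolev_gain TYPE('n) p"
  have \<rho>: "0 < \<rho>" "\<rho> < 1" using \<theta> powr_less_mono'[of "1/2" 0 "sobolev_gain TYPE('n) p"] by (auto simp: \<rho>_def)
  have "Lp_norm (ennreal p) lborel (\<lambda>x. \<phi> x - ball_avg ((1/2)^m) \<phi> x) \<le> ennreal (C / (1 - \<rho>) * \<rho> ^ m * e)"
    if \<phi>: "\<phi> \<in> test_functions D" and e: "e \<ge> 0"
      and E: "dirichlet_energy \<phi> \<le> ennreal (e\<^sup>2)"
    for \<phi> :: "real^'n \<Rightarrow> complex" and D m e
  proof -
    let ?A = "\<lambda>k. ball_avg ((1/2)^k) \<phi>"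
    have A[measurable]: "?A k \<in> borel_measurable borel" for k
      by (rule ball_avg_measurable[OF \<phi> _ e E]) simp
    have A': "?A k \<in> borel_measurable lborel" for k using A[of k] by simp
    have step: "Lp_norm (ennreal p) lborel (\<lambda>x. ?A (Suc k) x - ?A k x) \<le> ennreal (C * \<rho> ^ k * e)" for k
    proof -
      have "((1/2)^k) powr sobolev_gain TYPE('n) p = \<rho> ^ k"
        by (simp add: \<rho>_def powr_powr powr_realpow[symmetric] mult.commute)
      then show ?thesis using C(2)[rule_format, OF \<phi> _ e E, of "(1/2)^k"] by simp
    qed
    have tele: "Lp_norm (ennreal p) lborel (\<lambda>x. ?A (m + j) x - ?A m x) \<le> ennreal (C * (\<Sum>i<j. \<rho> ^ (m + i)) * e)" for j
    proof (induction j)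
      case 0
      show ?case using p by (subst Lp_norm_le_iff) auto
    next
      case (Suc j)
      have "Lp_norm (ennreal p) lborel (\<lambda>x. ?A (m + Suc j) x - ?A m x)
        \<le> Lp_norm (ennreal p) lborel (\<lambda>x. ?A (m + Suc j) x - ?A (m + j) x) + Lp_norm (ennreal p) lborel (\<lambda>x. ?A (m + j) x - ?A m x)"
        using p by (intro Lp_norm_triangle_diff A') auto
      also have "\<dots> \<le> ennreal (C * \<rho> ^ (m + j) * e) + ennreal (C * (\<Sum>i<j. \<rho> ^ (m + i)) * e)"
        using step[of "m + j"] Suc by (intro add_mono) auto
      also have "\<dots> = ennreal (C * \<rho> ^ (m + j) * e + C * (\<Sum>i<j. \<rho> ^ (m + i)) * e)"
        using C(1) \<rho> e by (intro ennreal_plus[symmetric]) (auto intro!: mult_nonneg_nonneg sum_nonneg)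
      also have "C * \<rho> ^ (m + j) * e + C * (\<Sum>i<j. \<rho> ^ (m + i)) * e = C * (\<Sum>i<Suc j. \<rho> ^ (m + i)) * e"
        by (simp add: algebra_simps)
      finally show ?case .
    qed
    have le: "C * (\<Sum>i<j. \<rho> ^ (m + i)) * e \<le> C / (1 - \<rho>) * \<rho> ^ m * e" for j
    proof -
      have "(\<Sum>i<j. \<rho> ^ (m + i)) = \<rho> ^ m * (\<Sum>i<j. \<rho> ^ i)" by (simp add: power_add sum_distrib_left)
      also have "(\<Sum>i<j. \<rho> ^ i) = (1 - \<rho> ^ j) / (1 - \<rho>)" using \<rho> by (simp add: sum_gp_strict)
      also have "\<rho> ^ m * ((1 - \<rho> ^ j) / (1 - \<rho>)) \<le> \<rho> ^ m * (1 / (1 - \<rho>))"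
        using \<rho> by (intro mult_left_mono divide_right_mono) auto
      finally have "C * (\<Sum>i<j. \<rho> ^ (m + i)) * e \<le> C * (\<rho> ^ m * (1 / (1 - \<rho>))) * e"
        using C(1) e by (intro mult_right_mono mult_left_mono) auto
      then show ?thesis by (simp add: mult_ac)
    qed
    show ?thesis
    proof (rule Lp_norm_Fatou[where f = "\<lambda>j x. ?A (m + j) x - ?A m x"])
      show "AE x in lborel. (\<lambda>j. ?A (m + j) x - ?A m x) \<longlonglongrightarrow> \<phi> x - ?A m x"
      proof (intro AE_I2 tendsto_diff tendsto_const)
        fix x
        have "(\<lambda>k. (1/2)^k :: real) \<longlonglongrightarrow> 0" by (intro LIMSEQ_power_zero) simp
        then have "(\<lambda>k. ?A k x) \<longlonglongrightarrow> \<phi> x" by (rule ball_avg_tendsto[OF \<phi>]) simp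
        then show "(\<lambda>j. ?A (m + j) x) \<longlonglongrightarrow> \<phi> x"
          using LIMSEQ_ignore_initial_segment[of "\<lambda>k. ?A k x" "\<phi> x" m] by (simp add: add.commute)
      qed
      show "\<forall>\<^sub>F j in sequentially. Lp_norm (ennreal p) lborel (\<lambda>x. ?A (m + j) x - ?A m x) \<le> ennreal (C / (1 - \<rho>) * \<rho> ^ m * e)"
        using order_trans[OF tele ennreal_leI[OF le]] by simp
    qed (use p in auto)
  qed
  moreover have "C / (1 - \<rho>) > 0" using \<rho> C(1) by simp
  ultimately show ?thesis using \<rho> by blast
qed

section \<open>Norms over a bounded domain\<close>

lemma Lp_norm_lebesgue_on_le:
  fixes f :: "'a::euclidean_space \<Rightarrow> 'b::{second_countable_topology,real_normed_vector}"
  assumes D: "D \<in> sets lebesgue" and p: "p > 0"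
  shows "Lp_norm (ennreal p) (lebesgue_on D) f \<le> Lp_norm (ennreal p) lborel f"
proof (rule ennreal_le_by_real)
  fix a :: real assume a: "a \<ge> 0" "Lp_norm (ennreal p) lborel f \<le> ennreal a"
  have "(\<integral>\<^sup>+ x. ennreal (norm (f x) powr p) \<partial>lebesgue_on D) = (\<integral>\<^sup>+ x. ennreal (norm (f x) powr p) * indicator D x \<partial>lebesgue)"
    using D by (intro nn_integral_restrict_space) simp
  also have "\<dots> \<le> (\<integral>\<^sup>+ x. ennreal (norm (f x) powr p) \<partial>lebesgue)"
    by (intro nn_integral_mono) (auto simp: indicator_def)
  also have "\<dots> = (\<integral>\<^sup>+ x. ennreal (norm (f x) powr p) \<partial>lborel)" by (rule nn_integral_completion)
  also have "\<dots> \<le> ennreal (a powr p)" using a p by (simp add: Lp_norm_le_iff)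
  finally show "Lp_norm (ennreal p) (lebesgue_on D) f \<le> ennreal a" using a p by (simp add: Lp_norm_le_iff)
qed

lemma bounded_lebesgue_on_finite:
  assumes "bounded D" "D \<in> sets lebesgue"
  shows "finite_measure (lebesgue_on D)"
proof
  have "D \<in> lmeasurable" using assms by (rule bounded_set_imp_lmeasurable)
  then show "emeasure (lebesgue_on D) (space (lebesgue_on D)) \<noteq> \<infinity>"
    using assms by (simp add: emeasure_restrict_space fmeasurable_def)
qed

lemma Lp_norm_bounded_le:
  fixes f :: "'a \<Rightarrow> 'b::real_normed_vector"
  assumes "finite_measure M" "p > 0" "a \<ge> 0" "\<And>x. x \<in> space M \<Longrightarrow> norm (f x) \<le> a"
  shows "Lp_norm (ennreal p) M f \<le> ennreal (a * measure M (space M) powr (1 / p))"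
proof -
  interpret finite_measure M by fact
  have "(\<integral>\<^sup>+ x. ennreal (norm (f x) powr p) \<partial>M) \<le> (\<integral>\<^sup>+ x. ennreal (a powr p) \<partial>M)"
    using assms by (intro nn_integral_mono ennreal_leI powr_mono2) auto
  also have "\<dots> = ennreal ((a * measure M (space M) powr (1 / p)) powr p)"
    using assms by (simp add: emeasure_eq_measure ennreal_mult powr_mult powr_powr)
  finally show ?thesis using assms by (simp add: Lp_norm_le_iff)
qed

lemma gradient_energy_le:
  assumes D: "open D" and \<phi>: "\<phi> \<in> test_functions D" and e: "e \<ge> 0"
    and le: "Lp_norm (ennreal 2) (lebesgue_on D) (gradient \<phi>) \<le> ennreal e"
  shows "dirichlet_energy \<phi> \<le> ennreal (e\<^sup>2)"
proof -
  have "Lp_norm (ennreal 2) lborel (gradient \<phi>) \<le> ennreal e"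
    using le Lp_norm_lebesgue_on_eq_lborel[OF gradient_borel_measurable[OF \<phi>] _ gradient_eq_0[OF \<phi>], of D 2] D by auto
  then show ?thesis using e by (subst (asm) Lp_norm_le_iff) auto
qed

lemma Poincare_sup:
  fixes \<phi> :: "real^'n::finite \<Rightarrow> complex"
  assumes \<phi>: "\<phi> \<in> test_functions D" and DR: "D \<subseteq> ball 0 R" "R > 0" and t: "t > 0" and e: "e \<ge> 0"
    and E: "dirichlet_energy \<phi> \<le> ennreal (e\<^sup>2)"
  shows "norm (ball_avg t \<phi> x) \<le> 2 * R / sqrt (ball_vol TYPE('n) t) * e"
proof -
  let ?v = "ball_vol TYPE('n) t"
  have v: "?v > 0" using t by (rule ball_vol_pos)
  have "ennreal ((norm (ball_avg t \<phi> x))\<^sup>2) \<le> ennreal (1 / ?v) * (\<integral>\<^sup>+ x. ennreal ((norm (\<phi> x))\<^sup>2) \<partial>lborel)"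
    by (rule ball_avg_sup[OF \<phi> t])
  also have "\<dots> \<le> ennreal (1 / ?v) * (ennreal ((2 * R)\<^sup>2) * ennreal (e\<^sup>2))"
    by (intro mult_left_mono order_trans[OF Poincare_inequality[OF \<phi> DR]] E) auto
  also have "\<dots> = ennreal ((2 * R / sqrt ?v * e)\<^sup>2)"
    using v by (simp add: ennreal_mult[symmetric] power_mult_distrib power_divide)
  finally have "(norm (ball_avg t \<phi> x))\<^sup>2 \<le> (2 * R / sqrt ?v * e)\<^sup>2" by (simp add: ennreal_le_iff)
  then show ?thesis using v e DR by (intro power2_le_imp_le[of "norm (ball_avg t \<phi> x)"]) auto
qed

text \<open>\<open>\<phi>\<close> is split into its average of radius 1, bounded pointwise through
  the Poincare inequality and hence in L^p of the bounded set \<open>D\<close>, and a remainder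
  covered by the dyadic estimate with \<open>m = 0\<close>.\<close>

theorem Sobolev_inequality:
  fixes D :: "(real^'n::finite) set"
  assumes D: "open D" "bounded D" and p: "p \<ge> 2" "sobolev_gain TYPE('n) p > 0"
  obtains C where "C > 0"
    "\<And>\<phi> e. \<phi> \<in> test_functions D \<Longrightarrow> e \<ge> 0 \<Longrightarrow> Lp_norm (ennreal 2) (lebesgue_on D) (gradient \<phi>) \<le> ennreal e \<Longrightarrow>
      Lp_norm (ennreal p) (lebesgue_on D) \<phi> \<le> ennreal (C * e)"
proof -
  obtain C \<rho> where C: "C > 0" "0 < \<rho>" "\<rho> < 1"
    "\<forall>(\<phi> :: real^'n \<Rightarrow> complex) D m e. \<phi> \<in> test_functions D \<longrightarrow> e \<ge> 0 \<longrightarrow>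
      dirichlet_energy \<phi> \<le> ennreal (e\<^sup>2) \<longrightarrow>
      Lp_norm (ennreal p) lborel (\<lambda>x. \<phi> x - ball_avg ((1/2)^m) \<phi> x) \<le> ennreal (C * \<rho> ^ m * e)"
    using dyadic_approximation[OF p] by blast
  obtain R where R: "R > 0" "D \<subseteq> ball 0 R" using bounded_subset_ballD[OF D(2), of 0] by auto
  have Dl: "D \<in> sets lebesgue" using D by auto
  define K where "K = 2 * R / sqrt (ball_vol TYPE('n) 1) * measure (lebesgue_on D) (space (lebesgue_on D)) powr (1 / p)"
  have K: "K \<ge> 0" using R by (simp add: K_def)
  show ?thesis
  proof (rule that[of "C + K"])
    show "C + K > 0" using C K by simp
    fix \<phi> e assume \<phi>: "\<phi> \<in> test_functions D" and e: "e \<ge> 0"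
      and le: "Lp_norm (ennreal 2) (lebesgue_on D) (gradient \<phi>) \<le> ennreal e"
    have E: "dirichlet_energy \<phi> \<le> ennreal (e\<^sup>2)"
      by (rule gradient_energy_le[OF D(1) \<phi> e le])
    have m: "\<phi> \<in> borel_measurable (lebesgue_on D)" "ball_avg 1 \<phi> \<in> borel_measurable (lebesgue_on D)"
      using test_functions_borel_measurable[OF \<phi>] ball_avg_measurable[OF \<phi> _ e E, of 1]
      by (auto intro: borel_measurable_lebesgue_on)
    have "Lp_norm (ennreal p) (lebesgue_on D) \<phi> \<le> Lp_norm (ennreal p) (lebesgue_on D) (ball_avg 1 \<phi>) +
        Lp_norm (ennreal p) (lebesgue_on D) (\<lambda>x. \<phi> x - ball_avg 1 \<phi> x)"
      using m p by (intro Lp_norm_le_add_diff) auto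
    also have "\<dots> \<le> ennreal (2 * R / sqrt (ball_vol TYPE('n) 1) * e * measure (lebesgue_on D) (space (lebesgue_on D)) powr (1 / p)) + ennreal (C * e)"
    proof (intro add_mono)
      show "Lp_norm (ennreal p) (lebesgue_on D) (ball_avg 1 \<phi>) \<le> ennreal (2 * R / sqrt (ball_vol TYPE('n) 1) * e * measure (lebesgue_on D) (space (lebesgue_on D)) powr (1 / p))"
        by (intro Lp_norm_bounded_le bounded_lebesgue_on_finite D Dl Poincare_sup[OF \<phi> R(2,1) _ e E]) (use p R e in auto)
      have "Lp_norm (ennreal p) lborel (\<lambda>x. \<phi> x - ball_avg 1 \<phi> x) \<le> ennreal (C * e)"
        using C(4)[rule_format, OF \<phi> e E, of 0] by simp
      then show "Lp_norm (ennreal p) (lebesgue_on D) (\<lambda>x. \<phi> x - ball_avg 1 \<phi> x) \<le> ennreal (C * e)"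
        using p by (intro order_trans[OF Lp_norm_lebesgue_on_le[OF Dl]]) auto
    qed
    also have "\<dots> = ennreal ((C + K) * e)"
      using C(1) R e by (simp add: ennreal_plus[symmetric] K_def algebra_simps del: ennreal_plus)
    finally show "Lp_norm (ennreal p) (lebesgue_on D) \<phi> \<le> ennreal ((C + K) * e)" .
  qed
qed

text \<open>Ascoli's theorem on a closed ball containing \<open>D\<close>. The Cauchy property is
  kept instead of the limit, so that nothing has to be known about limits at different
  radii.\<close>

lemma ball_avg_uniformly_Cauchy_subseq:
  fixes \<phi> :: "nat \<Rightarrow> real^'n::finite \<Rightarrow> complex"
  assumes \<phi>: "\<And>k. \<phi> k \<in> test_functions D" and DR: "D \<subseteq> ball 0 R" "R > 0" and t: "t > 0" and e: "e \<ge> 0"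
    and E: "\<And>k. dirichlet_energy (\<phi> k) \<le> ennreal (e\<^sup>2)"
  obtains r where "strict_mono (r :: nat \<Rightarrow> nat)"
    "\<And>\<epsilon>. \<epsilon> > 0 \<Longrightarrow> \<exists>N. \<forall>i\<ge>N. \<forall>j\<ge>N. \<forall>x\<in>D. norm (ball_avg t (\<phi> (r i)) x - ball_avg t (\<phi> (r j)) x) < \<epsilon>"
proof -
  \<comment> \<open>Adding 1 keeps the Lipschitz constant positive when \<open>e\<close> is zero, so
    that \<open>\<epsilon> / L\<close> is a valid modulus.\<close>
  define L where "L = e / sqrt (ball_vol TYPE('n) t) + 1"
  have L: "L > 0" using e by (simp add: L_def add_nonneg_pos)
  have lip: "norm (ball_avg t (\<phi> k) x - ball_avg t (\<phi> k) y) \<le> L * norm (x - y)" for k x y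
    by (rule order_trans[OF ball_avg_lipschitz[OF \<phi> t e E]]) (unfold L_def, intro mult_right_mono, auto)
  have equi: "\<exists>d>0. \<forall>n y. y \<in> cball 0 R \<and> norm (x - y) < d \<longrightarrow> norm (ball_avg t (\<phi> n) x - ball_avg t (\<phi> n) y) < \<epsilon>"
    if "\<epsilon> > 0" for x \<epsilon>
  proof (intro exI[of _ "\<epsilon> / L"] conjI allI impI)
    show "\<epsilon> / L > 0" using L that by simp
    fix n y assume "y \<in> cball 0 R \<and> norm (x - y) < \<epsilon> / L"
    then have "L * norm (x - y) < \<epsilon>" using L by (simp add: pos_less_divide_eq mult.commute)
    then show "norm (ball_avg t (\<phi> n) x - ball_avg t (\<phi> n) y) < \<epsilon>" using lip[of n x y] by simp
  qed
  obtain g r where gr: "strict_mono (r :: nat \<Rightarrow> nat)"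
      "\<And>\<epsilon>. 0 < \<epsilon> \<Longrightarrow> \<exists>N. \<forall>n x. n \<ge> N \<and> x \<in> cball 0 R \<longrightarrow> norm (ball_avg t (\<phi> (r n)) x - g x) < \<epsilon>"
    using Arzela_Ascoli[where S = "cball 0 R" and \<F> = "\<lambda>k. ball_avg t (\<phi> k)" and M = "2 * R / sqrt (ball_vol TYPE('n) t) * e",
        OF compact_cball Poincare_sup[OF \<phi> DR t e E] equi] by metis
  show ?thesis
  proof (rule that[OF gr(1)])
    fix \<epsilon> :: real assume "\<epsilon> > 0"
    then obtain N where N: "\<And>n x. n \<ge> N \<Longrightarrow> x \<in> cball 0 R \<Longrightarrow> norm (ball_avg t (\<phi> (r n)) x - g x) < \<epsilon> / 2"
      using gr(2)[of "\<epsilon> / 2"] by auto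
    show "\<exists>N. \<forall>i\<ge>N. \<forall>j\<ge>N. \<forall>x\<in>D. norm (ball_avg t (\<phi> (r i)) x - ball_avg t (\<phi> (r j)) x) < \<epsilon>"
    proof (intro exI[of _ N] allI impI ballI)
      fix i j x assume ij: "i \<ge> N" "j \<ge> N" and "x \<in> D"
      then have x: "x \<in> cball 0 R" using DR by (auto simp: less_imp_le)
      have "norm (ball_avg t (\<phi> (r i)) x - ball_avg t (\<phi> (r j)) x)
         \<le> norm (ball_avg t (\<phi> (r i)) x - g x) + norm (ball_avg t (\<phi> (r j)) x - g x)"
        using norm_triangle_ineq4[of "ball_avg t (\<phi> (r i)) x - g x" "ball_avg t (\<phi> (r j)) x - g x"] by simp
      then show "norm (ball_avg t (\<phi> (r i)) x - ball_avg t (\<phi> (r j)) x) < \<epsilon>"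
        using N[OF ij(1) x] N[OF ij(2) x] by simp
    qed
  qed
qed

text \<open>A diagonal subsequence makes the averages of every radius (1/2)^m uniformly Cauchy on
  \<open>D\<close>. Since \<open>\<phi> k\<close> stays within \<open>C * \<rho> ^ m * e\<close> of
  its average, uniformly in \<open>k\<close>, the sequence itself is Cauchy in L^p by a three-term
  estimate.\<close>

theorem Rellich_Kondrachov:
  fixes D :: "(real^'n::finite) set" and \<phi> :: "nat \<Rightarrow> real^'n \<Rightarrow> complex"
  assumes D: "open D" "bounded D" and p: "p \<ge> 2" "sobolev_gain TYPE('n) p > 0"
    and \<phi>: "\<And>k. \<phi> k \<in> test_functions D" and e: "e \<ge> 0"
    and le: "\<And>k. Lp_norm (ennreal 2) (lebesgue_on D) (gradient (\<phi> k)) \<le> ennreal e"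
  obtains r where "strict_mono (r :: nat \<Rightarrow> nat)"
    "\<And>\<epsilon>. \<epsilon> > 0 \<Longrightarrow> \<exists>N. \<forall>i\<ge>N. \<forall>j\<ge>N. Lp_norm (ennreal p) (lebesgue_on D) (\<lambda>x. \<phi> (r i) x - \<phi> (r j) x) \<le> ennreal \<epsilon>"
proof -
  have E: "dirichlet_energy (\<phi> k) \<le> ennreal (e\<^sup>2)" for k
    by (rule gradient_energy_le[OF D(1) \<phi> e le])
  obtain C \<rho> where C: "C > 0" "0 < \<rho>" "\<rho> < 1"
    "\<forall>(\<phi> :: real^'n \<Rightarrow> complex) D m e. \<phi> \<in> test_functions D \<longrightarrow> e \<ge> 0 \<longrightarrow>
      dirichlet_energy \<phi> \<le> ennreal (e\<^sup>2) \<longrightarrow>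
      Lp_norm (ennreal p) lborel (\<lambda>x. \<phi> x - ball_avg ((1/2)^m) \<phi> x) \<le> ennreal (C * \<rho> ^ m * e)"
    using dyadic_approximation[OF p] by blast
  obtain R where R: "R > 0" "D \<subseteq> ball 0 R" using bounded_subset_ballD[OF D(2), of 0] by auto
  have Dl: "D \<in> sets lebesgue" using D by auto
  have fin: "finite_measure (lebesgue_on D)" by (rule bounded_lebesgue_on_finite[OF D(2) Dl])
  let ?A = "\<lambda>m k. ball_avg ((1/2)^m) (\<phi> k)"
  \<comment> \<open>Being uniformly Cauchy names no limit and passes to subsequences, as the
    diagonal construction requires.\<close>
  define P where "P m s \<longleftrightarrow> (\<forall>\<epsilon>>0. \<exists>N. \<forall>i\<ge>N. \<forall>j\<ge>N. \<forall>x\<in>D. norm (?A m (s i) x - ?A m (s j) x) < \<epsilon>)"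
    for m :: nat and s :: "nat \<Rightarrow> nat"
  interpret subseqs P
  proof
    fix m and s :: "nat \<Rightarrow> nat" assume "strict_mono s"
    obtain r where "strict_mono (r :: nat \<Rightarrow> nat)"
      "\<And>\<epsilon>. \<epsilon> > 0 \<Longrightarrow> \<exists>N. \<forall>i\<ge>N. \<forall>j\<ge>N. \<forall>x\<in>D. norm (?A m (s (r i)) x - ?A m (s (r j)) x) < \<epsilon>"
      using ball_avg_uniformly_Cauchy_subseq[of "\<lambda>k. \<phi> (s k)" D R "(1/2)^m" e, OF \<phi> R(2,1) _ e E] by auto
    then show "\<exists>r. strict_mono r \<and> P m (s \<circ> r)" by (auto simp: P_def)
  qed
  \<comment> \<open>The construction yields \<open>P m\<close> only for the diagonal sequence from
    index \<open>Suc m\<close> on; a Cauchy property is insensitive to the terms before.\<close>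
  have Pd: "P m diagseq" for m
  proof -
    have "P m (diagseq \<circ> ((+) (Suc m)))"
    proof (rule diagseq_holds)
      fix r s :: "nat \<Rightarrow> nat" and n assume r: "strict_mono r" and s: "P n s"
      show "P n (s \<circ> r)" unfolding P_def
      proof (intro allI impI)
        fix \<epsilon> :: real assume "\<epsilon> > 0"
        then obtain N where N: "\<forall>i\<ge>N. \<forall>j\<ge>N. \<forall>x\<in>D. norm (?A n (s i) x - ?A n (s j) x) < \<epsilon>"
          using s unfolding P_def by blast
        show "\<exists>N. \<forall>i\<ge>N. \<forall>j\<ge>N. \<forall>x\<in>D. norm (?A n ((s \<circ> r) i) x - ?A n ((s \<circ> r) j) x) < \<epsilon>"
          using N seq_suble[OF r] by (intro exI[of _ N]) (auto intro: order_trans)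
      qed
    qed
    from P_def[THEN iffD1, OF this]
    have Pm: "\<forall>\<epsilon>>0. \<exists>N. \<forall>i\<ge>N. \<forall>j\<ge>N. \<forall>x\<in>D. norm (?A m (diagseq (Suc m + i)) x - ?A m (diagseq (Suc m + j)) x) < \<epsilon>"
      by (simp only: o_def)
    show ?thesis
    proof (rule P_def[THEN iffD2], intro allI impI)
      fix \<epsilon> :: real assume "\<epsilon> > 0"
      then obtain N where N: "\<forall>i\<ge>N. \<forall>j\<ge>N. \<forall>x\<in>D. norm (?A m (diagseq (Suc m + i)) x - ?A m (diagseq (Suc m + j)) x) < \<epsilon>"
        using Pm by blast
      show "\<exists>N. \<forall>i\<ge>N. \<forall>j\<ge>N. \<forall>x\<in>D. norm (?A m (diagseq i) x - ?A m (diagseq j) x) < \<epsilon>"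
      proof (intro exI[of _ "Suc m + N"] allI impI ballI)
        fix i j x assume ij: "Suc m + N \<le> i" "Suc m + N \<le> j" and "x \<in> D"
        then have "i - Suc m \<ge> N" "j - Suc m \<ge> N" "Suc m + (i - Suc m) = i" "Suc m + (j - Suc m) = j" by auto
        with N \<open>x \<in> D\<close> show "norm (?A m (diagseq i) x - ?A m (diagseq j) x) < \<epsilon>" by metis
      qed
    qed
  qed
  show ?thesis
  proof (rule that[OF subseq_diagseq])
    fix \<epsilon> :: real assume \<epsilon>: "\<epsilon> > 0"
    define V where "V = measure (lebesgue_on D) (space (lebesgue_on D)) powr (1 / p)"
    have V: "V \<ge> 0" by (simp add: V_def)
    have "(\<lambda>m. C * \<rho> ^ m * e) \<longlonglongrightarrow> C * 0 * e"
      using C by (intro tendsto_intros LIMSEQ_power_zero) auto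
    then have "\<forall>\<^sub>F m in sequentially. C * \<rho> ^ m * e < \<epsilon> / 3" using \<epsilon> by (intro order_tendstoD(2)) auto
    then obtain m where m: "C * \<rho> ^ m * e < \<epsilon> / 3" by (auto simp: eventually_sequentially)
    \<comment> \<open>\<open>V\<close> is the price of passing from uniform closeness to the L^p
      norm over \<open>D\<close>; \<open>V + 1\<close> keeps the divisor positive.\<close>
    define \<delta> where "\<delta> = \<epsilon> / 3 / (V + 1)"
    have \<delta>: "\<delta> > 0" "\<delta> * V \<le> \<epsilon> / 3" using \<epsilon> V by (auto simp: \<delta>_def field_simps)
    obtain N where N: "\<forall>i\<ge>N. \<forall>j\<ge>N. \<forall>x\<in>D. norm (?A m (diagseq i) x - ?A m (diagseq j) x) < \<delta>"
      using Pd[of m, THEN P_def[THEN iffD1]] \<delta>(1) by blast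
    show "\<exists>N. \<forall>i\<ge>N. \<forall>j\<ge>N. Lp_norm (ennreal p) (lebesgue_on D) (\<lambda>x. \<phi> (diagseq i) x - \<phi> (diagseq j) x) \<le> ennreal \<epsilon>"
    proof (intro exI[of _ N] allI impI)
      fix i j assume ij: "i \<ge> N" "j \<ge> N"
      let ?L = "Lp_norm (ennreal p) (lebesgue_on D)"
      have mm: "\<phi> k \<in> borel_measurable (lebesgue_on D)" "?A m k \<in> borel_measurable (lebesgue_on D)" for k
        using test_functions_borel_measurable[OF \<phi>] ball_avg_measurable[OF \<phi> _ e E]
        by (auto intro: borel_measurable_lebesgue_on)
      have a: "?L (\<lambda>x. \<phi> k x - ?A m k x) \<le> ennreal (\<epsilon> / 3)" for k
      proof -
        have "?L (\<lambda>x. \<phi> k x - ?A m k x) \<le> Lp_norm (ennreal p) lborel (\<lambda>x. \<phi> k x - ?A m k x)"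
          using p by (intro Lp_norm_lebesgue_on_le Dl) auto
        also have "\<dots> \<le> ennreal (C * \<rho> ^ m * e)" by (rule C(4)[rule_format, OF \<phi> e E])
        also have "\<dots> \<le> ennreal (\<epsilon> / 3)" using m by (intro ennreal_leI) auto
        finally show ?thesis .
      qed
      have b: "?L (\<lambda>x. ?A m (diagseq i) x - ?A m (diagseq j) x) \<le> ennreal (\<epsilon> / 3)"
      proof -
        have "?L (\<lambda>x. ?A m (diagseq i) x - ?A m (diagseq j) x) \<le> ennreal (\<delta> * V)"
          unfolding V_def using N ij p \<delta> by (intro Lp_norm_bounded_le[OF fin]) (auto intro: less_imp_le)
        also have "\<dots> \<le> ennreal (\<epsilon> / 3)" using \<delta> by (intro ennreal_leI)
        finally show ?thesis .
      qed
      have "?L (\<lambda>x. \<phi> (diagseq i) x - \<phi> (diagseq j) x) \<le> ?L (\<lambda>x. \<phi> (diagseq i) x - ?A m (diagseq i) x) + ?L (\<lambda>x. ?A m (diagseq i) x - \<phi> (diagseq j) x)"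
        using mm p by (intro Lp_norm_triangle_diff) auto
      also have "\<dots> \<le> ?L (\<lambda>x. \<phi> (diagseq i) x - ?A m (diagseq i) x) + (?L (\<lambda>x. ?A m (diagseq i) x - ?A m (diagseq j) x) + ?L (\<lambda>x. ?A m (diagseq j) x - \<phi> (diagseq j) x))"
        using mm p by (intro add_left_mono Lp_norm_triangle_diff) auto
      also have "\<dots> \<le> ennreal (\<epsilon> / 3) + (ennreal (\<epsilon> / 3) + ennreal (\<epsilon> / 3))"
        using a[of "diagseq j"] by (intro add_mono a b) (simp add: Lp_norm_minus_commute)
      also have "\<dots> = ennreal \<epsilon>" using \<epsilon> by (simp add: ennreal_plus[symmetric] del: ennreal_plus)
      finally show "?L (\<lambda>x. \<phi> (diagseq i) x - \<phi> (diagseq j) x) \<le> ennreal \<epsilon>" .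
    qed
  qed
qed

section \<open>The closure of the test functions\<close>

lemma Lp_finite_imp_integrable:
  fixes f :: "'a \<Rightarrow> 'b::{second_countable_topology,banach}"
  assumes "finite_measure M" "p \<ge> 1" "f \<in> borel_measurable M" "Lp_norm (ennreal p) M f < \<infinity>"
  shows "integrable M f"
proof -
  obtain C :: real where C: "\<forall>f :: 'a \<Rightarrow> 'b. f \<in> borel_measurable M \<longrightarrow>
     (\<integral>\<^sup>+ x. ennreal (norm (f x)) \<partial>M) \<le> ennreal C * Lp_norm (ennreal p) M f"
    using Lp_norm_1_le[OF assms(1,2), where 'b='b] by blast
  have "(\<integral>\<^sup>+ x. ennreal (norm (f x)) \<partial>M) \<le> ennreal C * Lp_norm (ennreal p) M f" using C assms(3) by blast
  also have "\<dots> < \<infinity>" using assms(4) by (simp add: ennreal_mult_less_top)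
  finally show ?thesis using assms(3) by (simp add: integrable_iff_bounded)
qed

lemma Lp_tendsto_imp_L1_tendsto:
  fixes f :: "nat \<Rightarrow> 'a \<Rightarrow> 'b::{second_countable_topology,banach}"
  assumes "finite_measure M" "p \<ge> 1" "\<And>k. f k \<in> borel_measurable M"
    and lim: "(\<lambda>k. Lp_norm (ennreal p) M (f k)) \<longlonglongrightarrow> 0"
  shows "(\<lambda>k. \<integral>\<^sup>+ x. ennreal (norm (f k x)) \<partial>M) \<longlonglongrightarrow> 0"
proof -
  obtain C :: real where C: "\<forall>f :: 'a \<Rightarrow> 'b. f \<in> borel_measurable M \<longrightarrow>
     (\<integral>\<^sup>+ x. ennreal (norm (f x)) \<partial>M) \<le> ennreal C * Lp_norm (ennreal p) M f"
    using Lp_norm_1_le[OF assms(1,2), where 'b='b] by blast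
  have l: "(\<lambda>k. ennreal C * Lp_norm (ennreal p) M (f k)) \<longlonglongrightarrow> 0"
    using ennreal_tendsto_cmult[OF _ lim, of "ennreal C"] by simp
  show ?thesis
    by (rule tendsto_sandwich[OF _ _ tendsto_const l]) (use C assms(3) in auto)
qed

text \<open>On a finite measure L^p convergence gives L^1 convergence, and the factor
  \<open>\<psi>\<close> is bounded. This takes both sides of the weak gradient identity to the
  limit.\<close>

lemma Lp_tendsto_imp_integral_tendsto:
  fixes f :: "nat \<Rightarrow> 'a \<Rightarrow> complex"
  assumes fin: "finite_measure M" and p: "p \<ge> 1"
    and m[measurable]: "\<And>k. f k \<in> borel_measurable M" "g \<in> borel_measurable M" "\<psi> \<in> borel_measurable M"
    and \<psi>: "\<And>x. norm (\<psi> x) \<le> B"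
    and f: "\<And>k. Lp_norm (ennreal p) M (f k) < \<infinity>" and g: "Lp_norm (ennreal p) M g < \<infinity>"
    and lim: "(\<lambda>k. Lp_norm (ennreal p) M (\<lambda>x. f k x - g x)) \<longlonglongrightarrow> 0"
  shows "(\<lambda>k. LINT x|M. f k x * \<psi> x) \<longlonglongrightarrow> (LINT x|M. g x * \<psi> x)"
proof (rule tendsto_L1_int)
  have i: "integrable M (\<lambda>x. h x * \<psi> x)" if "h \<in> borel_measurable M" "Lp_norm (ennreal p) M h < \<infinity>" for h :: "'a \<Rightarrow> complex"
  proof (rule Bochner_Integration.integrable_bound)
    show "integrable M (\<lambda>x. B *\<^sub>R h x)"
      by (intro integrable_scaleR_right Lp_finite_imp_integrable[OF fin p that])
    have "norm (h x * \<psi> x) \<le> norm (B *\<^sub>R h x)" for x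
    proof -
      have "norm (h x * \<psi> x) \<le> norm (h x) * B" unfolding norm_mult by (intro mult_left_mono \<psi>) simp
      also have "\<dots> \<le> norm (B *\<^sub>R h x)" by (simp add: mult.commute mult_right_mono)
      finally show ?thesis .
    qed
    then show "AE x in M. norm (h x * \<psi> x) \<le> norm (B *\<^sub>R h x)" by simp
    show "(\<lambda>x. h x * \<psi> x) \<in> borel_measurable M" using that(1) by measurable
  qed
  show "\<And>k. integrable M (\<lambda>x. f k x * \<psi> x)" "integrable M (\<lambda>x. g x * \<psi> x)"
    using i[OF m(1) f] i[OF m(2) g] .
  have L1: "(\<lambda>k. \<integral>\<^sup>+ x. ennreal (norm (f k x - g x)) \<partial>M) \<longlonglongrightarrow> 0"
    by (rule Lp_tendsto_imp_L1_tendsto[OF fin p _ lim]) measurable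
  have l: "(\<lambda>k. ennreal B * (\<integral>\<^sup>+ x. ennreal (norm (f k x - g x)) \<partial>M)) \<longlonglongrightarrow> 0"
    using ennreal_tendsto_cmult[OF _ L1, of "ennreal B"] by simp
  have B0: "B \<ge> 0" using \<psi>[of undefined] norm_ge_zero order_trans by blast
  have "(\<integral>\<^sup>+ x. ennreal (norm (f k x * \<psi> x - g x * \<psi> x)) \<partial>M) \<le> ennreal B * (\<integral>\<^sup>+ x. ennreal (norm (f k x - g x)) \<partial>M)" for k
  proof -
    have "(\<integral>\<^sup>+ x. ennreal (norm (f k x * \<psi> x - g x * \<psi> x)) \<partial>M) \<le> (\<integral>\<^sup>+ x. ennreal B * ennreal (norm (f k x - g x)) \<partial>M)"
    proof (intro nn_integral_mono)
      fix x
      have "norm (f k x * \<psi> x - g x * \<psi> x) = norm (f k x - g x) * norm (\<psi> x)"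
        by (simp flip: norm_mult left_diff_distrib)
      also have "\<dots> \<le> norm (f k x - g x) * B" by (intro mult_left_mono \<psi>) simp
      finally have "ennreal (norm (f k x * \<psi> x - g x * \<psi> x)) \<le> ennreal (B * norm (f k x - g x))"
        by (intro ennreal_leI) (simp add: mult.commute)
      then show "ennreal (norm (f k x * \<psi> x - g x * \<psi> x)) \<le> ennreal B * ennreal (norm (f k x - g x))"
        using B0 by (simp add: ennreal_mult)
    qed
    also have "\<dots> = ennreal B * (\<integral>\<^sup>+ x. ennreal (norm (f k x - g x)) \<partial>M)" by (intro nn_integral_cmult) measurable
    finally show ?thesis .
  qed
  then show "(\<lambda>k. \<integral>\<^sup>+ x. ennreal (norm (f k x * \<psi> x - g x * \<psi> x)) \<partial>M) \<longlonglongrightarrow> 0"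
    by (intro tendsto_sandwich[OF _ _ tendsto_const l]) auto
qed

lemma integrable_imp_locally_integrable:
  fixes f :: "real^'n::finite \<Rightarrow> 'b::euclidean_space"
  assumes "D \<in> sets lebesgue" "integrable (lebesgue_on D) f"
  shows "locally_integrable D f"
  unfolding locally_integrable_def
proof (intro allI impI, elim conjE)
  fix K assume K: "compact K" "K \<subseteq> D"
  have "set_integrable lebesgue D f" using assms by (simp add: set_integrable_def integrable_restrict_space)
  then show "f absolutely_integrable_on K"
    by (rule set_integrable_subset) (use K in \<open>auto simp: compact_imp_closed\<close>)
qed

lemma nn_integral_lebesgue_on_mono:
  assumes "K \<subseteq> D" "K \<in> sets lebesgue" "D \<in> sets lebesgue"
  shows "(\<integral>\<^sup>+ x. f x \<partial>lebesgue_on K) \<le> (\<integral>\<^sup>+ x. f x \<partial>lebesgue_on D)"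
proof -
  have "(\<integral>\<^sup>+ x. f x \<partial>lebesgue_on K) = (\<integral>\<^sup>+ x. f x * indicator K x \<partial>lebesgue)"
    using assms by (intro nn_integral_restrict_space) simp
  also have "\<dots> \<le> (\<integral>\<^sup>+ x. f x * indicator D x \<partial>lebesgue)"
    using assms(1) by (intro nn_integral_mono) (auto simp: indicator_def)
  also have "\<dots> = (\<integral>\<^sup>+ x. f x \<partial>lebesgue_on D)"
    using assms by (intro nn_integral_restrict_space[symmetric]) simp
  finally show ?thesis .
qed

lemma Lp_norm_1_eq:
  fixes f :: "'a \<Rightarrow> 'b::real_normed_vector"
  shows "Lp_norm 1 M f = (\<integral>\<^sup>+ x. ennreal (norm (f x)) \<partial>M)"
proof -
  have e: "enn2real 1 = 1" by (metis enn2real_ennreal ennreal_1 zero_le_one)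
  show ?thesis by (auto simp: Lp_norm_def Let_def e less_top)
qed

lemma Lp_norm_nth_le:
  fixes G :: "'a \<Rightarrow> 'b::real_normed_vector^'n::finite"
  assumes "p > 0"
  shows "Lp_norm (ennreal p) M (\<lambda>x. G x $ i) \<le> Lp_norm (ennreal p) M G"
  using assms by (intro Lp_norm_mono_AE AE_I2) (rule Finite_Cartesian_Product.norm_nth_le)

text \<open>\<open>p\<close> is the exponent 2q of the theorem, and \<open>gain_pos\<close> is the
  form in which the restriction on r enters the analysis.\<close>

locale subcritical_domain =
  fixes D :: "(real^'n::finite) set" and p :: real
  assumes open_D: "open D" and bounded_D: "bounded D"
    and p_ge_2: "p \<ge> 2" and gain_pos: "sobolev_gain TYPE('n) p > 0"
begin

abbreviation "M \<equiv> lebesgue_on D"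

lemma p_ge_1: "p \<ge> 1" and p_pos: "p > 0"
  using p_ge_2 by auto

lemma D_lebesgue: "D \<in> sets lebesgue"
  using open_D by auto

lemma finite_M: "finite_measure M"
  by (rule bounded_lebesgue_on_finite[OF bounded_D D_lebesgue])

lemma test_measurable: "\<phi> \<in> test_functions D \<Longrightarrow> \<phi> \<in> borel_measurable M"
  by (intro borel_measurable_lebesgue_on test_functions_borel_measurable)

lemma gradient_measurable: "\<phi> \<in> test_functions D \<Longrightarrow> gradient \<phi> \<in> borel_measurable M"
  by (intro borel_measurable_lebesgue_on gradient_borel_measurable)

lemma Lp_norm_bounded_finite:
  fixes f :: "real^'n \<Rightarrow> 'b::real_normed_vector"
  assumes "s > 0" "\<And>x. norm (f x) \<le> B"
  shows "Lp_norm (ennreal s) M f < \<infinity>"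
proof -
  have "B \<ge> 0" using assms(2)[of 0] norm_ge_zero order_trans by blast
  then have "Lp_norm (ennreal s) M f \<le> ennreal (B * measure M (space M) powr (1 / s))"
    using assms by (intro Lp_norm_bounded_le finite_M) auto
  also have "\<dots> < \<infinity>" by simp
  finally show ?thesis .
qed

lemma Lp_norm_test_finite: "\<phi> \<in> test_functions D \<Longrightarrow> s > 0 \<Longrightarrow> Lp_norm (ennreal s) M \<phi> < \<infinity>"
  using test_functions_bounded[of \<phi> D] Lp_norm_bounded_finite by blast

lemma Lp_norm_gradient_finite: "\<phi> \<in> test_functions D \<Longrightarrow> s > 0 \<Longrightarrow> Lp_norm (ennreal s) M (gradient \<phi>) < \<infinity>"
  using gradient_bounded[of \<phi> D] Lp_norm_bounded_finite by blast

text \<open>Differs from membership in \<open>W012\<close> in that the sequence is named, the values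
  converge in L^p over all of \<open>D\<close>, and the gradient is a parameter. Norms of test
  functions and their gradients then converge to those of \<open>u\<close> and
  \<open>G\<close>.\<close>

definition approximates :: "(nat \<Rightarrow> real^'n \<Rightarrow> complex) \<Rightarrow> (real^'n \<Rightarrow> complex) \<Rightarrow> (real^'n \<Rightarrow> complex^'n) \<Rightarrow> bool" where
  "approximates \<phi> u G \<longleftrightarrow> u \<in> borel_measurable M \<and> G \<in> borel_measurable M \<and> (\<forall>k. \<phi> k \<in> test_functions D) \<and>
     (\<lambda>k. Lp_norm (ennreal 2) M (\<lambda>x. gradient (\<phi> k) x - G x)) \<longlonglongrightarrow> 0 \<and>
     (\<lambda>k. Lp_norm (ennreal p) M (\<lambda>x. \<phi> k x - u x)) \<longlonglongrightarrow> 0"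

lemma tendsto_0_imp_finite:
  fixes f :: "nat \<Rightarrow> ennreal"
  assumes "f \<longlonglongrightarrow> 0" shows "\<exists>k. f k < \<infinity>"
proof -
  have "\<forall>\<^sub>F k in sequentially. f k < \<infinity>" using assms by (rule order_tendstoD) simp
  then show ?thesis by (auto simp: eventually_sequentially)
qed

lemma approximates_finite:
  assumes "approximates \<phi> u G"
  shows "Lp_norm (ennreal 2) M G < \<infinity>" "Lp_norm (ennreal p) M u < \<infinity>"
proof -
  note a = assms[unfolded approximates_def]
  obtain k where k: "Lp_norm (ennreal 2) M (\<lambda>x. gradient (\<phi> k) x - G x) < \<infinity>" using a tendsto_0_imp_finite by blast
  have "Lp_norm (ennreal 2) M G \<le> Lp_norm (ennreal 2) M (gradient (\<phi> k)) + Lp_norm (ennreal 2) M (\<lambda>x. G x - gradient (\<phi> k) x)"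
    using a gradient_measurable[of "\<phi> k"] by (intro Lp_norm_le_add_diff) auto
  also have "\<dots> < \<infinity>" using k a Lp_norm_gradient_finite[of "\<phi> k" 2] by (simp add: Lp_norm_minus_commute)
  finally show "Lp_norm (ennreal 2) M G < \<infinity>" .
  obtain l where l: "Lp_norm (ennreal p) M (\<lambda>x. \<phi> l x - u x) < \<infinity>" using a tendsto_0_imp_finite by blast
  have "Lp_norm (ennreal p) M u \<le> Lp_norm (ennreal p) M (\<phi> l) + Lp_norm (ennreal p) M (\<lambda>x. u x - \<phi> l x)"
    using a p_ge_1 test_measurable[of "\<phi> l"] by (intro Lp_norm_le_add_diff) auto
  also have "\<dots> < \<infinity>" using l a Lp_norm_test_finite[of "\<phi> l" p] p_pos by (simp add: Lp_norm_minus_commute)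
  finally show "Lp_norm (ennreal p) M u < \<infinity>" .
qed

lemma approximates_tendsto:
  assumes "approximates \<phi> u G"
  shows "(\<lambda>k. Lp_norm (ennreal 2) M (gradient (\<phi> k))) \<longlonglongrightarrow> Lp_norm (ennreal 2) M G"
    "(\<lambda>k. Lp_norm (ennreal p) M (\<phi> k)) \<longlonglongrightarrow> Lp_norm (ennreal p) M u"
proof -
  note a = assms[unfolded approximates_def]
  have m: "\<phi> k \<in> borel_measurable M" "gradient (\<phi> k) \<in> borel_measurable M" for k
    using a test_measurable gradient_measurable by blast+
  show "(\<lambda>k. Lp_norm (ennreal 2) M (gradient (\<phi> k))) \<longlonglongrightarrow> Lp_norm (ennreal 2) M G"
    by (rule Lp_norm_tendsto[OF m(2) _ _ _ approximates_finite(1)[OF assms]]) (use a in auto)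
  show "(\<lambda>k. Lp_norm (ennreal p) M (\<phi> k)) \<longlonglongrightarrow> Lp_norm (ennreal p) M u"
    by (rule Lp_norm_tendsto[OF m(1) _ p_ge_1 _ approximates_finite(2)[OF assms]]) (use a in auto)
qed

text \<open>The identity holds for each \<open>\<phi> k\<close> by integration by parts, and both of
  its sides converge because \<open>\<psi>\<close> and its partial derivatives are bounded.\<close>

lemma approximates_is_weak_gradient:
  assumes "approximates \<phi> u G"
  shows "is_weak_gradient D u G"
  unfolding is_weak_gradient_def
proof (intro conjI ballI allI)
  note a = assms[unfolded approximates_def]
  note fin = approximates_finite[OF assms]
  have m: "u \<in> borel_measurable M" "G \<in> borel_measurable M" "\<And>k. \<phi> k \<in> test_functions D" using a by auto
  show "locally_integrable D u"
    by (intro integrable_imp_locally_integrable D_lebesgue Lp_finite_imp_integrable[OF finite_M p_ge_1] m fin)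
  show "locally_integrable D G"
    by (intro integrable_imp_locally_integrable D_lebesgue Lp_finite_imp_integrable[OF finite_M _ _ fin(1)] m) simp
  fix \<psi> i assume \<psi>: "\<psi> \<in> test_functions D"
  obtain B where B: "\<And>x. norm (\<psi> x) \<le> B" using test_functions_bounded[OF \<psi>] by blast
  obtain B' where B': "\<And>x. norm (partial_deriv i \<psi> x) \<le> B'"
    using test_functions_bounded[OF test_functions_partial_deriv[OF \<psi>]] by blast
  have l1: "(\<lambda>k. LINT x|M. \<phi> k x * partial_deriv i \<psi> x) \<longlonglongrightarrow> (LINT x|M. u x * partial_deriv i \<psi> x)"
    by (rule Lp_tendsto_imp_integral_tendsto[OF finite_M p_ge_1 test_measurable[OF m(3)] m(1)
        test_measurable[OF test_functions_partial_deriv[OF \<psi>]] B' Lp_norm_test_finite[OF m(3) p_pos] fin(2)])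
      (use a in auto)
  have nth: "(\<lambda>x. F x $ i) \<in> borel_measurable M" if "F \<in> borel_measurable M" for F :: "_ \<Rightarrow> complex^'n"
    using that by (rule measurable_compose) (intro borel_measurable_continuous_onI continuous_intros)
  have l2: "(\<lambda>k. LINT x|M. gradient (\<phi> k) x $ i * \<psi> x) \<longlonglongrightarrow> (LINT x|M. G x $ i * \<psi> x)"
  proof (rule Lp_tendsto_imp_integral_tendsto[OF finite_M _ nth[OF gradient_measurable[OF m(3)]] nth[OF m(2)] test_measurable[OF \<psi>] B])
    show "(1::real) \<le> 2" by simp
    show "Lp_norm (ennreal 2) M (\<lambda>x. gradient (\<phi> k) x $ i) < \<infinity>" for k
      by (rule le_less_trans[OF Lp_norm_nth_le Lp_norm_gradient_finite[OF m(3)]]) simp_all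
    show "Lp_norm (ennreal 2) M (\<lambda>x. G x $ i) < \<infinity>"
      by (rule le_less_trans[OF Lp_norm_nth_le fin(1)]) simp
    have l: "(\<lambda>k. Lp_norm (ennreal 2) M (\<lambda>x. gradient (\<phi> k) x - G x)) \<longlonglongrightarrow> 0" using a by auto
    have "Lp_norm (ennreal 2) M (\<lambda>x. gradient (\<phi> k) x $ i - G x $ i) \<le> Lp_norm (ennreal 2) M (\<lambda>x. gradient (\<phi> k) x - G x)" for k
      using Lp_norm_nth_le[of 2 M "\<lambda>x. gradient (\<phi> k) x - G x" i] by simp
    then show "(\<lambda>k. Lp_norm (ennreal 2) M (\<lambda>x. gradient (\<phi> k) x $ i - G x $ i)) \<longlonglongrightarrow> 0"
      by (intro tendsto_sandwich[OF _ _ tendsto_const l]) auto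
  qed
  have "(LINT x|M. \<phi> k x * partial_deriv i \<psi> x) = - (LINT x|M. gradient (\<phi> k) x $ i * \<psi> x)" for k
    using is_weak_gradient_test[OF open_D m(3)] \<psi> unfolding is_weak_gradient_def by blast
  with l1 have "(\<lambda>k. - (LINT x|M. gradient (\<phi> k) x $ i * \<psi> x)) \<longlonglongrightarrow> (LINT x|M. u x * partial_deriv i \<psi> x)" by (simp only:)
  from LIMSEQ_unique[OF this tendsto_minus[OF l2]]
  show "(LINT x|M. u x * partial_deriv i \<psi> x) = - (LINT x|M. G x $ i * \<psi> x)" .
qed

lemma weak_gradient_eq:
  assumes "is_weak_gradient D u G"
  shows "is_weak_gradient D u (weak_gradient D u)" "AE x in M. weak_gradient D u x = G x"
proof -
  show "is_weak_gradient D u (weak_gradient D u)" unfolding weak_gradient_def by (rule someI[of "is_weak_gradient D u", OF assms])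
  from weak_gradient_unique[OF open_D this assms] show "AE x in M. weak_gradient D u x = G x" .
qed

lemma weak_gradient_measurable:
  assumes "is_weak_gradient D u G"
  shows "weak_gradient D u \<in> borel_measurable M" "u \<in> borel_measurable M"
  using weak_gradient_eq(1)[OF assms] locally_integrable_borel_measurable[OF open_D]
  unfolding is_weak_gradient_def by auto

text \<open>The chosen \<open>weak_gradient\<close> agrees with \<open>G\<close> almost everywhere,
  which the norms cannot detect, and convergence in L^p over the bounded set \<open>D\<close>
  implies convergence in L^1 on its compact subsets.\<close>

lemma approximates_W012:
  assumes "approximates \<phi> u G"
  shows "u \<in> W012 D"
proof -
  note a = assms[unfolded approximates_def]
  have wg: "is_weak_gradient D u G" by (rule approximates_is_weak_gradient[OF assms])
  have "(\<lambda>k. Lp_norm 2 M (\<lambda>x. gradient (\<phi> k) x - weak_gradient D u x)) \<longlonglongrightarrow> 0"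
  proof -
    have "Lp_norm (ennreal 2) M (\<lambda>x. gradient (\<phi> k) x - weak_gradient D u x) = Lp_norm (ennreal 2) M (\<lambda>x. gradient (\<phi> k) x - G x)" for k
      by (rule Lp_norm_cong_AE) (use weak_gradient_eq(2)[OF wg] in auto)
    then show ?thesis using a by simp
  qed
  moreover have "(\<lambda>k. Lp_norm 1 (lebesgue_on K) (\<lambda>x. \<phi> k x - u x)) \<longlonglongrightarrow> 0" if K: "compact K" "K \<subseteq> D" for K
  proof -
    have Kl: "K \<in> sets lebesgue" using K by (simp add: compact_imp_closed)
    have l: "(\<lambda>k. \<integral>\<^sup>+ x. ennreal (norm (\<phi> k x - u x)) \<partial>M) \<longlonglongrightarrow> 0"
      by (rule Lp_tendsto_imp_L1_tendsto[OF finite_M p_ge_1]) (use a test_measurable in auto)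
    show ?thesis unfolding Lp_norm_1_eq
      by (rule tendsto_sandwich[OF _ _ tendsto_const l])
        (use nn_integral_lebesgue_on_mono[OF K(2) Kl D_lebesgue] in auto)
  qed
  ultimately show ?thesis using wg a unfolding W012_def by blast
qed

lemma test_approximates:
  assumes "\<phi> \<in> test_functions D"
  shows "approximates (\<lambda>_. \<phi>) \<phi> (gradient \<phi>)"
proof -
  have "Lp_norm (ennreal 2) M (\<lambda>x. 0 :: complex^'n) = 0"
    using Lp_norm_le_iff[of 2 0 M "\<lambda>x. 0 :: complex^'n"] by simp
  moreover have "Lp_norm (ennreal p) M (\<lambda>x. 0 :: complex) = 0"
    using Lp_norm_le_iff[of p 0 M "\<lambda>x. 0 :: complex"] p_pos by simp
  ultimately show ?thesis
    using assms p_pos test_measurable gradient_measurable by (simp add: approximates_def)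
qed

text \<open>Differences of test functions are test functions, so the Sobolev inequality applies to
  them directly.\<close>

lemma L2_Cauchy_imp_Lp_Cauchy:
  assumes \<phi>: "\<And>k. \<phi> k \<in> test_functions D"
    and C: "\<And>e. e > 0 \<Longrightarrow> \<exists>N. \<forall>m\<ge>N. \<forall>n\<ge>N. Lp_norm (ennreal 2) M (\<lambda>x. gradient (\<phi> m) x - gradient (\<phi> n) x) \<le> ennreal e"
    and e: "e > 0"
  shows "\<exists>N. \<forall>m\<ge>N. \<forall>n\<ge>N. Lp_norm (ennreal p) M (\<lambda>x. \<phi> m x - \<phi> n x) \<le> ennreal e"
proof -
  obtain S where S: "S > 0" "\<And>\<phi> e. \<phi> \<in> test_functions D \<Longrightarrow> e \<ge> 0 \<Longrightarrow> Lp_norm (ennreal 2) M (gradient \<phi>) \<le> ennreal e \<Longrightarrow>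
      Lp_norm (ennreal p) M \<phi> \<le> ennreal (S * e)"
    using Sobolev_inequality[OF open_D bounded_D p_ge_2 gain_pos] by metis
  obtain N where N: "\<forall>m\<ge>N. \<forall>n\<ge>N. Lp_norm (ennreal 2) M (\<lambda>x. gradient (\<phi> m) x - gradient (\<phi> n) x) \<le> ennreal (e / S)"
    using C[of "e / S"] S(1) e by auto
  have "Lp_norm (ennreal p) M (\<lambda>x. \<phi> m x - \<phi> n x) \<le> ennreal e" if "m \<ge> N" "n \<ge> N" for m n
  proof -
    have "gradient (\<lambda>x. \<phi> m x - \<phi> n x) = (\<lambda>x. gradient (\<phi> m) x - gradient (\<phi> n) x)"
      by (rule ext) (rule gradient_diff[OF \<phi> \<phi>])
    then have "Lp_norm (ennreal 2) M (gradient (\<lambda>x. \<phi> m x - \<phi> n x)) \<le> ennreal (e / S)" using N that by simp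
    from S(2)[OF test_functions_diff[OF \<phi> \<phi>] _ this] show ?thesis using S(1) e by simp
  qed
  then show ?thesis by blast
qed

lemma Cauchy_imp_approximates:
  assumes \<phi>: "\<And>k. \<phi> k \<in> test_functions D"
    and C: "\<And>e. e > 0 \<Longrightarrow> \<exists>N. \<forall>m\<ge>N. \<forall>n\<ge>N. Lp_norm (ennreal 2) M (\<lambda>x. gradient (\<phi> m) x - gradient (\<phi> n) x) \<le> ennreal e"
  obtains u G where "approximates \<phi> u G"
proof -
  obtain G where G: "G \<in> borel_measurable M" "(\<lambda>k. Lp_norm (ennreal 2) M (\<lambda>x. gradient (\<phi> k) x - G x)) \<longlonglongrightarrow> 0"
    by (rule Lp_norm_complete[OF gradient_measurable[OF \<phi>] _ C]) simp_all
  obtain u where u: "u \<in> borel_measurable M" "(\<lambda>k. Lp_norm (ennreal p) M (\<lambda>x. \<phi> k x - u x)) \<longlonglongrightarrow> 0"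
    by (rule Lp_norm_complete[OF test_measurable[OF \<phi>] p_ge_1 L2_Cauchy_imp_Lp_Cauchy[OF \<phi> C]])
  show ?thesis using that[of u G] G u \<phi> by (simp add: approximates_def)
qed

lemma Lp_tendsto_imp_Cauchy:
  fixes f :: "nat \<Rightarrow> 'a \<Rightarrow> 'b::{second_countable_topology,real_normed_vector}"
  assumes [measurable]: "\<And>k. f k \<in> borel_measurable N" "g \<in> borel_measurable N" and s: "s \<ge> 1"
    and lim: "(\<lambda>k. Lp_norm (ennreal s) N (\<lambda>x. f k x - g x)) \<longlonglongrightarrow> 0" and e: "e > 0"
  shows "\<exists>K. \<forall>m\<ge>K. \<forall>n\<ge>K. Lp_norm (ennreal s) N (\<lambda>x. f m x - f n x) \<le> ennreal e"
proof -
  obtain K where K: "\<And>k. k \<ge> K \<Longrightarrow> Lp_norm (ennreal s) N (\<lambda>x. f k x - g x) \<le> ennreal (e / 2)"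
    using tendsto_ennreal_zeroD[OF lim, of "e / 2"] e by (auto simp: eventually_sequentially)
  have "Lp_norm (ennreal s) N (\<lambda>x. f m x - f n x) \<le> ennreal e" if "m \<ge> K" "n \<ge> K" for m n
  proof -
    have "Lp_norm (ennreal s) N (\<lambda>x. f m x - f n x) \<le> Lp_norm (ennreal s) N (\<lambda>x. f m x - g x) + Lp_norm (ennreal s) N (\<lambda>x. g x - f n x)"
      using s by (intro Lp_norm_triangle_diff) auto
    also have "\<dots> \<le> ennreal (e / 2) + ennreal (e / 2)"
      using K[OF that(1)] K[OF that(2)] by (intro add_mono) (auto simp: Lp_norm_minus_commute)
    also have "\<dots> = ennreal e" using e by (simp add: ennreal_plus[symmetric] del: ennreal_plus)
    finally show ?thesis .
  qed
  then show ?thesis by blast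
qed

text \<open>The gradients are Cauchy in L^2, so the Sobolev inequality provides some L^p limit
  \<open>v\<close> of the values. On each compact subset both \<open>u\<close> and \<open>v\<close>
  are L^1 limits of the same sequence, and countably many closed boxes exhaust \<open>D\<close>;
  hence \<open>u\<close> and \<open>v\<close> agree almost everywhere.\<close>

lemma W012_approximates:
  assumes u: "u \<in> W012 D"
  obtains \<phi> where "approximates \<phi> u (weak_gradient D u)"
proof -
  obtain \<phi> G where \<phi>: "\<And>k. \<phi> k \<in> test_functions D" and wg: "is_weak_gradient D u G"
    and l2: "(\<lambda>k. Lp_norm 2 M (\<lambda>x. gradient (\<phi> k) x - weak_gradient D u x)) \<longlonglongrightarrow> 0"
    and l1: "\<And>K. compact K \<Longrightarrow> K \<subseteq> D \<Longrightarrow> (\<lambda>k. Lp_norm 1 (lebesgue_on K) (\<lambda>x. \<phi> k x - u x)) \<longlonglongrightarrow> 0"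
    using u unfolding W012_def by blast
  have m: "weak_gradient D u \<in> borel_measurable M" "u \<in> borel_measurable M"
    by (rule weak_gradient_measurable[OF wg])+
  have l2': "(\<lambda>k. Lp_norm (ennreal 2) M (\<lambda>x. gradient (\<phi> k) x - weak_gradient D u x)) \<longlonglongrightarrow> 0" using l2 by simp
  have "\<exists>N. \<forall>m\<ge>N. \<forall>n\<ge>N. Lp_norm (ennreal 2) M (\<lambda>x. gradient (\<phi> m) x - gradient (\<phi> n) x) \<le> ennreal e" if "e > 0" for e
    by (rule Lp_tendsto_imp_Cauchy[OF gradient_measurable[OF \<phi>] m(1) _ l2' that]) simp
  then obtain v H where v: "approximates \<phi> v H" using Cauchy_imp_approximates[of \<phi>] \<phi> by blast
  have vm: "v \<in> borel_measurable M" and lv: "(\<lambda>k. Lp_norm (ennreal p) M (\<lambda>x. \<phi> k x - v x)) \<longlonglongrightarrow> 0"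
    using v by (auto simp: approximates_def)
  have uv: "AE x in lebesgue. x \<in> K \<longrightarrow> u x = v x" if K: "compact K" "K \<subseteq> D" for K
  proof -
    have Kl: "K \<in> sets lebesgue" using K by (simp add: compact_imp_closed)
    have mK: "f \<in> borel_measurable (lebesgue_on K)" if "f \<in> borel_measurable M" for f :: "_ \<Rightarrow> complex"
      using measurable_restrict_mono[OF that K(2)] .
    have lM: "(\<lambda>k. \<integral>\<^sup>+ x. ennreal (norm (\<phi> k x - v x)) \<partial>M) \<longlonglongrightarrow> 0"
      by (rule Lp_tendsto_imp_L1_tendsto[OF finite_M p_ge_1 _ lv]) (use vm \<phi> test_measurable in auto)
    have lK: "(\<lambda>k. \<integral>\<^sup>+ x. ennreal (norm (\<phi> k x - v x)) \<partial>lebesgue_on K) \<longlonglongrightarrow> 0"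
      by (rule tendsto_sandwich[OF _ _ tendsto_const lM]) (use nn_integral_lebesgue_on_mono[OF K(2) Kl D_lebesgue] in auto)
    have lu: "(\<lambda>k. \<integral>\<^sup>+ x. ennreal (norm (\<phi> k x - u x)) \<partial>lebesgue_on K) \<longlonglongrightarrow> 0"
      using l1[OF K] by (simp add: Lp_norm_1_eq)
    have "(\<integral>\<^sup>+ x. ennreal (norm (u x - v x)) \<partial>lebesgue_on K)
       \<le> (\<integral>\<^sup>+ x. ennreal (norm (\<phi> k x - u x)) \<partial>lebesgue_on K) + (\<integral>\<^sup>+ x. ennreal (norm (\<phi> k x - v x)) \<partial>lebesgue_on K)" for k
    proof -
      note [measurable] = mK[OF m(2)] mK[OF vm] mK[OF test_measurable[OF \<phi>]]
      have "(\<integral>\<^sup>+ x. ennreal (norm (u x - v x)) \<partial>lebesgue_on K) \<le> (\<integral>\<^sup>+ x. ennreal (norm (\<phi> k x - u x)) + ennreal (norm (\<phi> k x - v x)) \<partial>lebesgue_on K)"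
      proof (intro nn_integral_mono)
        fix x
        have "norm (u x - v x) \<le> norm (\<phi> k x - u x) + norm (\<phi> k x - v x)"
          using norm_triangle_ineq4[of "\<phi> k x - v x" "\<phi> k x - u x"] by simp
        then show "ennreal (norm (u x - v x)) \<le> ennreal (norm (\<phi> k x - u x)) + ennreal (norm (\<phi> k x - v x))"
          by (simp add: ennreal_plus[symmetric] del: ennreal_plus)
      qed
      also have "\<dots> = (\<integral>\<^sup>+ x. ennreal (norm (\<phi> k x - u x)) \<partial>lebesgue_on K) + (\<integral>\<^sup>+ x. ennreal (norm (\<phi> k x - v x)) \<partial>lebesgue_on K)"
        by (intro nn_integral_add) measurable
      finally show ?thesis .
    qed
    from tendsto_lowerbound[OF tendsto_add[OF lu lK] always_eventually[OF allI[OF this]]]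
    have z: "(\<integral>\<^sup>+ x. ennreal (norm (u x - v x)) \<partial>lebesgue_on K) = 0" by simp
    have "AE x in lebesgue_on K. u x = v x"
    proof -
      note [measurable] = mK[OF m(2)] mK[OF vm]
      have "AE x in lebesgue_on K. ennreal (norm (u x - v x)) = 0"
        using z by (subst nn_integral_0_iff_AE[symmetric]) auto
      then show ?thesis by (auto elim: eventually_mono simp: ennreal_eq_0_iff)
    qed
    then show ?thesis using Kl by (simp add: AE_restrict_space_iff)
  qed
  obtain C where C: "countable C" "C \<subseteq> Pow D" "\<And>X. X \<in> C \<Longrightarrow> \<exists>a b. X = cbox a b" "\<Union>C = D"
    using open_countable_Union_open_cbox[OF open_D] by metis
  have "AE x in lebesgue. \<forall>X\<in>C. x \<in> X \<longrightarrow> u x = v x"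
  proof (rule AE_ball_countable'[OF _ C(1)])
    fix X assume "X \<in> C"
    then obtain a b where "X = cbox a b" "X \<subseteq> D" using C(2,3) by blast
    then show "AE x in lebesgue. x \<in> X \<longrightarrow> u x = v x" using uv[of X] by auto
  qed
  then have "AE x in lebesgue. x \<in> D \<longrightarrow> u x = v x" using C(4) by (auto elim: eventually_mono)
  then have "AE x in M. u x = v x" using D_lebesgue by (simp add: AE_restrict_space_iff)
  then have "Lp_norm (ennreal p) M (\<lambda>x. \<phi> k x - u x) = Lp_norm (ennreal p) M (\<lambda>x. \<phi> k x - v x)" for k
    by (intro Lp_norm_cong_AE p_pos) auto
  with lv have "(\<lambda>k. Lp_norm (ennreal p) M (\<lambda>x. \<phi> k x - u x)) \<longlonglongrightarrow> 0" by simp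
  then show ?thesis using that[of \<phi>] l2' m \<phi> by (simp add: approximates_def)
qed

end

section \<open>Existence of an extremal\<close>

lemma ennreal_divide_le_iff:
  fixes K a b :: ennreal
  assumes "b \<noteq> 0" "b \<noteq> \<infinity>"
  shows "a / b \<le> K \<longleftrightarrow> a \<le> K * b"
proof -
  obtain b' where b: "b = ennreal b'" "b' > 0"
    using assms by (cases b) (auto simp: less_le)
  show ?thesis
  proof
    assume "a / b \<le> K"
    then have "a / b * b \<le> K * b" by (rule mult_right_mono) simp
    also have "a / b * b = a"
      using b by (cases a) (auto simp: divide_ennreal ennreal_mult[symmetric] ennreal_top_divide ennreal_top_mult)
    finally show "a \<le> K * b" .
  next
    assume "a \<le> K * b"
    then show "a / b \<le> K" using assms by (intro divide_le_posI_ennreal) (auto simp: mult.commute less_le)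
  qed
qed

text \<open>The norms enter as finite reals because the identity will be solved for
  \<open>d\<close>, which needs genuine subtraction.\<close>

lemma L2_norm_parallelogram:
  fixes f g :: "'a \<Rightarrow> 'b::{real_inner,second_countable_topology}"
  assumes [measurable]: "f \<in> borel_measurable N" "g \<in> borel_measurable N"
    and n: "Lp_norm (ennreal 2) N f = ennreal a" "Lp_norm (ennreal 2) N g = ennreal b"
      "Lp_norm (ennreal 2) N (\<lambda>x. f x + g x) = ennreal s" "Lp_norm (ennreal 2) N (\<lambda>x. f x - g x) = ennreal d"
    and nn: "a \<ge> 0" "b \<ge> 0" "s \<ge> 0" "d \<ge> 0"
  shows "s\<^sup>2 + d\<^sup>2 = 2 * a\<^sup>2 + 2 * b\<^sup>2"
proof -
  have i: "(\<integral>\<^sup>+ x. ennreal ((norm (h x))\<^sup>2) \<partial>N) = ennreal (c\<^sup>2)"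
    if "Lp_norm (ennreal 2) N h = ennreal c" "c \<ge> 0" for h :: "'a \<Rightarrow> 'b" and c
    using Lp_norm_eqD[OF that(1)] that(2) by simp
  have pt: "(norm (x + y))\<^sup>2 + (norm (x - y))\<^sup>2 = 2 * (norm x)\<^sup>2 + 2 * (norm y)\<^sup>2" for x y :: 'b
    by (simp add: power2_norm_eq_inner inner_add inner_diff inner_commute)
  have "ennreal (s\<^sup>2 + d\<^sup>2) = (\<integral>\<^sup>+ x. ennreal ((norm (f x + g x))\<^sup>2) \<partial>N) + (\<integral>\<^sup>+ x. ennreal ((norm (f x - g x))\<^sup>2) \<partial>N)"
    using i[OF n(3)] i[OF n(4)] nn by simp
  also have "\<dots> = (\<integral>\<^sup>+ x. ennreal ((norm (f x + g x))\<^sup>2) + ennreal ((norm (f x - g x))\<^sup>2) \<partial>N)"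
    by (intro nn_integral_add[symmetric]) measurable
  also have "\<dots> = (\<integral>\<^sup>+ x. ennreal 2 * ennreal ((norm (f x))\<^sup>2) + ennreal 2 * ennreal ((norm (g x))\<^sup>2) \<partial>N)"
    by (intro nn_integral_cong) (simp add: pt ennreal_plus[symmetric] ennreal_mult[symmetric] del: ennreal_plus ennreal_numeral)
  also have "\<dots> = ennreal 2 * (\<integral>\<^sup>+ x. ennreal ((norm (f x))\<^sup>2) \<partial>N) + ennreal 2 * (\<integral>\<^sup>+ x. ennreal ((norm (g x))\<^sup>2) \<partial>N)"
    by (subst nn_integral_add) (auto simp: nn_integral_cmult)
  also have "\<dots> = ennreal (2 * a\<^sup>2 + 2 * b\<^sup>2)"
    using i[OF n(1)] i[OF n(2)] nn
    by (simp add: ennreal_plus[symmetric] ennreal_mult[symmetric] del: ennreal_plus ennreal_numeral)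
  finally show ?thesis by (subst (asm) ennreal_inj) auto
qed

locale nonempty_subcritical_domain = subcritical_domain +
  assumes D_nonempty: "D \<noteq> {}"
begin

lemma approximates_le:
  assumes "\<And>\<phi>. \<phi> \<in> test_functions D \<Longrightarrow> Lp_norm (ennreal p) M \<phi> \<le> ennreal c * Lp_norm (ennreal 2) M (gradient \<phi>)"
    and a: "approximates \<phi> u G"
  shows "Lp_norm (ennreal p) M u \<le> ennreal c * Lp_norm (ennreal 2) M G"
proof (rule LIMSEQ_le[OF approximates_tendsto(2)[OF a]])
  show "(\<lambda>k. ennreal c * Lp_norm (ennreal 2) M (gradient (\<phi> k))) \<longlonglongrightarrow> ennreal c * Lp_norm (ennreal 2) M G"
    by (rule ennreal_tendsto_cmult[OF _ approximates_tendsto(1)[OF a]]) simp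
  show "\<exists>N. \<forall>k\<ge>N. Lp_norm (ennreal p) M (\<phi> k) \<le> ennreal c * Lp_norm (ennreal 2) M (gradient (\<phi> k))"
    using assms by (auto simp: approximates_def)
qed

lemma test_Sobolev:
  "\<exists>C>0. \<forall>\<phi>\<in>test_functions D. Lp_norm (ennreal p) M \<phi> \<le> ennreal C * Lp_norm (ennreal 2) M (gradient \<phi>)"
proof -
  obtain C where C: "C > 0" "\<And>\<phi> e. \<phi> \<in> test_functions D \<Longrightarrow> e \<ge> 0 \<Longrightarrow> Lp_norm (ennreal 2) M (gradient \<phi>) \<le> ennreal e \<Longrightarrow>
      Lp_norm (ennreal p) M \<phi> \<le> ennreal (C * e)"
    using Sobolev_inequality[OF open_D bounded_D p_ge_2 gain_pos] by metis
  have "Lp_norm (ennreal p) M \<phi> \<le> ennreal C * Lp_norm (ennreal 2) M (gradient \<phi>)" if \<phi>: "\<phi> \<in> test_functions D" for \<phi>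
  proof -
    have "Lp_norm (ennreal 2) M (gradient \<phi>) \<noteq> \<infinity>" using Lp_norm_gradient_finite[OF \<phi>, of 2] by simp
    then obtain e where e: "Lp_norm (ennreal 2) M (gradient \<phi>) = ennreal e" "e \<ge> 0" by (rule ennreal_realE)
    then show ?thesis using C(2)[OF \<phi> e(2)] C(1) by (simp add: ennreal_mult)
  qed
  then show ?thesis using C(1) by blast
qed

lemma nontrivial_iff:
  assumes "approximates \<phi> u G"
  shows "nontrivial D u \<longleftrightarrow> Lp_norm (ennreal p) M u \<noteq> 0"
  using assms Lp_norm_zero_iff[of u M p] p_pos by (auto simp: nontrivial_def approximates_def)

text \<open>By the Sobolev inequality a function with zero gradient norm is zero. The denominator of
  the Sobolev quotient is therefore never degenerate in the supremum.\<close>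

lemma nontrivial_gradient:
  assumes "approximates \<phi> u G" "nontrivial D u"
  shows "Lp_norm (ennreal 2) M G \<noteq> 0"
proof
  assume z: "Lp_norm (ennreal 2) M G = 0"
  obtain C where "\<forall>\<phi>\<in>test_functions D. Lp_norm (ennreal p) M \<phi> \<le> ennreal C * Lp_norm (ennreal 2) M (gradient \<phi>)"
    using test_Sobolev by blast
  then have "Lp_norm (ennreal p) M u \<le> ennreal C * Lp_norm (ennreal 2) M G" by (intro approximates_le[OF _ assms(1)]) auto
  then show False using z assms(2) nontrivial_iff[OF assms(1)] by simp
qed

section \<open>The Sobolev constant\<close>

abbreviation "K \<equiv> sobolev_const (p / 2) D"

lemma Lp_norm_weak_gradient:
  assumes "approximates \<phi> u G"
  shows "Lp_norm (ennreal 2) M (weak_gradient D u) = Lp_norm (ennreal 2) M G"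
  by (rule Lp_norm_cong_AE) (use weak_gradient_eq(2)[OF approximates_is_weak_gradient[OF assms]] in auto)

lemma sobolev_quotient_eq:
  assumes "approximates \<phi> u G"
  shows "sobolev_quotient (p / 2) D u = Lp_norm (ennreal p) M u / Lp_norm (ennreal 2) M G"
  using Lp_norm_weak_gradient[OF assms] by (simp add: sobolev_quotient_def)

text \<open>The supremum runs over the whole closure, but both norms converge along an approximating
  sequence, so it is enough to check the inequality on test functions.\<close>

lemma sobolev_const_le:
  assumes "\<And>\<phi>. \<phi> \<in> test_functions D \<Longrightarrow> Lp_norm (ennreal p) M \<phi> \<le> ennreal c * Lp_norm (ennreal 2) M (gradient \<phi>)"
  shows "K \<le> ennreal c"
  unfolding sobolev_const_def
proof (rule Sup_least, safe)
  fix u assume u: "u \<in> W012 D" "nontrivial D u"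
  obtain \<phi> where a: "approximates \<phi> u (weak_gradient D u)" using W012_approximates[OF u(1)] .
  show "sobolev_quotient (p / 2) D u \<le> ennreal c"
    unfolding sobolev_quotient_eq[OF a]
    using nontrivial_gradient[OF a u(2)] approximates_finite(1)[OF a] approximates_le[OF assms a]
    by (subst ennreal_divide_le_iff) auto
qed

lemma le_sobolev_const:
  assumes a: "approximates \<phi> u G"
  shows "Lp_norm (ennreal p) M u \<le> K * Lp_norm (ennreal 2) M G"
proof (cases "nontrivial D u")
  case True
  have "sobolev_quotient (p / 2) D u \<le> K"
    unfolding sobolev_const_def using approximates_W012[OF a] True by (intro Sup_upper) auto
  then show ?thesis
    unfolding sobolev_quotient_eq[OF a]
    using nontrivial_gradient[OF a True] approximates_finite(1)[OF a] by (subst (asm) ennreal_divide_le_iff) auto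
next
  case False
  then show ?thesis using nontrivial_iff[OF a] by simp
qed

lemma exists_nontrivial_test: "\<exists>\<phi>\<in>test_functions D. Lp_norm (ennreal p) M \<phi> \<noteq> 0"
proof -
  \<comment> \<open>The witness is a bump on a small box around \<open>x\<close>: it is nonzero on
    the whole open box, which is not negligible.\<close>
  obtain x where "x \<in> D" using D_nonempty by blast
  then obtain a b where ab: "x \<in> box a b" "cbox a b \<subseteq> D"
    using open_contains_cbox[OF open_D] by metis
  have \<phi>: "box_bump a b 0 \<in> test_functions D" by (rule test_functions_box_bump[OF ab(2)])
  have "Lp_norm (ennreal p) M (box_bump a b 0) \<noteq> 0"
  proof
    assume "Lp_norm (ennreal p) M (box_bump a b 0) = 0"
    then have "AE x in M. box_bump a b 0 x = 0" using Lp_norm_zero_iff[OF test_measurable[OF \<phi>] p_pos] by simp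
    then have "AE x in lebesgue. x \<in> D \<longrightarrow> box_bump a b 0 x = 0" using D_lebesgue by (simp add: AE_restrict_space_iff)
    then have "AE x in lebesgue. x \<notin> box a b"
      by eventually_elim (use box_bump_neq_0[of _ a b 0] ab(2) box_subset_cbox[of a b] in auto)
    then have "negligible (box a b)"
      by (simp add: negligible_iff_null_sets AE_iff_null_sets)
    then show False using open_not_negligible[OF open_box, of a b] ab(1) by auto
  qed
  then show ?thesis using \<phi> by blast
qed

lemma sobolev_const_real: obtains \<kappa> where "K = ennreal \<kappa>" "\<kappa> > 0"
proof -
  obtain C where C: "\<forall>\<phi>\<in>test_functions D. Lp_norm (ennreal p) M \<phi> \<le> ennreal C * Lp_norm (ennreal 2) M (gradient \<phi>)"
    using test_Sobolev by blast
  then have "K \<le> ennreal C" by (intro sobolev_const_le) auto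
  then have "K \<noteq> \<infinity>" by (auto simp: top_unique)
  then obtain \<kappa> where \<kappa>: "K = ennreal \<kappa>" "\<kappa> \<ge> 0" by (rule ennreal_realE)
  obtain \<phi> where \<phi>: "\<phi> \<in> test_functions D" "Lp_norm (ennreal p) M \<phi> \<noteq> 0" using exists_nontrivial_test by blast
  have "\<kappa> \<noteq> 0"
    using le_sobolev_const[OF test_approximates[OF \<phi>(1)]] \<phi>(2) \<kappa> by auto
  then show ?thesis using that \<kappa> by simp
qed

text \<open>A number \<open>c\<close> below the supremum fails as a bound already for some test
  function, by \<open>sobolev_const_le\<close>. The quotient is invariant under scaling, so the
  gradient can be normalised.\<close>

lemma test_maximizer:
  assumes \<kappa>: "K = ennreal \<kappa>" and c: "c \<ge> 0" "c < \<kappa>"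
  shows "\<exists>\<phi>\<in>test_functions D. Lp_norm (ennreal 2) M (gradient \<phi>) = 1 \<and> ennreal c \<le> Lp_norm (ennreal p) M \<phi>"
proof -
  have "\<not> K \<le> ennreal c" using \<kappa> c by (simp add: ennreal_less_iff not_le)
  then obtain \<phi> where \<phi>: "\<phi> \<in> test_functions D" "ennreal c * Lp_norm (ennreal 2) M (gradient \<phi>) < Lp_norm (ennreal p) M \<phi>"
    using sobolev_const_le[of c] by (meson not_le)
  have "Lp_norm (ennreal 2) M (gradient \<phi>) \<noteq> \<infinity>" using Lp_norm_gradient_finite[OF \<phi>(1), of 2] by simp
  then obtain g where g: "Lp_norm (ennreal 2) M (gradient \<phi>) = ennreal g" "g \<ge> 0" by (rule ennreal_realE)
  have "g \<noteq> 0"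
  proof
    assume "g = 0"
    then have "Lp_norm (ennreal p) M \<phi> = 0" using le_sobolev_const[OF test_approximates[OF \<phi>(1)]] g by simp
    then show False using \<phi>(2) by simp
  qed
  then have g0: "g > 0" using g by simp
  let ?\<psi> = "\<lambda>x. (1 / g) *\<^sub>R \<phi> x"
  have "gradient ?\<psi> = (\<lambda>x. (1 / g) *\<^sub>R gradient \<phi> x)" by (rule ext) (rule gradient_scaleR[OF \<phi>(1)])
  then have 1: "Lp_norm (ennreal 2) M (gradient ?\<psi>) = 1"
    using Lp_norm_scaleR[OF gradient_measurable[OF \<phi>(1)], of 2 "1 / g"] g g0
    by (simp add: ennreal_mult[symmetric] del: ennreal_numeral)
  have "Lp_norm (ennreal p) M ?\<psi> = ennreal (1 / g) * Lp_norm (ennreal p) M \<phi>"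
    using Lp_norm_scaleR[OF test_measurable[OF \<phi>(1)] p_pos, of "1 / g"] g0 by simp
  also have "\<dots> \<ge> ennreal (1 / g) * (ennreal c * ennreal g)"
    using \<phi>(2) g(1) by (intro mult_left_mono) auto
  also have "ennreal (1 / g) * (ennreal c * ennreal g) = ennreal c"
    using g0 c by (simp add: ennreal_mult[symmetric])
  finally show ?thesis using 1 test_functions_scaleR[OF \<phi>(1), of "1 / g"] by blast
qed

text \<open>Since 2 \<phi> is the sum of \<phi> + \<psi> and \<phi> - \<psi>, the L^p norm of \<phi>
  + \<psi> is at least \<kappa> (2 - \<eta>): the two error terms cost \<kappa> \<eta> / 2 each.
  Hence its gradient has norm s \<ge> 2 - \<eta>, and the parallelogram law bounds the squared norm
  of the difference by 4 - (2 - \<eta>)^2, which is at most 4 \<eta>.\<close>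

lemma maximizing_gradients_close:
  assumes \<kappa>: "K = ennreal \<kappa>" "\<kappa> > 0" and \<phi>: "\<phi> \<in> test_functions D" and \<psi>: "\<psi> \<in> test_functions D"
    and n: "Lp_norm (ennreal 2) M (gradient \<phi>) = 1" "Lp_norm (ennreal 2) M (gradient \<psi>) = 1"
    and \<eta>: "\<eta> > 0" "\<eta> \<le> 1" and e: "e > 0" "4 * \<eta> \<le> e\<^sup>2"
    and c: "ennreal (\<kappa> - \<kappa> * \<eta> / 4) \<le> Lp_norm (ennreal p) M \<phi>"
    and d: "Lp_norm (ennreal p) M (\<lambda>x. \<phi> x - \<psi> x) \<le> ennreal (\<kappa> * \<eta> / 2)"
  shows "Lp_norm (ennreal 2) M (\<lambda>x. gradient \<phi> x - gradient \<psi> x) \<le> ennreal e"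
proof -
  note sum = test_functions_add[OF \<phi> \<psi>] and diff = test_functions_diff[OF \<phi> \<psi>]
  have gs: "gradient (\<lambda>x. \<phi> x + \<psi> x) = (\<lambda>x. gradient \<phi> x + gradient \<psi> x)" by (rule ext) (rule gradient_add[OF \<phi> \<psi>])
  have gd: "gradient (\<lambda>x. \<phi> x - \<psi> x) = (\<lambda>x. gradient \<phi> x - gradient \<psi> x)" by (rule ext) (rule gradient_diff[OF \<phi> \<psi>])
  have "Lp_norm (ennreal 2) M (\<lambda>x. gradient \<phi> x + gradient \<psi> x) \<noteq> \<infinity>"
    using Lp_norm_gradient_finite[OF sum, of 2] by (simp add: gs)
  then obtain s where s: "Lp_norm (ennreal 2) M (\<lambda>x. gradient \<phi> x + gradient \<psi> x) = ennreal s" "s \<ge> 0" by (rule ennreal_realE)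
  have "Lp_norm (ennreal 2) M (\<lambda>x. gradient \<phi> x - gradient \<psi> x) \<noteq> \<infinity>"
    using Lp_norm_gradient_finite[OF diff, of 2] by (simp add: gd)
  then obtain t where t: "Lp_norm (ennreal 2) M (\<lambda>x. gradient \<phi> x - gradient \<psi> x) = ennreal t" "t \<ge> 0" by (rule ennreal_realE)
  have st: "s\<^sup>2 + t\<^sup>2 = 2 * 1\<^sup>2 + 2 * 1\<^sup>2"
    by (rule L2_norm_parallelogram[OF gradient_measurable[OF \<phi>] gradient_measurable[OF \<psi>] _ _ s(1) t(1) _ _ s(2) t(2)]) (use n in auto)
  have "ennreal (2 * (\<kappa> - \<kappa> * \<eta> / 4)) = ennreal 2 * ennreal (\<kappa> - \<kappa> * \<eta> / 4)"
    by (intro ennreal_mult') simp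
  also have "\<dots> \<le> ennreal 2 * Lp_norm (ennreal p) M \<phi>" by (intro mult_left_mono c) simp
  also have "\<dots> = Lp_norm (ennreal p) M (\<lambda>x. 2 *\<^sub>R \<phi> x)"
    using Lp_norm_scaleR[OF test_measurable[OF \<phi>] p_pos, of 2] by simp
  also have "\<dots> = Lp_norm (ennreal p) M (\<lambda>x. (\<phi> x + \<psi> x) + (\<phi> x - \<psi> x))" by (simp add: scaleR_2)
  also have "\<dots> \<le> Lp_norm (ennreal p) M (\<lambda>x. \<phi> x + \<psi> x) + Lp_norm (ennreal p) M (\<lambda>x. \<phi> x - \<psi> x)"
    by (intro Lp_norm_triangle test_measurable sum diff p_ge_1)
  also have "\<dots> \<le> ennreal \<kappa> * ennreal s + ennreal (\<kappa> * \<eta> / 2)"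
    using le_sobolev_const[OF test_approximates[OF sum]] \<kappa> s(1) by (intro add_mono d) (simp add: gs)
  also have "\<dots> = ennreal (\<kappa> * s + \<kappa> * \<eta> / 2)"
    using \<kappa> s \<eta> by (simp add: ennreal_mult[symmetric] ennreal_plus[symmetric] del: ennreal_plus)
  finally have "2 * (\<kappa> - \<kappa> * \<eta> / 4) \<le> \<kappa> * s + \<kappa> * \<eta> / 2"
    using \<kappa> s \<eta> by (subst (asm) ennreal_le_iff) auto
  then have "\<kappa> * (2 - \<eta>) \<le> \<kappa> * s" by (simp add: algebra_simps)
  then have "2 - \<eta> \<le> s" using \<kappa> by simp
  then have "(2 - \<eta>)\<^sup>2 \<le> s\<^sup>2" using \<eta> by (intro power_mono) auto
  then have "4 - 4 * \<eta> \<le> s\<^sup>2" using \<eta> by (simp add: power2_diff) (smt (verit) zero_le_power2)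
  then have "t\<^sup>2 \<le> e\<^sup>2" using st e by simp
  then have "t \<le> e" by (rule power2_le_imp_le[OF _ less_imp_le[OF e(1)]])
  then show ?thesis using t by (simp add: ennreal_leI)
qed

text \<open>A maximizing sequence with gradients of norm 1 converges in \<open>L\<^sup>p\<close> along a subsequence. Its midpoints are then
  nearly maximizing too, so their gradients have norm nearly 1, and the parallelogram law makes the gradients
  a Cauchy sequence in \<open>L\<^sup>2\<close>; no weak compactness is needed.\<close>

theorem exists_extremal: "\<exists>u. sobolev_extremal (p / 2) D u"
proof -
  obtain \<kappa> where \<kappa>: "K = ennreal \<kappa>" "\<kappa> > 0" using sobolev_const_real .
  \<comment> \<open>Increases to \<open>\<kappa>\<close> from 0 and stays strictly below it, as
    \<open>test_maximizer\<close> requires.\<close>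
  define c where "c k = \<kappa> * (1 - 1 / real (Suc k))" for k
  have c: "c k \<ge> 0" "c k < \<kappa>" for k using \<kappa> by (auto simp: c_def field_simps)
  have "\<exists>\<phi>. \<phi> \<in> test_functions D \<and> Lp_norm (ennreal 2) M (gradient \<phi>) = 1 \<and> ennreal (c k) \<le> Lp_norm (ennreal p) M \<phi>" for k
    using test_maximizer[OF \<kappa>(1) c] by blast
  then obtain \<phi> where \<phi>: "\<And>k. \<phi> k \<in> test_functions D" "\<And>k. Lp_norm (ennreal 2) M (gradient (\<phi> k)) = 1"
     "\<And>k. ennreal (c k) \<le> Lp_norm (ennreal p) M (\<phi> k)" by metis
  have le1: "Lp_norm (ennreal 2) M (gradient (\<phi> k)) \<le> ennreal 1" for k using \<phi>(2)[of k] by simp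
  obtain r where r: "strict_mono (r :: nat \<Rightarrow> nat)"
    "\<And>\<epsilon>. \<epsilon> > 0 \<Longrightarrow> \<exists>N. \<forall>i\<ge>N. \<forall>j\<ge>N. Lp_norm (ennreal p) M (\<lambda>x. \<phi> (r i) x - \<phi> (r j) x) \<le> ennreal \<epsilon>"
    using Rellich_Kondrachov[where \<phi> = \<phi>, OF open_D bounded_D p_ge_2 gain_pos \<phi>(1) zero_le_one le1] by blast
  have climit: "c \<longlonglongrightarrow> \<kappa>"
  proof -
    have "(\<lambda>k. \<kappa> * (1 - inverse (real (Suc k)))) \<longlonglongrightarrow> \<kappa> * (1 - 0)"
      by (intro tendsto_intros LIMSEQ_inverse_real_of_nat)
    moreover have "c = (\<lambda>k. \<kappa> * (1 - inverse (real (Suc k))))" by (simp add: c_def fun_eq_iff divide_inverse)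
    ultimately show ?thesis by simp
  qed
  have "\<exists>N. \<forall>m\<ge>N. \<forall>n\<ge>N. Lp_norm (ennreal 2) M (\<lambda>x. gradient (\<phi> (r m)) x - gradient (\<phi> (r n)) x) \<le> ennreal e" if e: "e > 0" for e
  proof -
    \<comment> \<open>The cap at 1 keeps \<open>2 - \<eta>\<close> nonnegative when it is squared in
      \<open>maximizing_gradients_close\<close>.\<close>
    define \<eta> where "\<eta> = min 1 (e\<^sup>2 / 4)"
    have \<eta>: "\<eta> > 0" "\<eta> \<le> 1" "4 * \<eta> \<le> e\<^sup>2" using e by (auto simp: \<eta>_def)
    obtain N1 where N1: "\<forall>i\<ge>N1. \<forall>j\<ge>N1. Lp_norm (ennreal p) M (\<lambda>x. \<phi> (r i) x - \<phi> (r j) x) \<le> ennreal (\<kappa> * \<eta> / 2)"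
      using r(2)[of "\<kappa> * \<eta> / 2"] \<kappa> \<eta> by auto
    have lt: "\<kappa> - \<kappa> * \<eta> / 4 < \<kappa>" using \<kappa> \<eta> by simp
    obtain N2 where N2: "\<forall>k\<ge>N2. \<kappa> - \<kappa> * \<eta> / 4 < c k"
      using order_tendstoD(1)[OF climit lt] by (auto simp: eventually_sequentially)
    have "Lp_norm (ennreal 2) M (\<lambda>x. gradient (\<phi> (r m)) x - gradient (\<phi> (r n)) x) \<le> ennreal e" if "m \<ge> max N1 N2" "n \<ge> max N1 N2" for m n
    proof (rule maximizing_gradients_close[OF \<kappa> \<phi>(1) \<phi>(1) \<phi>(2) \<phi>(2) \<eta>(1,2) e \<eta>(3)])
      have "r m \<ge> N2" using seq_suble[OF r(1), of m] that by simp
      then have "ennreal (\<kappa> - \<kappa> * \<eta> / 4) \<le> ennreal (c (r m))" using N2 by (intro ennreal_leI) auto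
      then show "ennreal (\<kappa> - \<kappa> * \<eta> / 4) \<le> Lp_norm (ennreal p) M (\<phi> (r m))" using \<phi>(3)[of "r m"] by (rule order_trans)
      show "Lp_norm (ennreal p) M (\<lambda>x. \<phi> (r m) x - \<phi> (r n) x) \<le> ennreal (\<kappa> * \<eta> / 2)" using N1 that by simp
    qed
    then show ?thesis by blast
  qed
  then obtain u G where a: "approximates (\<lambda>k. \<phi> (r k)) u G"
    using Cauchy_imp_approximates[of "\<lambda>k. \<phi> (r k)"] \<phi>(1) by blast
  have G: "Lp_norm (ennreal 2) M G = 1"
    using LIMSEQ_unique[OF approximates_tendsto(1)[OF a]] \<phi>(2) by simp
  \<comment> \<open>The limit gradient still has norm 1, because the gradients converge in norm, so
    this lower bound already makes \<open>u\<close> extremal.\<close>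
  have "K \<le> Lp_norm (ennreal p) M u"
  proof (rule LIMSEQ_le[OF _ approximates_tendsto(2)[OF a]])
    have "(\<lambda>k. c (r k)) \<longlonglongrightarrow> \<kappa>" using LIMSEQ_subseq_LIMSEQ[OF climit r(1)] by (simp add: o_def)
    then show "(\<lambda>k. ennreal (c (r k))) \<longlonglongrightarrow> K" unfolding \<kappa>(1) by (rule tendsto_ennrealI)
    show "\<exists>N. \<forall>k\<ge>N. ennreal (c (r k)) \<le> Lp_norm (ennreal p) M (\<phi> (r k))" using \<phi>(3) by blast
  qed
  then have u: "Lp_norm (ennreal p) M u = K" using le_sobolev_const[OF a] G by (simp add: antisym)
  have "nontrivial D u" using nontrivial_iff[OF a] u \<kappa> by auto
  moreover have "sobolev_quotient (p / 2) D u = K" using sobolev_quotient_eq[OF a] u G by (simp add: divide_ennreal_def)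
  ultimately show ?thesis using approximates_W012[OF a] by (auto simp: sobolev_extremal_def)
qed

end

section \<open>Euler--Lagrange equation and lower bound\<close>

text \<open>The tangent line of a convex power, obtained from Young's inequality for the product of
  \<open>a powr (p - 1)\<close> and \<open>b\<close>; in this form \<open>b = 0\<close> is
  included.\<close>

lemma powr_tangent_le:
  fixes a b :: real
  assumes p: "p > 1" and "a > 0" "b \<ge> 0"
  shows "a powr p + p * a powr (p - 1) * (b - a) \<le> b powr p"
proof -
  define p' where "p' = p / (p - 1)"
  have p': "p' > 1" "1 / p' + 1 / p = 1" using p by (auto simp: p'_def field_simps)
  have "a powr (p - 1) * b \<le> (a powr (p - 1)) powr p' / p' + b powr p / p"
    using assms p' by (intro Youngs_inequality) auto
  also have "(a powr (p - 1)) powr p' = a powr p" using p by (simp add: powr_powr p'_def)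
  finally have 1: "p * (a powr (p - 1) * b) \<le> p * (a powr p / p' + b powr p / p)" using p by (intro mult_left_mono) auto
  have "p * (a powr p / p' + b powr p / p) = (p - 1) * a powr p + b powr p"
    using p by (simp add: p'_def distrib_left)
  moreover have "a powr (p - 1) * a = a powr p" using assms by (simp add: powr_mult_base mult.commute)
  ultimately show ?thesis using 1 by (simp add: algebra_simps)
qed

text \<open>This replaces differentiation under the integral sign in the derivation of the Euler--Lagrange equation.\<close>

lemma norm_powr_tangent_le:
  fixes x y :: "'a::real_inner"
  assumes p: "p \<ge> 2"
  shows "norm x powr p + p * t * (nonneg_power (norm x) (p - 2) * (x \<bullet> y)) \<le> norm (x + t *\<^sub>R y) powr p"
proof (cases "x = 0")
  case True
  then show ?thesis by simp
next
  case False
  then have x: "norm x > 0" by simp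
  let ?z = "x + t *\<^sub>R y"
  have np: "nonneg_power (norm x) (p - 2) = norm x powr (p - 2)" using x by (simp add: nonneg_power_def)
  \<comment> \<open>Cauchy-Schwarz bounds the increment of the norm from below by its linearisation;
    this reduces the vector inequality to the scalar tangent line at \<open>norm x\<close>.\<close>
  have "x \<bullet> ?z \<le> norm x * norm ?z" by (rule norm_cauchy_schwarz)
  then have "t * (x \<bullet> y) \<le> norm x * (norm ?z - norm x)"
    by (simp add: inner_add_right dot_square_norm power2_eq_square algebra_simps)
  then have "norm x powr (p - 2) * (t * (x \<bullet> y)) \<le> norm x powr (p - 2) * (norm x * (norm ?z - norm x))"
    by (intro mult_left_mono) auto
  also have "norm x powr (p - 2) * (norm x * (norm ?z - norm x)) = norm x powr (p - 1) * (norm ?z - norm x)"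
    using x by (simp add: powr_mult_base mult.assoc[symmetric] mult.commute[of "norm x powr (p - 2)"])
  finally have "p * (norm x powr (p - 2) * (t * (x \<bullet> y))) \<le> p * (norm x powr (p - 1) * (norm ?z - norm x))"
    using p by (intro mult_left_mono) auto
  moreover have "norm x powr p + p * norm x powr (p - 1) * (norm ?z - norm x) \<le> norm ?z powr p"
    using p x by (intro powr_tangent_le) auto
  ultimately show ?thesis unfolding np by (simp add: algebra_simps)
qed

lemma norm_add_scaleR_square:
  fixes y z :: "'a::real_inner"
  shows "(norm (y + t *\<^sub>R z))\<^sup>2 = (norm y)\<^sup>2 + (2 * t) * (y \<bullet> z) + t\<^sup>2 * (norm z)\<^sup>2"
  unfolding power2_norm_eq_inner
  by (simp add: inner_add_left inner_add_right inner_commute power2_eq_square algebra_simps)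

section \<open>Norms as Bochner integrals, and the endpoint of Hoelder's inequality\<close>

lemma Lp_norm_imp_integral:
  fixes f :: "'a \<Rightarrow> 'b::{second_countable_topology,real_normed_vector}"
  assumes [measurable]: "f \<in> borel_measurable N" and "Lp_norm (ennreal s) N f = ennreal a" "a \<ge> 0" "s > 0"
  shows "integrable N (\<lambda>x. norm (f x) powr s)" "(LINT x|N. norm (f x) powr s) = a powr s"
proof -
  have "(\<integral>\<^sup>+ x. ennreal (norm (f x) powr s) \<partial>N) = ennreal (a powr s)"
    using Lp_norm_eqD[OF assms(2,4,3)] .
  then have "integrable N (\<lambda>x. norm (f x) powr s) \<and> (LINT x|N. norm (f x) powr s) = a powr s"
    by (subst (asm) nn_integral_eq_integrable) auto
  then show "integrable N (\<lambda>x. norm (f x) powr s)" "(LINT x|N. norm (f x) powr s) = a powr s" by auto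
qed

lemma L2_norm_imp_integral:
  fixes f :: "'a \<Rightarrow> 'b::{second_countable_topology,real_normed_vector}"
  assumes "f \<in> borel_measurable N" "Lp_norm (ennreal 2) N f = ennreal a" "a \<ge> 0"
  shows "integrable N (\<lambda>x. (norm (f x))\<^sup>2)" "(LINT x|N. (norm (f x))\<^sup>2) = a\<^sup>2"
  using Lp_norm_imp_integral[OF assms] assms(3) by simp_all

lemma L2_inner_le:
  fixes f g :: "'a \<Rightarrow> 'b::{second_countable_topology,real_inner}"
  assumes [measurable]: "f \<in> borel_measurable N" "g \<in> borel_measurable N"
  shows "(\<integral>\<^sup>+ x. ennreal (norm (f x \<bullet> g x)) \<partial>N) \<le> Lp_norm (ennreal 2) N f * Lp_norm (ennreal 2) N g"
proof -
  have "(\<integral>\<^sup>+ x. ennreal (norm (f x \<bullet> g x)) \<partial>N) \<le> (\<integral>\<^sup>+ x. ennreal (norm (f x) * norm (g x)) \<partial>N)"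
    by (intro nn_integral_mono ennreal_leI) (simp add: Cauchy_Schwarz_ineq2)
  also have "\<dots> \<le> Lp_norm (ennreal 2) N f * Lp_norm (ennreal 2) N g"
    by (intro Lp_norm_Holder) auto
  finally show ?thesis .
qed

lemma L2_inner_integrable:
  fixes f g :: "'a \<Rightarrow> 'b::{second_countable_topology,real_inner}"
  assumes [measurable]: "f \<in> borel_measurable N" "g \<in> borel_measurable N"
    and "Lp_norm (ennreal 2) N f < \<infinity>" "Lp_norm (ennreal 2) N g < \<infinity>"
  shows "integrable N (\<lambda>x. f x \<bullet> g x)"
proof (rule integrableI_bounded)
  have "(\<integral>\<^sup>+ x. ennreal (norm (f x \<bullet> g x)) \<partial>N) \<le> Lp_norm (ennreal 2) N f * Lp_norm (ennreal 2) N g"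
    by (rule L2_inner_le) measurable
  also have "\<dots> < \<infinity>" using assms(3,4) by (simp add: ennreal_mult_less_top)
  finally show "(\<integral>\<^sup>+ x. ennreal (norm (f x \<bullet> g x)) \<partial>N) < \<infinity>" .
qed measurable

text \<open>\<open>ennreal q\<close> is zero for nonpositive \<open>q\<close>, and its reciprocal is
  then infinite, which rules such \<open>q\<close> out. The remaining split is the endpoint, where 1
  / \<infinity> = 0 forces q = 1, against ordinary conjugate exponents above 1.\<close>

lemma conjugate_exponent_cases:
  fixes r :: ennreal and q :: real
  assumes "1 / ennreal q + 1 / r = 1" "r > 1"
  obtains "r = \<infinity>" "q = 1" | r' where "r = ennreal r'" "r' > 1" "q > 1" "1 / r' + 1 / q = 1"
proof (cases "q > 0")
  case False
  then have "1 / ennreal q = \<infinity>" by (simp add: ennreal_neg)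
  then show ?thesis using assms by simp
next
  case q: True
  then have 1: "1 / ennreal q = ennreal (1 / q)" by (metis divide_ennreal ennreal_1 zero_le_one)
  show ?thesis
  proof (cases r)
    case top
    then have "ennreal (1 / q) = 1" using assms 1 by simp
    then have "1 / q = 1" using q by (simp add: ennreal_eq_1)
    then show ?thesis using that(1) top by simp
  next
    case (real r')
    then have r': "r' > 1" using assms(2) by (metis ennreal_1 ennreal_less_iff zero_le_one)
    have 2: "1 / r = ennreal (1 / r')" using real r' by (metis divide_ennreal ennreal_1 zero_le_one less_trans zero_less_one)
    have "ennreal (1 / r' + 1 / q) = 1" using assms(1) q r' unfolding 1 2 by (simp add: ennreal_plus[symmetric] add.commute del: ennreal_plus)
    then have "ennreal (1 / r' + 1 / q) = ennreal 1" by simp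
    then have e: "1 / r' + 1 / q = 1" using q r' by (subst (asm) ennreal_inj) auto
    have "1 / r' > 0" using r' by simp
    then have "1 / q < 1" using e by linarith
    then have "q > 1" using q by (simp add: divide_less_eq)
    then show ?thesis using that(2) real r' e by simp
  qed
qed

lemma Holder_conjugate:
  fixes f :: "'a \<Rightarrow> real" and w :: "'a \<Rightarrow> real"
  assumes [measurable]: "f \<in> borel_measurable N" "w \<in> borel_measurable N"
    and "1 / ennreal q + 1 / r = 1" "r > 1"
  shows "(\<integral>\<^sup>+ x. ennreal (norm (f x) * norm (w x)) \<partial>N) \<le> Lp_norm r N f * Lp_norm (ennreal q) N w"
  using assms(3,4)
proof (cases rule: conjugate_exponent_cases)
  case 1
  let ?S = "esssup N (\<lambda>x. ennreal (norm (f x)))"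
  have "AE x in N. ennreal (norm (f x)) \<le> ?S" by (rule esssup_AE)
  then have "(\<integral>\<^sup>+ x. ennreal (norm (f x) * norm (w x)) \<partial>N) \<le> (\<integral>\<^sup>+ x. ?S * ennreal (norm (w x)) \<partial>N)"
    by (intro nn_integral_mono_AE) (auto elim!: eventually_mono simp: ennreal_mult intro: mult_right_mono)
  also have "\<dots> = ?S * (\<integral>\<^sup>+ x. ennreal (norm (w x)) \<partial>N)" by (intro nn_integral_cmult) measurable
  finally show ?thesis using 1 Lp_norm_1_eq[of N w] by (simp add: Lp_norm_def[of \<infinity>] Lp_norm_def[of top])
next
  case (2 r')
  then show ?thesis using Lp_norm_Holder[of f N w r' q] by simp
qed

section \<open>First variation at an extremal\<close>

context nonempty_subcritical_domain
begin

lemma approximates_add_test: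
  assumes a: "approximates \<phi> u G" and \<psi>: "\<psi> \<in> test_functions D"
  shows "approximates (\<lambda>k x. \<phi> k x + t *\<^sub>R \<psi> x) (\<lambda>x. u x + t *\<^sub>R \<psi> x) (\<lambda>x. G x + t *\<^sub>R gradient \<psi> x)"
proof -
  note a' = a[unfolded approximates_def]
  have t: "(\<lambda>x. t *\<^sub>R \<psi> x) \<in> test_functions D" by (rule test_functions_scaleR[OF \<psi>])
  have "gradient (\<lambda>x. \<phi> k x + t *\<^sub>R \<psi> x) = (\<lambda>x. gradient (\<phi> k) x + t *\<^sub>R gradient \<psi> x)" for k
    using a' gradient_add[OF _ t] gradient_scaleR[OF \<psi>] by (intro ext) simp
  moreover have "(\<lambda>x. u x + t *\<^sub>R \<psi> x) \<in> borel_measurable M" "(\<lambda>x. G x + t *\<^sub>R gradient \<psi> x) \<in> borel_measurable M"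
    using a' test_measurable[OF \<psi>] gradient_measurable[OF \<psi>]
    by (intro borel_measurable_add borel_measurable_scaleR borel_measurable_const; simp)+
  ultimately show ?thesis
    using a' test_functions_add[OF _ t] unfolding approximates_def by simp
qed

text \<open>For positive \<open>b\<close> the left side is \<open>b powr (p - 1)\<close>, at most 1
  or at most \<open>b powr p\<close> according to the size of \<open>b\<close>. Over a finite
  measure, integrability of the p-th power thus yields integrability of the nonlinear term against
  test functions.\<close>

lemma nonneg_power_mult_le:
  assumes "b \<ge> 0" shows "nonneg_power b (p - 2) * b \<le> 1 + b powr p"
proof (cases "b = 0")
  case False
  with assms have b: "b > 0" by simp
  then have "nonneg_power b (p - 2) * b = b powr (p - 1)"
    using powr_mult_base[of b "p - 2"] by (auto simp: nonneg_power_def mult.commute)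
  also have "\<dots> \<le> 1 + b powr p"
  proof (cases "b \<le> 1")
    case True
    have "b powr (p - 1) \<le> 1" using b True p_ge_1 by (intro powr_le1) auto
    then show ?thesis by (simp add: add_increasing2)
  next
    case False
    then have "b powr (p - 1) \<le> b powr p" by (intro powr_mono) auto
    then show ?thesis by simp
  qed
  finally show ?thesis .
qed simp

lemma nonneg_power_nonneg: "b \<ge> 0 \<Longrightarrow> nonneg_power b s \<ge> 0"
  by (simp add: nonneg_power_def)

lemma nonneg_power_measurable [measurable]:
  "f \<in> borel_measurable N \<Longrightarrow> (\<lambda>x. nonneg_power (f x) s) \<in> borel_measurable N"
  unfolding nonneg_power_def by (cases "s = 0") auto

lemma integrable_power_test:
  assumes a: "approximates \<phi> u G" and \<psi>: "\<psi> \<in> test_functions D"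
  shows "integrable M (\<lambda>x. complex_of_real (nonneg_power (norm (u x)) (p - 2)) * u x * \<psi> x)"
    and "integrable M (\<lambda>x. nonneg_power (norm (u x)) (p - 2) * (u x \<bullet> \<psi> x))"
proof -
  have [measurable]: "u \<in> borel_measurable M" using a by (simp add: approximates_def)
  note [measurable] = test_measurable[OF \<psi>]
  obtain B where B: "\<And>x. norm (\<psi> x) \<le> B" using test_functions_bounded[OF \<psi>] by blast
  obtain c where c: "Lp_norm (ennreal p) M u = ennreal c" "c \<ge> 0"
    by (rule ennreal_realE[OF less_imp_neq[OF approximates_finite(2)[OF a]]])
  interpret finite_measure M by (rule finite_M)
  have i: "integrable M (\<lambda>x. B * (1 + norm (u x) powr p))"
    using Lp_norm_imp_integral(1)[OF _ c p_pos] by (intro integrable_mult_right Bochner_Integration.integrable_add) auto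
  have le: "nonneg_power (norm (u x)) (p - 2) * norm (u x) * norm (\<psi> x) \<le> B * (1 + norm (u x) powr p)" for x
  proof -
    have "nonneg_power (norm (u x)) (p - 2) * norm (u x) * norm (\<psi> x) \<le> (1 + norm (u x) powr p) * B"
      by (intro mult_mono nonneg_power_mult_le B) auto
    then show ?thesis by (simp add: mult.commute)
  qed
  have B0: "B \<ge> 0" using B[of undefined] norm_ge_zero order_trans by blast
  have n: "norm (B * (1 + norm (u x) powr p)) = B * (1 + norm (u x) powr p)" for x
    using B0 by simp
  show "integrable M (\<lambda>x. complex_of_real (nonneg_power (norm (u x)) (p - 2)) * u x * \<psi> x)"
  proof (rule Bochner_Integration.integrable_bound[OF i])
    show "AE x in M. norm (complex_of_real (nonneg_power (norm (u x)) (p - 2)) * u x * \<psi> x) \<le> norm (B * (1 + norm (u x) powr p))"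
      unfolding n using le nonneg_power_nonneg by (simp add: norm_mult)
  qed measurable
  show "integrable M (\<lambda>x. nonneg_power (norm (u x)) (p - 2) * (u x \<bullet> \<psi> x))"
  proof (rule Bochner_Integration.integrable_bound[OF i])
    have "norm (nonneg_power (norm (u x)) (p - 2) * (u x \<bullet> \<psi> x)) \<le> B * (1 + norm (u x) powr p)" for x
    proof -
      have "norm (nonneg_power (norm (u x)) (p - 2) * (u x \<bullet> \<psi> x)) \<le> nonneg_power (norm (u x)) (p - 2) * (norm (u x) * norm (\<psi> x))"
        using nonneg_power_nonneg[of "norm (u x)" "p - 2"] Cauchy_Schwarz_ineq2[of "u x" "\<psi> x"]
        by (simp add: abs_mult mult_left_mono)
      then show ?thesis using le[of x] by (simp add: mult.assoc)
    qed
    then show "AE x in M. norm (nonneg_power (norm (u x)) (p - 2) * (u x \<bullet> \<psi> x)) \<le> norm (B * (1 + norm (u x) powr p))"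
      unfolding n by simp
  qed measurable
qed

text \<open>Along \<open>u + t \<psi>\<close> the squared gradient norm is the quadratic
  \<open>?Q\<close>, while the p-th power of the L^p norm is only bounded below by its tangent
  \<open>?L\<close>. The Sobolev inequality still gives
  \<open>?L t powr (2 / p) \<le> \<kappa>\<^sup>2 * ?Q t\<close>, with equality at
  \<open>t = 0\<close> by extremality; the difference has a local minimum there, and its vanishing
  derivative is the equation.\<close>

lemma Euler_Lagrange:
  assumes ap: "approximates \<phi> u G" and g: "Lp_norm (ennreal 2) M G = ennreal g" "g > 0"
    and a: "Lp_norm (ennreal p) M u = ennreal a" "a > 0"
    and \<kappa>: "K = ennreal \<kappa>" "a = \<kappa> * g" and \<psi>: "\<psi> \<in> test_functions D"
  shows "(LINT x|M. G x \<bullet> gradient \<psi> x) =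
    g\<^sup>2 / a powr p * (LINT x|M. nonneg_power (norm (u x)) (p - 2) * (u x \<bullet> \<psi> x))" (is "?B = _ * ?A")
proof -
  have \<kappa>0: "\<kappa> > 0" using a(2) g(2) \<kappa>(2) by (simp add: zero_less_mult_iff)
  have m[measurable]: "u \<in> borel_measurable M" "G \<in> borel_measurable M" using ap by (auto simp: approximates_def)
  note [measurable] = test_measurable[OF \<psi>] gradient_measurable[OF \<psi>]
  obtain e where e: "Lp_norm (ennreal 2) M (gradient \<psi>) = ennreal e" "e \<ge> 0"
    by (rule ennreal_realE[OF less_imp_neq[OF Lp_norm_gradient_finite[OF \<psi>, of 2]]]) simp
  have iB: "integrable M (\<lambda>x. G x \<bullet> gradient \<psi> x)"
    by (rule L2_inner_integrable) (use g e in auto)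
  let ?L = "\<lambda>t. a powr p + p * t * ?A"
  let ?Q = "\<lambda>t. g\<^sup>2 + 2 * t * ?B + t\<^sup>2 * e\<^sup>2"
  have key: "?L t powr (2 / p) \<le> \<kappa>\<^sup>2 * ?Q t" if L: "?L t > 0" for t
  proof -
    note at = approximates_add_test[OF ap \<psi>, of t]
    have mt: "(\<lambda>x. u x + t *\<^sub>R \<psi> x) \<in> borel_measurable M" "(\<lambda>x. G x + t *\<^sub>R gradient \<psi> x) \<in> borel_measurable M" by measurable
    obtain b where b: "Lp_norm (ennreal p) M (\<lambda>x. u x + t *\<^sub>R \<psi> x) = ennreal b" "b \<ge> 0"
      by (rule ennreal_realE[OF less_imp_neq[OF approximates_finite(2)[OF at]]])
    obtain h where h: "Lp_norm (ennreal 2) M (\<lambda>x. G x + t *\<^sub>R gradient \<psi> x) = ennreal h" "h \<ge> 0"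
      by (rule ennreal_realE[OF less_imp_neq[OF approximates_finite(1)[OF at]]])
    have "ennreal b \<le> ennreal (\<kappa> * h)"
      using le_sobolev_const[OF at] b h \<kappa>(1) \<kappa>0 by (simp add: ennreal_mult)
    then have bh: "b \<le> \<kappa> * h" using h \<kappa>0 by (subst (asm) ennreal_le_iff) auto
    have "h\<^sup>2 = (LINT x|M. (norm (G x + t *\<^sub>R gradient \<psi> x))\<^sup>2)"
      using L2_norm_imp_integral(2)[OF mt(2) h] by simp
    also have "\<dots> = (LINT x|M. (norm (G x))\<^sup>2 + (2 * t) * (G x \<bullet> gradient \<psi> x) + t\<^sup>2 * (norm (gradient \<psi> x))\<^sup>2)"
      by (intro Bochner_Integration.integral_cong refl norm_add_scaleR_square)
    also have "\<dots> = (LINT x|M. (norm (G x))\<^sup>2) + (2 * t) * ?B + t\<^sup>2 * (LINT x|M. (norm (gradient \<psi> x))\<^sup>2)"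
      using L2_norm_imp_integral(1)[OF m(2) g(1)] L2_norm_imp_integral(1)[OF gradient_measurable[OF \<psi>] e] iB g(2) by simp
    also have "\<dots> = ?Q t"
      using L2_norm_imp_integral(2)[OF m(2) g(1)] L2_norm_imp_integral(2)[OF gradient_measurable[OF \<psi>] e] g(2) by simp
    finally have hQ: "h\<^sup>2 = ?Q t" .
    have "?L t = (LINT x|M. norm (u x) powr p) + p * t * ?A"
      using Lp_norm_imp_integral(2)[OF m(1) a(1) _ p_pos] a(2) by simp
    also have "\<dots> = (LINT x|M. norm (u x) powr p + p * t * (nonneg_power (norm (u x)) (p - 2) * (u x \<bullet> \<psi> x)))"
      using Lp_norm_imp_integral(1)[OF m(1) a(1) _ p_pos] a(2) integrable_power_test(2)[OF ap \<psi>] by simp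
    also have "\<dots> \<le> (LINT x|M. norm (u x + t *\<^sub>R \<psi> x) powr p)"
    proof (rule integral_mono)
      show "integrable M (\<lambda>x. norm (u x) powr p + p * t * (nonneg_power (norm (u x)) (p - 2) * (u x \<bullet> \<psi> x)))"
        using Lp_norm_imp_integral(1)[OF m(1) a(1) _ p_pos] a(2) integrable_power_test(2)[OF ap \<psi>]
        by (intro Bochner_Integration.integrable_add integrable_mult_right) auto
      show "integrable M (\<lambda>x. norm (u x + t *\<^sub>R \<psi> x) powr p)" by (rule Lp_norm_imp_integral(1)[OF mt(1) b p_pos])
    qed (rule norm_powr_tangent_le[OF p_ge_2])
    also have "\<dots> = b powr p" by (rule Lp_norm_imp_integral(2)[OF mt(1) b p_pos])
    finally have "?L t powr (2 / p) \<le> (b powr p) powr (2 / p)" using L p_pos by (intro powr_mono2) auto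
    also have "\<dots> = b\<^sup>2" using b p_pos by (simp add: powr_powr)
    also have "\<dots> \<le> (\<kappa> * h)\<^sup>2" using bh b by (intro power_mono) auto
    finally show ?thesis by (simp add: power_mult_distrib hQ)
  qed
  let ?F = "\<lambda>t. \<kappa>\<^sup>2 * ?Q t - ?L t powr (2 / p)"
  have a0: "a powr p > 0" using a by simp
  have F0: "?F 0 = 0" using a p_pos \<kappa> by (simp add: powr_powr power_mult_distrib)
  \<comment> \<open>For \<open>\<bar>t\<bar> < d\<close> the affine function \<open>?L\<close> stays
    positive, so that its power is monotone in the bound and \<open>key\<close> applies.\<close>
  define d where "d = a powr p / (p * \<bar>?A\<bar> + 1)"
  have dpos: "p * \<bar>?A\<bar> + 1 > 0" using p_pos by (simp add: add_nonneg_pos)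
  then have d: "d > 0" using a0 by (simp add: d_def)
  have Fpos: "?F 0 \<le> ?F t" if t: "\<bar>0 - t\<bar> < d" for t
  proof -
    have "\<bar>p * t * ?A\<bar> = \<bar>t\<bar> * (p * \<bar>?A\<bar>)" using p_pos by (simp add: abs_mult)
    also have "\<dots> \<le> \<bar>t\<bar> * (p * \<bar>?A\<bar> + 1)" by (intro mult_left_mono) auto
    also have "\<dots> < d * (p * \<bar>?A\<bar> + 1)" using t dpos by (intro mult_strict_right_mono) auto
    also have "\<dots> = a powr p" using dpos by (simp add: d_def)
    finally have "?L t > 0" by linarith
    from key[OF this] show ?thesis unfolding F0 by simp
  qed
  have dL: "(?L has_real_derivative p * ?A) (at 0)" by (auto intro!: derivative_eq_intros)
  have dP: "((\<lambda>t. ?L t powr (2 / p)) has_real_derivative (2 / p) * ?L 0 powr (2 / p - 1) * (p * ?A)) (at 0)"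
    using DERIV_fun_powr[OF dL, of "2 / p"] a0 by simp
  have dQ: "((\<lambda>t. \<kappa>\<^sup>2 * ?Q t) has_real_derivative \<kappa>\<^sup>2 * (2 * ?B)) (at 0)" by (auto intro!: derivative_eq_intros)
  have "\<kappa>\<^sup>2 * (2 * ?B) - (2 / p) * ?L 0 powr (2 / p - 1) * (p * ?A) = 0"
    by (rule DERIV_local_min[OF DERIV_diff[OF dQ dP] d]) (use Fpos in blast)
  then have "\<kappa>\<^sup>2 * ?B = (a powr p) powr (2 / p - 1) * ?A" using p_pos by simp
  also have "(a powr p) powr (2 / p - 1) = a\<^sup>2 / a powr p"
  proof -
    have "(a powr p) powr (2 / p - 1) = a powr (2 - p)" using p_pos by (simp add: powr_powr right_diff_distrib)
    also have "\<dots> = a powr 2 / a powr p" by (rule powr_diff)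
    finally show ?thesis using a by simp
  qed
  \<comment> \<open>Extremality, in the form \<open>a = \<kappa> * g\<close>, makes
    \<open>\<kappa>\<^sup>2\<close> a common factor of both sides.\<close>
  also have "a\<^sup>2 / a powr p * ?A = \<kappa>\<^sup>2 * (g\<^sup>2 / a powr p * ?A)" by (simp add: \<kappa>(2) power_mult_distrib)
  finally have "\<kappa>\<^sup>2 * ?B = \<kappa>\<^sup>2 * (g\<^sup>2 / a powr p * ?A)" .
  then show ?thesis using \<kappa>0 by (subst (asm) mult_cancel_left) simp
qed

section \<open>Real and complex forms of the weak equation\<close>

lemma inner_gradient_bounded_linear:
  assumes \<psi>: "\<psi> \<in> test_functions D" and L: "bounded_linear L" and T: "bounded_linear T"
    and LT: "\<And>z w. z \<bullet> L w = T (z * w)"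
  shows "G x \<bullet> gradient (\<lambda>x. L (\<psi> x)) x = T (\<Sum>i\<in>UNIV. G x $ i * partial_deriv i \<psi> x)"
proof -
  interpret T: bounded_linear T by (rule T)
  show ?thesis
    unfolding gradient_bounded_linear[OF \<psi> L] by (simp add: inner_vec_def LT T.sum gradient_def)
qed

lemma integrable_gradient_pairing:
  assumes wg: "is_weak_gradient D u G" and \<psi>: "\<psi> \<in> test_functions D"
  shows "integrable M (\<lambda>x. \<Sum>i\<in>UNIV. G x $ i * partial_deriv i \<psi> x)"
proof (rule Bochner_Integration.integrable_sum)
  fix i
  show "integrable M (\<lambda>x. G x $ i * partial_deriv i \<psi> x)"
    using wg by (intro integrable_locally_integrable_test[OF open_D locally_integrable_nth test_functions_partial_deriv[OF \<psi>]])
      (simp add: is_weak_gradient_def)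
qed

text \<open>\<open>T\<close> reads off the real or imaginary part of a product, and \<open>L\<close>
  transforms the test function so that the real inner product computes that part. One component of
  the complex equation for \<open>\<psi>\<close> is thus the real equation for
  \<open>L \<psi>\<close>; the equivalence serves both to use a given solution and to establish
  one.\<close>

lemma weak_equation_component_iff:
  assumes wg: "is_weak_gradient D u G" and \<psi>: "\<psi> \<in> test_functions D"
    and L: "bounded_linear L" and T: "bounded_linear T" and LT: "\<And>z w. z \<bullet> L w = T (z * w)"
    and i: "integrable M (\<lambda>x. complex_of_real (V x) * u x * \<psi> x)"
  shows "(LINT x|M. G x \<bullet> gradient (\<lambda>x. L (\<psi> x)) x) = (LINT x|M. V x * (u x \<bullet> L (\<psi> x))) \<longleftrightarrow>
    T (LINT x|M. (\<Sum>i\<in>UNIV. G x $ i * partial_deriv i \<psi> x)) = T (LINT x|M. complex_of_real (V x) * u x * \<psi> x)"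
proof -
  have "(LINT x|M. G x \<bullet> gradient (\<lambda>x. L (\<psi> x)) x) = T (LINT x|M. (\<Sum>i\<in>UNIV. G x $ i * partial_deriv i \<psi> x))"
    unfolding inner_gradient_bounded_linear[OF \<psi> L T LT]
    by (rule integral_bounded_linear[OF T integrable_gradient_pairing[OF wg \<psi>]])
  moreover have "(LINT x|M. V x * (u x \<bullet> L (\<psi> x))) = T (LINT x|M. complex_of_real (V x) * u x * \<psi> x)"
  proof -
    interpret T: bounded_linear T by (rule T)
    have "V x * (u x \<bullet> L (\<psi> x)) = T (complex_of_real (V x) * u x * \<psi> x)" for x
      using T.scaleR[of "V x" "u x * \<psi> x"] by (simp add: LT scaleR_conv_of_real mult.assoc)
    then show ?thesis using integral_bounded_linear[OF T i] by simp
  qed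
  ultimately show ?thesis by (simp only:)
qed

lemma Re_pairing: "bounded_linear cnj" "bounded_linear Re" "z \<bullet> cnj w = Re (z * w)"
  by (auto simp: bounded_linear_cnj bounded_linear_Re inner_complex_def)

lemma Im_pairing: "bounded_linear (\<lambda>w. cnj (- \<i> * w))" "bounded_linear Im" "z \<bullet> cnj (- \<i> * w) = Im (z * w)"
  using bounded_linear_compose[OF bounded_linear_cnj bounded_linear_mult_right[of "- \<i>"]]
  by (auto simp: bounded_linear_Im inner_complex_def)

lemma weak_equation_complex:
  assumes wg: "is_weak_gradient D u G"
    and eq: "\<And>\<psi>. \<psi> \<in> test_functions D \<Longrightarrow> (LINT x|M. G x \<bullet> gradient \<psi> x) = (LINT x|M. V x * (u x \<bullet> \<psi> x))"
    and \<psi>: "\<psi> \<in> test_functions D" and i: "integrable M (\<lambda>x. complex_of_real (V x) * u x * \<psi> x)"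
  shows "(LINT x|M. (\<Sum>i\<in>UNIV. G x $ i * partial_deriv i \<psi> x)) = (LINT x|M. complex_of_real (V x) * u x * \<psi> x)"
proof (rule complex_eqI)
  show "Re (LINT x|M. (\<Sum>i\<in>UNIV. G x $ i * partial_deriv i \<psi> x)) = Re (LINT x|M. complex_of_real (V x) * u x * \<psi> x)"
    using weak_equation_component_iff[OF wg \<psi> Re_pairing i] eq[OF test_functions_bounded_linear[OF \<psi> Re_pairing(1)]] by blast
  show "Im (LINT x|M. (\<Sum>i\<in>UNIV. G x $ i * partial_deriv i \<psi> x)) = Im (LINT x|M. complex_of_real (V x) * u x * \<psi> x)"
    using weak_equation_component_iff[OF wg \<psi> Im_pairing i] eq[OF test_functions_bounded_linear[OF \<psi> Im_pairing(1)]] by blast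
qed

text \<open>The complex equation is tested with the conjugate of \<open>\<phi>\<close>, since the
  real inner product conjugates its second argument once more.\<close>

lemma solution_real_equation:
  assumes s: "schroedinger_solution D V u" and wg: "is_weak_gradient D u (weak_gradient D u)" and \<phi>: "\<phi> \<in> test_functions D"
  shows "(LINT x|M. weak_gradient D u x \<bullet> gradient \<phi> x) = (LINT x|M. V x * (u x \<bullet> \<phi> x))"
proof -
  have \<psi>: "(\<lambda>x. cnj (\<phi> x)) \<in> test_functions D" by (rule test_functions_bounded_linear[OF \<phi> bounded_linear_cnj])
  have "integrable M (\<lambda>x. complex_of_real (V x) * u x * cnj (\<phi> x)) \<and>
    (LINT x|M. (\<Sum>i\<in>UNIV. weak_gradient D u x $ i * partial_deriv i (\<lambda>x. cnj (\<phi> x)) x)) = (LINT x|M. complex_of_real (V x) * u x * cnj (\<phi> x))"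
    by (rule s[unfolded schroedinger_solution_def, THEN conjunct2, THEN bspec, OF \<psi>])
  then show ?thesis using weak_equation_component_iff[OF wg \<psi> Re_pairing, of V] by simp
qed

text \<open>For \<open>V\<close> in L^r and \<open>u\<close> in L^p,
  \<open>V x * (u x \<bullet> w x)\<close> is integrable for every \<open>w\<close> in L^p and its
  integral depends continuously on \<open>w\<close>. Both sides of the real equation therefore
  converge along the approximating test functions, which is what testing with \<open>u\<close>
  means.\<close>

theorem potential_lower_bound:
  assumes r: "1 / ennreal (p / 2) + 1 / r = 1" "r > 1"
    and V: "V \<in> Lp_space r M" and nt: "nontrivial D u" and s: "schroedinger_solution D V u"
  shows "1 \<le> K\<^sup>2 * Lp_norm r M (\<lambda>x. max (V x) 0)"
proof -
  let ?q = "p / 2" and ?G = "weak_gradient D u"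
  obtain \<phi> where ap: "approximates \<phi> u ?G" using s W012_approximates unfolding schroedinger_solution_def by blast
  have wg: "is_weak_gradient D u ?G" by (rule approximates_is_weak_gradient[OF ap])
  have m[measurable]: "u \<in> borel_measurable M" "?G \<in> borel_measurable M" and \<phi>: "\<And>k. \<phi> k \<in> test_functions D"
    and lim: "(\<lambda>k. Lp_norm (ennreal 2) M (\<lambda>x. gradient (\<phi> k) x - ?G x)) \<longlonglongrightarrow> 0"
      "(\<lambda>k. Lp_norm (ennreal p) M (\<lambda>x. \<phi> k x - u x)) \<longlonglongrightarrow> 0"
    using ap by (auto simp: approximates_def)
  have Vm[measurable]: "V \<in> borel_measurable M" and Vfin: "Lp_norm r M V < \<infinity>" using V by (auto simp: Lp_space_def)
  note [measurable] = test_measurable[OF \<phi>] gradient_measurable[OF \<phi>]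
  obtain \<kappa> where \<kappa>: "K = ennreal \<kappa>" "\<kappa> > 0" using sobolev_const_real .
  obtain g where g: "Lp_norm (ennreal 2) M ?G = ennreal g" "g \<ge> 0"
    by (rule ennreal_realE[OF less_imp_neq[OF approximates_finite(1)[OF ap]]])
  have "g \<noteq> 0" using nontrivial_gradient[OF ap nt] g by auto
  then have g0: "g > 0" using g by simp
  obtain a where a: "Lp_norm (ennreal p) M u = ennreal a" "a \<ge> 0"
    by (rule ennreal_realE[OF less_imp_neq[OF approximates_finite(2)[OF ap]]])
  have "ennreal a \<le> ennreal (\<kappa> * g)" using le_sobolev_const[OF ap] a g \<kappa> by (simp add: ennreal_mult)
  then have ag: "a \<le> \<kappa> * g" using g \<kappa> by (subst (asm) ennreal_le_iff) auto
  have q: "?q \<ge> 1" using p_ge_2 by simp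
  \<comment> \<open>Hoelder's inequality with exponents r and p/2, then Cauchy-Schwarz on the
    remaining two factors. It is applied to \<open>V\<close> for integrability and for convergence,
    and to its positive part for the final bound.\<close>
  have three: "(\<integral>\<^sup>+ x. ennreal (norm (W x * (u x \<bullet> w x))) \<partial>M) \<le> Lp_norm r M W * ennreal (a * c)"
    if [measurable]: "W \<in> borel_measurable M" "w \<in> borel_measurable M" and c: "c \<ge> 0" "Lp_norm (ennreal p) M w \<le> ennreal c"
    for W :: "_ \<Rightarrow> real" and w :: "_ \<Rightarrow> complex" and c
  proof -
    have "(\<integral>\<^sup>+ x. ennreal (norm (W x * (u x \<bullet> w x))) \<partial>M) \<le> (\<integral>\<^sup>+ x. ennreal (norm (W x) * norm (norm (u x) * norm (w x))) \<partial>M)"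
      by (intro nn_integral_mono ennreal_leI) (simp add: abs_mult mult_left_mono Cauchy_Schwarz_ineq2)
    also have "\<dots> \<le> Lp_norm r M W * Lp_norm (ennreal ?q) M (\<lambda>x. norm (u x) * norm (w x))"
      by (rule Holder_conjugate[OF _ _ r]) measurable
    also have "\<dots> \<le> Lp_norm r M W * ennreal (a * c)"
      using a c q by (intro mult_left_mono Lp_norm_mult_le) auto
    finally show ?thesis .
  qed
  have int: "integrable M (\<lambda>x. V x * (u x \<bullet> w x))"
    if w[measurable]: "w \<in> borel_measurable M" and wf: "Lp_norm (ennreal p) M w < \<infinity>" for w
  proof (rule integrableI_bounded)
    obtain c where c: "Lp_norm (ennreal p) M w = ennreal c" "c \<ge> 0" by (rule ennreal_realE[OF less_imp_neq[OF wf]])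
    have "(\<integral>\<^sup>+ x. ennreal (norm (V x * (u x \<bullet> w x))) \<partial>M) \<le> Lp_norm r M V * ennreal (a * c)"
      using c by (intro three) auto
    also have "\<dots> < \<infinity>" using Vfin by (simp add: ennreal_mult_less_top)
    finally show "(\<integral>\<^sup>+ x. ennreal (norm (V x * (u x \<bullet> w x))) \<partial>M) < \<infinity>" .
  qed measurable
  have l1: "(\<lambda>k. LINT x|M. V x * (u x \<bullet> \<phi> k x)) \<longlonglongrightarrow> (LINT x|M. V x * (u x \<bullet> u x))"
  proof (rule tendsto_L1_int)
    show "integrable M (\<lambda>x. V x * (u x \<bullet> \<phi> k x))" for k by (intro int test_measurable[OF \<phi>] Lp_norm_test_finite[OF \<phi> p_pos])
    show "integrable M (\<lambda>x. V x * (u x \<bullet> u x))" by (intro int m approximates_finite(2)[OF ap])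
    show "(\<lambda>k. \<integral>\<^sup>+ x. ennreal (norm (V x * (u x \<bullet> \<phi> k x) - V x * (u x \<bullet> u x))) \<partial>M) \<longlonglongrightarrow> 0"
    proof (rule tendsto_sandwich[OF _ _ tendsto_const])
      have "Lp_norm r M V * ennreal a \<noteq> \<infinity>" using Vfin by (simp add: ennreal_mult_eq_top_iff)
      then show "(\<lambda>k. (Lp_norm r M V * ennreal a) * Lp_norm (ennreal p) M (\<lambda>x. \<phi> k x - u x)) \<longlonglongrightarrow> 0"
        using ennreal_tendsto_cmult[OF _ lim(2), of "Lp_norm r M V * ennreal a"] by (simp add: less_top)
      have "(\<integral>\<^sup>+ x. ennreal (norm (V x * (u x \<bullet> \<phi> k x) - V x * (u x \<bullet> u x))) \<partial>M) \<le> (Lp_norm r M V * ennreal a) * Lp_norm (ennreal p) M (\<lambda>x. \<phi> k x - u x)" for k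
      proof -
        have "Lp_norm (ennreal p) M (\<lambda>x. \<phi> k x - u x) \<noteq> \<infinity>"
        proof -
          have "Lp_norm (ennreal p) M (\<lambda>x. \<phi> k x + (-1) *\<^sub>R u x) \<le> Lp_norm (ennreal p) M (\<phi> k) + Lp_norm (ennreal p) M (\<lambda>x. (-1) *\<^sub>R u x)"
            by (intro Lp_norm_triangle p_ge_1) measurable
          also have "\<dots> < \<infinity>" using Lp_norm_test_finite[OF \<phi>, of p k] p_pos a Lp_norm_scaleR[OF m(1) p_pos, of "-1"] by simp
          finally show ?thesis by simp
        qed
        then obtain c where c: "Lp_norm (ennreal p) M (\<lambda>x. \<phi> k x - u x) = ennreal c" "c \<ge> 0" by (rule ennreal_realE)
        have "(\<integral>\<^sup>+ x. ennreal (norm (V x * (u x \<bullet> (\<phi> k x - u x)))) \<partial>M) \<le> Lp_norm r M V * ennreal (a * c)"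
          using c by (intro three) auto
        then show ?thesis using c a by (simp add: inner_diff_right right_diff_distrib ennreal_mult mult.assoc)
      qed
      then show "\<forall>\<^sub>F k in sequentially. (\<integral>\<^sup>+ x. ennreal (norm (V x * (u x \<bullet> \<phi> k x) - V x * (u x \<bullet> u x))) \<partial>M)
         \<le> (Lp_norm r M V * ennreal a) * Lp_norm (ennreal p) M (\<lambda>x. \<phi> k x - u x)" by simp
    qed simp
  qed
  have l2: "(\<lambda>k. LINT x|M. ?G x \<bullet> gradient (\<phi> k) x) \<longlonglongrightarrow> (LINT x|M. ?G x \<bullet> ?G x)"
  proof (rule tendsto_L1_int)
    show "integrable M (\<lambda>x. ?G x \<bullet> gradient (\<phi> k) x)" for k
      using Lp_norm_gradient_finite[OF \<phi>, of 2 k] g by (intro L2_inner_integrable) auto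
    show "integrable M (\<lambda>x. ?G x \<bullet> ?G x)" using g by (intro L2_inner_integrable) auto
    show "(\<lambda>k. \<integral>\<^sup>+ x. ennreal (norm (?G x \<bullet> gradient (\<phi> k) x - ?G x \<bullet> ?G x)) \<partial>M) \<longlonglongrightarrow> 0"
    proof (rule tendsto_sandwich[OF _ _ tendsto_const])
      show "(\<lambda>k. ennreal g * Lp_norm (ennreal 2) M (\<lambda>x. gradient (\<phi> k) x - ?G x)) \<longlonglongrightarrow> 0"
        using ennreal_tendsto_cmult[OF _ lim(1), of "ennreal g"] by simp
      have "(\<integral>\<^sup>+ x. ennreal (norm (?G x \<bullet> gradient (\<phi> k) x - ?G x \<bullet> ?G x)) \<partial>M) \<le> ennreal g * Lp_norm (ennreal 2) M (\<lambda>x. gradient (\<phi> k) x - ?G x)" for k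
        using L2_inner_le[of ?G M "\<lambda>x. gradient (\<phi> k) x - ?G x"] g by (simp add: inner_diff_right)
      then show "\<forall>\<^sub>F k in sequentially. (\<integral>\<^sup>+ x. ennreal (norm (?G x \<bullet> gradient (\<phi> k) x - ?G x \<bullet> ?G x)) \<partial>M)
         \<le> ennreal g * Lp_norm (ennreal 2) M (\<lambda>x. gradient (\<phi> k) x - ?G x)" by simp
    qed simp
  qed
  have "(LINT x|M. ?G x \<bullet> gradient (\<phi> k) x) = (LINT x|M. V x * (u x \<bullet> \<phi> k x))" for k
    by (rule solution_real_equation[OF s wg \<phi>])
  then have "(LINT x|M. ?G x \<bullet> ?G x) = (LINT x|M. V x * (u x \<bullet> u x))" using l1 l2 LIMSEQ_unique by (simp only:) 
  moreover have "(LINT x|M. ?G x \<bullet> ?G x) = g\<^sup>2"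
    using L2_norm_imp_integral(2)[OF m(2) g] by (simp add: power2_norm_eq_inner)
  ultimately have "ennreal (g\<^sup>2) = ennreal (LINT x|M. V x * (u x \<bullet> u x))" by simp
  also have "\<dots> \<le> (\<integral>\<^sup>+ x. ennreal (norm (max (V x) 0 * (u x \<bullet> u x))) \<partial>M)"
  proof -
    \<comment> \<open>The positive part is taken of the whole integrand, whose integrability is
      known; as \<open>u x \<bullet> u x\<close> is nonnegative, this equals the positive part of
      \<open>V\<close> times that factor.\<close>
    have "(LINT x|M. V x * (u x \<bullet> u x)) \<le> (LINT x|M. max (V x * (u x \<bullet> u x)) 0)"
      using int[OF m(1) approximates_finite(2)[OF ap]] by (intro integral_mono integrable_max) auto
    then have "ennreal (LINT x|M. V x * (u x \<bullet> u x)) \<le> ennreal (LINT x|M. max (V x * (u x \<bullet> u x)) 0)" by (rule ennreal_leI)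
    also have "\<dots> = (\<integral>\<^sup>+ x. ennreal (max (V x * (u x \<bullet> u x)) 0) \<partial>M)"
      using int[OF m(1) approximates_finite(2)[OF ap]] by (intro nn_integral_eq_integral[symmetric] integrable_max) auto
    also have "\<dots> = (\<integral>\<^sup>+ x. ennreal (norm (max (V x) 0 * (u x \<bullet> u x))) \<partial>M)"
      by (intro nn_integral_cong arg_cong[where f = ennreal]) (auto simp: max_def mult_le_0_iff zero_le_mult_iff not_le dest: inner_ge_zero[THEN antisym, rotated])
    finally show ?thesis .
  qed
  also have "\<dots> \<le> Lp_norm r M (\<lambda>x. max (V x) 0) * ennreal (a * a)"
    using a by (intro three) auto
  also have "\<dots> \<le> Lp_norm r M (\<lambda>x. max (V x) 0) * ennreal ((\<kappa> * g) * (\<kappa> * g))"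
    using ag a by (intro mult_left_mono ennreal_leI mult_mono) auto
  also have "\<dots> = (ennreal (\<kappa>\<^sup>2) * Lp_norm r M (\<lambda>x. max (V x) 0)) * ennreal (g\<^sup>2)"
    using \<kappa> g by (simp add: ennreal_mult[symmetric] power2_eq_square mult_ac)
      (simp add: ennreal_mult mult_ac)
  \<comment> \<open>The energy cancels because \<open>g\<close> is positive, by nontriviality of
    \<open>u\<close>.\<close>
  finally have "ennreal (g\<^sup>2) / ennreal (g\<^sup>2) \<le> ennreal (\<kappa>\<^sup>2) * Lp_norm r M (\<lambda>x. max (V x) 0)"
    using g0 by (subst ennreal_divide_le_iff) auto
  then show ?thesis using g0 \<kappa> by (simp add: divide_ennreal ennreal_power)
qed

section \<open>The potential of an extremal\<close>

lemma emeasure_M_nonzero: "emeasure M (space M) \<noteq> 0"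
proof
  assume "emeasure M (space M) = 0"
  then have "D \<in> null_sets lebesgue"
    using D_lebesgue by (simp add: emeasure_restrict_space null_sets_def)
  then show False using open_not_negligible[OF open_D D_nonempty] by (simp add: negligible_iff_null_sets)
qed

lemma Lp_norm_power_potential:
  assumes r: "1 / ennreal (p / 2) + 1 / r = 1" "r > 1"
    and [measurable]: "u \<in> borel_measurable M" and a: "Lp_norm (ennreal p) M u = ennreal a" "a > 0" and c: "c > 0"
  shows "Lp_norm r M (\<lambda>x. c * nonneg_power (norm (u x)) (p - 2)) = ennreal (c * a powr (p - 2))"
  using r
proof (cases rule: conjugate_exponent_cases)
  case 1
  \<comment> \<open>At the endpoint \<open>nonneg_power\<close> is the constant 1. The essential
    supremum of a constant is that constant because \<open>M\<close> is not the zero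
    measure.\<close>
  then have "p = 2" by simp
  then show ?thesis
    using 1 a c esssup_const[OF emeasure_M_nonzero, of "ennreal c"] by (simp add: Lp_norm_def nonneg_power_def)
next
  case (2 r')
  have p2: "p > 2" using 2 by simp
  \<comment> \<open>Conjugacy of r' and p/2 in the form that turns the r'-th power of the potential
    into a multiple of the p-th power of \<open>norm (u x)\<close>.\<close>
  have r': "(p - 2) * r' = p"
  proof -
    have "1 / r' = (p - 2) / p" using 2 p2 by (simp add: field_simps)
    then show ?thesis using p2 2 by (simp add: field_simps)
  qed
  have "(\<integral>\<^sup>+ x. ennreal (norm (c * nonneg_power (norm (u x)) (p - 2)) powr r') \<partial>M)
     = (\<integral>\<^sup>+ x. ennreal (c powr r') * ennreal (norm (u x) powr p) \<partial>M)"
    using c p2 r' by (intro nn_integral_cong) (simp add: nonneg_power_def abs_mult powr_mult powr_powr ennreal_mult)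
  also have "\<dots> = ennreal (c powr r') * (\<integral>\<^sup>+ x. ennreal (norm (u x) powr p) \<partial>M)"
    by (intro nn_integral_cmult) measurable
  also have "\<dots> = ennreal (c powr r' * a powr p)"
    using Lp_norm_eqD[OF a(1) p_pos] a by (simp add: ennreal_mult)
  finally have "Lp_norm r M (\<lambda>x. c * nonneg_power (norm (u x)) (p - 2)) = ennreal ((c powr r' * a powr p) powr (1 / r'))"
    unfolding \<open>r = ennreal r'\<close> using 2 by (intro Lp_norm_eqI) auto
  also have "(c powr r' * a powr p) powr (1 / r') = c * a powr (p - 2)"
  proof -
    have "p / r' = p - 2" using r' 2 by (simp add: field_simps)
    then show ?thesis using c a 2 by (simp add: powr_mult powr_powr)
  qed
  finally show ?thesis .
qed

theorem extremal_potential_attains: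
  assumes r: "1 / ennreal (p / 2) + 1 / r = 1" "r > 1" and ex: "sobolev_extremal (p / 2) D u"
  defines "V \<equiv> extremal_potential (p / 2) D u"
  shows "V \<in> Lp_space r M" "schroedinger_solution D V u" "K\<^sup>2 * Lp_norm r M (\<lambda>x. max (V x) 0) = 1"
proof -
  let ?G = "weak_gradient D u"
  have u: "u \<in> W012 D" "nontrivial D u" "K = sobolev_quotient (p / 2) D u" using ex by (auto simp: sobolev_extremal_def)
  obtain \<phi> where ap: "approximates \<phi> u ?G" using W012_approximates[OF u(1)] .
  have wg: "is_weak_gradient D u ?G" by (rule approximates_is_weak_gradient[OF ap])
  have [measurable]: "u \<in> borel_measurable M" using ap by (simp add: approximates_def)
  obtain g where g: "Lp_norm (ennreal 2) M ?G = ennreal g" "g \<ge> 0"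
    by (rule ennreal_realE[OF less_imp_neq[OF approximates_finite(1)[OF ap]]])
  obtain a where a: "Lp_norm (ennreal p) M u = ennreal a" "a \<ge> 0"
    by (rule ennreal_realE[OF less_imp_neq[OF approximates_finite(2)[OF ap]]])
  have "g \<noteq> 0" using nontrivial_gradient[OF ap u(2)] g by auto
  then have g0: "g > 0" using g by simp
  have "a \<noteq> 0" using nontrivial_iff[OF ap] u(2) a by auto
  then have a0: "a > 0" using a by simp
  have K: "K = ennreal (a / g)"
    using u(3) sobolev_quotient_eq[OF ap] g a g0 by (simp add: divide_ennreal)
  define c where "c = g\<^sup>2 / a powr p"
  have c: "c > 0" using a0 g0 by (simp add: c_def)
  have V: "V x = c * nonneg_power (norm (u x)) (p - 2)" for x
    using g a g0 a0 by (simp add: V_def extremal_potential_def c_def)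
  have V': "V = (\<lambda>x. c * nonneg_power (norm (u x)) (p - 2))" using V by blast
  have Vm: "V \<in> borel_measurable M" unfolding V' by measurable
  have V0: "V x \<ge> 0" for x unfolding V using c nonneg_power_nonneg[of "norm (u x)"] by simp
  have norm_V: "Lp_norm r M V = ennreal (c * a powr (p - 2))"
    unfolding V' by (rule Lp_norm_power_potential[OF r _ a(1) a0 c]) measurable
  \<comment> \<open>Together with \<open>K = ennreal (a / g)\<close> this says that the norm of the
    potential is the inverse square of \<open>K\<close>.\<close>
  have cc: "c * a powr (p - 2) = g\<^sup>2 / a\<^sup>2"
    using a0 by (simp add: c_def powr_diff)
  show "V \<in> Lp_space r M" using Vm norm_V by (simp add: Lp_space_def)
  have "max (V x) 0 = V x" for x using V0[of x] by simp
  then have "K\<^sup>2 * Lp_norm r M (\<lambda>x. max (V x) 0) = ennreal ((a / g)\<^sup>2) * ennreal (g\<^sup>2 / a\<^sup>2)"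
    using norm_V K a0 g0 by (simp add: cc ennreal_power)
  also have "\<dots> = 1" using a0 g0 by (simp add: ennreal_mult[symmetric] power_divide)
  finally show "K\<^sup>2 * Lp_norm r M (\<lambda>x. max (V x) 0) = 1" .
  show "schroedinger_solution D V u"
    unfolding schroedinger_solution_def
  proof (intro conjI ballI u(1))
    fix \<psi> assume \<psi>: "\<psi> \<in> test_functions D"
    have "integrable M (\<lambda>x. complex_of_real c * (complex_of_real (nonneg_power (norm (u x)) (p - 2)) * u x * \<psi> x))"
      by (intro integrable_mult_right integrable_power_test(1)[OF ap \<psi>])
    then show i: "integrable M (\<lambda>x. complex_of_real (V x) * u x * \<psi> x)" by (simp add: V mult.assoc)
    show "(LINT x|M. (\<Sum>i\<in>UNIV. ?G x $ i * partial_deriv i \<psi> x)) = (LINT x|M. complex_of_real (V x) * u x * \<psi> x)"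
    \<comment> \<open>The first variation is a real equation, but it holds in every direction; the
      directions \<open>cnj \<psi>\<close> and \<open>cnj (- \<i> * \<psi>)\<close> yield the two
      parts of the complex one.\<close>
    proof (rule weak_equation_complex[OF wg _ \<psi> i])
      fix \<zeta> assume \<zeta>: "\<zeta> \<in> test_functions D"
      have "(LINT x|M. ?G x \<bullet> gradient \<zeta> x) = c * (LINT x|M. nonneg_power (norm (u x)) (p - 2) * (u x \<bullet> \<zeta> x))"
        unfolding c_def using g0 by (intro Euler_Lagrange[OF ap g(1) g0 a(1) a0 K _ \<zeta>]) simp
      also have "\<dots> = (LINT x|M. V x * (u x \<bullet> \<zeta> x))" by (simp add: V mult.assoc)
      finally show "(LINT x|M. ?G x \<bullet> gradient \<zeta> x) = (LINT x|M. V x * (u x \<bullet> \<zeta> x))" .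
    qed
  qed
qed

end

text \<open>At the exponent 2q positivity of the gain reads (n - 2)(q - 1) < 2. For finite r, q - 1
  = 1 / (r - 1), so this is n < 2r; for infinite r the left side is zero.\<close>

lemma sobolev_gain_pos:
  fixes r :: ennreal and q :: real
  assumes "ennreal (max 1 (real CARD('n::finite) / 2)) < r" "1 / ennreal q + 1 / r = 1"
  shows "q \<ge> 1" "sobolev_gain TYPE('n) (2 * q) > 0"
proof -
  have "ennreal 1 \<le> ennreal (max 1 (real CARD('n) / 2))" by (intro ennreal_leI) simp
  then have r1: "r > 1" using assms(1) by (metis ennreal_1 le_less_trans)
  have "q \<ge> 1 \<and> (real CARD('n) - 2) * (q - 1) < 2"
    using assms(2) r1
  proof (cases rule: conjugate_exponent_cases)
    case (2 r')
    then have n: "real CARD('n) < 2 * r'" using assms(1) by (simp add: ennreal_less_iff)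
    have "1 / q = (r' - 1) / r'" using 2 by (simp add: field_simps)
    then have q: "q = r' / (r' - 1)" using 2 by (simp add: field_simps)
    have "q - 1 = 1 / (r' - 1)" using 2 by (subst q) (simp add: field_simps)
    moreover have "(real CARD('n) - 2) * (1 / (r' - 1)) < 2" using n 2 by (simp add: pos_divide_less_eq)
    ultimately show ?thesis using 2 by (simp only:) simp
  qed simp
  then show q: "q \<ge> 1" and "sobolev_gain TYPE('n) (2 * q) > 0"
    unfolding sobolev_gain_def by (auto simp: field_simps intro!: divide_pos_pos)
qed

theorem theorem1p1:
  fixes D :: "(real^'n::finite) set" and r :: ennreal and q :: real
  assumes "open D" and "connected D" and "D \<noteq> {}" and "bounded D"
    and "ennreal (max 1 (real CARD('n) / 2)) < r"
    and "1 / ennreal q + 1 / r = 1"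
  shows "(\<forall>V u. V \<in> Lp_space r (lebesgue_on D) \<and> nontrivial D u \<and> schroedinger_solution D V u \<longrightarrow>
            (sobolev_const q D)\<^sup>2 * Lp_norm r (lebesgue_on D) (\<lambda>x. max (V x) 0) \<ge> 1)
       \<and> (\<exists>u. sobolev_extremal q D u)
       \<and> (\<forall>u. sobolev_extremal q D u \<longrightarrow>
            (let V = extremal_potential q D u in
               V \<in> Lp_space r (lebesgue_on D) \<and> schroedinger_solution D V u \<and>
               (sobolev_const q D)\<^sup>2 * Lp_norm r (lebesgue_on D) (\<lambda>x. max (V x) 0) = 1))"
proof -
  have q: "q \<ge> 1" "sobolev_gain TYPE('n) (2 * q) > 0"
    by (rule sobolev_gain_pos[OF assms(5,6)])+
  \<comment> \<open>With the locale exponent \<open>2 * q\<close> the \<open>p / 2\<close> in its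
    results simplifies back to \<open>q\<close>.\<close>
  interpret nonempty_subcritical_domain D "2 * q"
    by unfold_locales (use assms q in auto)
  have "ennreal 1 \<le> ennreal (max 1 (real CARD('n) / 2))" by (intro ennreal_leI) simp
  then have r: "1 / ennreal (2 * q / 2) + 1 / r = 1" "r > 1"
    using assms(5,6) by (simp, metis ennreal_1 le_less_trans)
  show ?thesis
    using potential_lower_bound[OF r] exists_extremal extremal_potential_attains[OF r]
    by (auto simp: Let_def)
qed

end
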